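(* Let $A$ be a commutative ring, $n\ge 0$ an integer, $F\in\mathrm{Mat}_n(A)$ with $F^2=F$, and let $M$ be the finitely generated projective $A$-module equal to the image of $F$ in $A^n$. Define a polynomial $R(X)=r_0+r_1X+\cdots+r_nX^n\in A[X]$ by $R(1+X)=\det(\mathrm{I}_n+XF)$. Then: (1) $(r_0,r_1,\ldots,r_n)$ is a fundamental system of orthogonal idempotents of $A$. (2) For every $k\in\{0,\ldots,n\}$, all minors of order $k+1$ of the matrix $r_kF$ are zero. (3) For every $k\in\{0,\ldots,n\}$, if $s$ is a diagonal minor of order $k$ of $r_kF$, then the module $M_s$ is free of rank $k$ over the ring $A_s$.
   Context: A fundamental system of orthogonal idempotents of $A$ is a list $(r_0,\ldots,r_n)$ of elements of $A$ with $r_ir_j=0$ for $i\ne j$ and $\sum_i r_i=1$ (some $r_i$ may be zero). A diagonal minor is a principal minor (same row and column indices). For $s\in A$, $A_s=A[1/s]$ and $M_s$ is the corresponding localization of $M$; $s=0$ (or nilpotent) is allowed, in which case $A_s$ is the trivial ring. By convention the (trivial) module over the trivial ring is considered free of rank $k$ for every integer $k\ge 0$. The matrix $r_kF$ is regarded as having entries in the ring $r_kA\simeq A_{r_k}$ (with unit $r_k$); thus for $k=0$ the only diagonal minor of order $0$ of $r_0F$ is $s=r_0$. For $k\geq 1$ the diagonal minors of order $k$ of $r_kF$ are the elements $r_kt$ with $t$ a diagonal minor of order $k$ of $F$. *)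

theory Defs
  imports "HOL-Algebra.UnivPoly" "HOL-Combinatorics.Permutations"
begin

text \<open>
  Rings are records of HOL-Algebra, so that the trivial ring is allowed both as base ring and
  as localization. An \<open>n\<close> by \<open>n\<close> matrix over a ring \<open>R\<close> is a function
  \<open>F :: nat \<Rightarrow> nat \<Rightarrow> 'a\<close> of which only the entries \<open>F i j\<close> with \<open>i < n\<close> and \<open>j < n\<close> matter.
\<close>

section \<open>Matrices, determinants and minors over a commutative ring\<close>

definition is_mat :: "('a, 'm) ring_scheme \<Rightarrow> nat \<Rightarrow> (nat \<Rightarrow> nat \<Rightarrow> 'a) \<Rightarrow> bool" where
  "is_mat R n F \<longleftrightarrow> (\<forall>i<n. \<forall>j<n. F i j \<in> carrier R)"

definition mat_mult ::
  "('a, 'm) ring_scheme \<Rightarrow> nat \<Rightarrow> (nat \<Rightarrow> nat \<Rightarrow> 'a) \<Rightarrow> (nat \<Rightarrow> nat \<Rightarrow> 'a) \<Rightarrow> nat \<Rightarrow> nat \<Rightarrow> 'a" where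
  "mat_mult R n F G i j = (\<Oplus>\<^bsub>R\<^esub>l\<in>{..<n}. F i l \<otimes>\<^bsub>R\<^esub> G l j)"

definition idempotent_mat :: "('a, 'm) ring_scheme \<Rightarrow> nat \<Rightarrow> (nat \<Rightarrow> nat \<Rightarrow> 'a) \<Rightarrow> bool" where
  "idempotent_mat R n F \<longleftrightarrow> (\<forall>i<n. \<forall>j<n. mat_mult R n F F i j = F i j)"

definition mat_det :: "('a, 'm) ring_scheme \<Rightarrow> nat \<Rightarrow> (nat \<Rightarrow> nat \<Rightarrow> 'a) \<Rightarrow> 'a" where
  "mat_det R n F =
    (\<Oplus>\<^bsub>R\<^esub>p\<in>{p. p permutes {..<n}}. [sign p] \<cdot>\<^bsub>R\<^esub> (\<Otimes>\<^bsub>R\<^esub>i\<in>{..<n}. F i (p i)))"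

text \<open>The submatrix with rows in \<open>I\<close> and columns in \<open>J\<close>, both listed in increasing order.\<close>

definition submat :: "(nat \<Rightarrow> nat \<Rightarrow> 'a) \<Rightarrow> nat set \<Rightarrow> nat set \<Rightarrow> nat \<Rightarrow> nat \<Rightarrow> 'a" where
  "submat F I J i j = F (sorted_list_of_set I ! i) (sorted_list_of_set J ! j)"

definition minors ::
  "('a, 'm) ring_scheme \<Rightarrow> nat \<Rightarrow> (nat \<Rightarrow> nat \<Rightarrow> 'a) \<Rightarrow> nat \<Rightarrow> 'a set" where
  "minors R n F k =
    {mat_det R k (submat F I J) |I J. I \<subseteq> {..<n} \<and> J \<subseteq> {..<n} \<and> card I = k \<and> card J = k}"

definition diagonal_minors ::
  "('a, 'm) ring_scheme \<Rightarrow> nat \<Rightarrow> (nat \<Rightarrow> nat \<Rightarrow> 'a) \<Rightarrow> nat \<Rightarrow> 'a set" where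
  "diagonal_minors R n F k = {mat_det R k (submat F I I) |I. I \<subseteq> {..<n} \<and> card I = k}"

text \<open>
  For an idempotent \<open>e\<close> this is the ring \<open>eR\<close>, whose unit is \<open>e\<close>. In particular the determinant
  of the empty matrix over \<open>eR\<close> is \<open>e\<close>.
\<close>

definition idem_ring :: "('a, 'm) ring_scheme \<Rightarrow> 'a \<Rightarrow> ('a, 'm) ring_scheme" where
  "idem_ring R e = R\<lparr>carrier := {e \<otimes>\<^bsub>R\<^esub> a |a. a \<in> carrier R}, one := e\<rparr>"

definition scale_mat ::
  "('a, 'm) ring_scheme \<Rightarrow> 'a \<Rightarrow> (nat \<Rightarrow> nat \<Rightarrow> 'a) \<Rightarrow> nat \<Rightarrow> nat \<Rightarrow> 'a" where
  "scale_mat R a F i j = a \<otimes>\<^bsub>R\<^esub> F i j"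

definition fundamental_system_idempotents ::
  "('a, 'm) ring_scheme \<Rightarrow> nat \<Rightarrow> (nat \<Rightarrow> 'a) \<Rightarrow> bool" where
  "fundamental_system_idempotents R n r \<longleftrightarrow>
    (\<forall>i\<le>n. r i \<in> carrier R) \<and>
    (\<forall>i\<le>n. \<forall>j\<le>n. i \<noteq> j \<longrightarrow> r i \<otimes>\<^bsub>R\<^esub> r j = \<zero>\<^bsub>R\<^esub>) \<and>
    (\<Oplus>\<^bsub>R\<^esub>i\<in>{..n}. r i) = \<one>\<^bsub>R\<^esub>"

section \<open>The polynomial \<open>R(X)\<close>\<close>

definition poly_const :: "('a, 'm) ring_scheme \<Rightarrow> 'a \<Rightarrow> nat \<Rightarrow> 'a" where
  "poly_const R a = monom (UP R) a 0"

definition poly_var :: "('a, 'm) ring_scheme \<Rightarrow> nat \<Rightarrow> 'a" where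
  "poly_var R = monom (UP R) \<one>\<^bsub>R\<^esub> 1"

text \<open>The matrix \<open>I + XF\<close> over \<open>R[X]\<close>.\<close>

definition one_plus_X_mat ::
  "('a, 'm) ring_scheme \<Rightarrow> (nat \<Rightarrow> nat \<Rightarrow> 'a) \<Rightarrow> nat \<Rightarrow> nat \<Rightarrow> nat \<Rightarrow> 'a" where
  "one_plus_X_mat R F i j =
    (if i = j then \<one>\<^bsub>UP R\<^esub> else \<zero>\<^bsub>UP R\<^esub>) \<oplus>\<^bsub>UP R\<^esub> poly_var R \<otimes>\<^bsub>UP R\<^esub> poly_const R (F i j)"

text \<open>The polynomial \<open>P\<close> of formal degree \<open>n\<close> with \<open>P(1 + X) = det (I + XF)\<close>.\<close>

definition rank_polynomial ::
  "('a, 'm) ring_scheme \<Rightarrow> nat \<Rightarrow> (nat \<Rightarrow> nat \<Rightarrow> 'a) \<Rightarrow> nat \<Rightarrow> 'a" where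
  "rank_polynomial R n F =
    (THE P. P \<in> carrier (UP R) \<and> deg R P \<le> n \<and>
      eval R (UP R) (poly_const R) (\<one>\<^bsub>UP R\<^esub> \<oplus>\<^bsub>UP R\<^esub> poly_var R) P =
        mat_det (UP R) n (one_plus_X_mat R F))"

section \<open>Free modules and the image of a matrix\<close>

text \<open>
  In the module records below the fields \<open>mult\<close> and \<open>one\<close>, inherited from rings, play no role.
\<close>

definition standard_module :: "('a, 'm) ring_scheme \<Rightarrow> nat \<Rightarrow> ('a, nat \<Rightarrow> 'a) module" where
  "standard_module R n =
    \<lparr>carrier = {..<n} \<rightarrow>\<^sub>E carrier R, monoid.mult = undefined, monoid.one = undefined,
     zero = (\<lambda>i\<in>{..<n}. \<zero>\<^bsub>R\<^esub>),
     add = (\<lambda>v w. \<lambda>i\<in>{..<n}. v i \<oplus>\<^bsub>R\<^esub> w i),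
     smult = (\<lambda>a v. \<lambda>i\<in>{..<n}. a \<otimes>\<^bsub>R\<^esub> v i)\<rparr>"

definition mat_vec ::
  "('a, 'm) ring_scheme \<Rightarrow> nat \<Rightarrow> (nat \<Rightarrow> nat \<Rightarrow> 'a) \<Rightarrow> (nat \<Rightarrow> 'a) \<Rightarrow> nat \<Rightarrow> 'a" where
  "mat_vec R n F v = (\<lambda>i\<in>{..<n}. \<Oplus>\<^bsub>R\<^esub>j\<in>{..<n}. F i j \<otimes>\<^bsub>R\<^esub> v j)"

definition image_module ::
  "('a, 'm) ring_scheme \<Rightarrow> nat \<Rightarrow> (nat \<Rightarrow> nat \<Rightarrow> 'a) \<Rightarrow> ('a, nat \<Rightarrow> 'a) module" where
  "image_module R n F =
    (standard_module R n)\<lparr>carrier := mat_vec R n F ` carrier (standard_module R n)\<rparr>"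

definition module_iso ::
  "('a, 'm) ring_scheme \<Rightarrow> ('a, 'b, 'k) module_scheme \<Rightarrow> ('a, 'c, 'l) module_scheme
    \<Rightarrow> ('b \<Rightarrow> 'c) set" where
  "module_iso R M N =
    {h. bij_betw h (carrier M) (carrier N) \<and>
        (\<forall>x\<in>carrier M. \<forall>y\<in>carrier M. h (x \<oplus>\<^bsub>M\<^esub> y) = h x \<oplus>\<^bsub>N\<^esub> h y) \<and>
        (\<forall>a\<in>carrier R. \<forall>x\<in>carrier M. h (a \<odot>\<^bsub>M\<^esub> x) = a \<odot>\<^bsub>N\<^esub> h x)}"

text \<open>
  Over the trivial ring, \<open>R\<^sup>k\<close> is trivial for every \<open>k\<close>; so the trivial module is then free of
  every rank.
\<close>

definition free_of_rank ::
  "('a, 'm) ring_scheme \<Rightarrow> ('a, 'b, 'k) module_scheme \<Rightarrow> nat \<Rightarrow> bool" where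
  "free_of_rank R M k \<longleftrightarrow> module R M \<and> module_iso R (standard_module R k) M \<noteq> {}"

section \<open>Localization\<close>

definition powers :: "('a, 'm) ring_scheme \<Rightarrow> 'a \<Rightarrow> 'a set" where
  "powers R s = {s [^]\<^bsub>R\<^esub> (m::nat) |m. True}"

definition regular_module :: "('a, 'm) ring_scheme \<Rightarrow> ('a, 'a) module" where
  "regular_module R =
    \<lparr>carrier = carrier R, monoid.mult = monoid.mult R, monoid.one = \<one>\<^bsub>R\<^esub>, zero = \<zero>\<^bsub>R\<^esub>, add = add R,
     smult = monoid.mult R\<rparr>"

text \<open>\<open>x/s = y/t\<close> holds iff \<open>u t x = u s y\<close> for some \<open>u\<close> in \<open>S\<close>.\<close>

definition frac_rel ::
  "('a, 'b, 'k) module_scheme \<Rightarrow> 'a set \<Rightarrow> (('b \<times> 'a) \<times> ('b \<times> 'a)) set" where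
  "frac_rel M S =
    {((x, s), (y, t)) |x s y t. x \<in> carrier M \<and> y \<in> carrier M \<and> s \<in> S \<and> t \<in> S \<and>
      (\<exists>u\<in>S. u \<odot>\<^bsub>M\<^esub> (t \<odot>\<^bsub>M\<^esub> x) = u \<odot>\<^bsub>M\<^esub> (s \<odot>\<^bsub>M\<^esub> y))}"

definition frac :: "('a, 'b, 'k) module_scheme \<Rightarrow> 'a set \<Rightarrow> 'b \<Rightarrow> 'a \<Rightarrow> ('b \<times> 'a) set" where
  "frac M S x s = frac_rel M S `` {(x, s)}"

text \<open>
  As usual for operations on quotients, the unions range over all representatives of the
  arguments; all their members are equal.
\<close>

definition loc_ring :: "('a, 'm) ring_scheme \<Rightarrow> 'a set \<Rightarrow> ('a \<times> 'a) set ring" where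
  "loc_ring R S = (let Q = frac (regular_module R) S in
    \<lparr>carrier = {Q a s |a s. a \<in> carrier R \<and> s \<in> S},
     monoid.mult = (\<lambda>X Y. \<Union>(a, s)\<in>X. \<Union>(b, t)\<in>Y. Q (a \<otimes>\<^bsub>R\<^esub> b) (s \<otimes>\<^bsub>R\<^esub> t)),
     monoid.one = Q \<one>\<^bsub>R\<^esub> \<one>\<^bsub>R\<^esub>,
     zero = Q \<zero>\<^bsub>R\<^esub> \<one>\<^bsub>R\<^esub>,
     add = (\<lambda>X Y. \<Union>(a, s)\<in>X. \<Union>(b, t)\<in>Y. Q (t \<otimes>\<^bsub>R\<^esub> a \<oplus>\<^bsub>R\<^esub> s \<otimes>\<^bsub>R\<^esub> b) (s \<otimes>\<^bsub>R\<^esub> t))\<rparr>)"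

definition loc_module ::
  "('a, 'm) ring_scheme \<Rightarrow> ('a, 'b, 'k) module_scheme \<Rightarrow> 'a set
    \<Rightarrow> (('a \<times> 'a) set, ('b \<times> 'a) set) module" where
  "loc_module R M S =
    \<lparr>carrier = {frac M S x s |x s. x \<in> carrier M \<and> s \<in> S}, monoid.mult = undefined, monoid.one = undefined,
     zero = frac M S \<zero>\<^bsub>M\<^esub> \<one>\<^bsub>R\<^esub>,
     add = (\<lambda>X Y. \<Union>(x, s)\<in>X. \<Union>(y, t)\<in>Y. frac M S (t \<odot>\<^bsub>M\<^esub> x \<oplus>\<^bsub>M\<^esub> s \<odot>\<^bsub>M\<^esub> y) (s \<otimes>\<^bsub>R\<^esub> t)),
     smult = (\<lambda>X Y. \<Union>(a, s)\<in>X. \<Union>(y, t)\<in>Y. frac M S (a \<odot>\<^bsub>M\<^esub> y) (s \<otimes>\<^bsub>R\<^esub> t))\<rparr>"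

end

theory Submission
  imports Defs
begin

text \<open>
Let \<open>G(X) = (I - F) + X F\<close>, so that \<open>R(X) = det G(X)\<close>. Since \<open>F\<close> and \<open>I - F\<close> are orthogonal
idempotents, \<open>G(X) G(Y) = G(X Y)\<close>. Taking determinants, \<open>R(X) R(Y) = R(X Y)\<close>; comparing
coefficients gives \<open>r\<^sub>i r\<^sub>j = 0\<close> for \<open>i \<noteq> j\<close> and \<open>r\<^sub>i\<^sup>2 = r\<^sub>i\<close> (\<open>rank_idem_mult\<close>). As \<open>G(1) = I\<close>, the \<open>r\<^sub>i\<close> add up
to 1 (\<open>rank_idem_sum\<close>).

The component of \<open>r\<^sub>k\<close> is the part where \<open>M\<close> has rank \<open>k\<close>: there \<open>det G(X) = X\<^sup>k\<close>. The matrix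
\<open>H(X) = X (I - F) + F\<close> satisfies \<open>H G = X I\<close>, and Jacobi's complementary minor argument shows that
\<open>X\<^sup>k\<^sup>+\<^sup>1\<close> divides \<open>X\<^sup>k\<close> times every minor of order \<open>k + 1\<close> of \<open>H\<close>. Setting \<open>X = 0\<close>, the minors of
order \<open>k + 1\<close> of \<open>r\<^sub>kF\<close> are zero (\<open>rank_idem_minor_zero\<close>). No passage to a localization over which
\<open>M\<close> is free is involved, hence no choice of prime ideals or covering.

Let finally \<open>s = r\<^sub>k t\<close> with \<open>t\<close> a diagonal minor of order \<open>k\<close>. Once \<open>s\<close> is inverted, \<open>F\<close> has an
invertible minor of order \<open>k\<close> while those of order \<open>k + 1\<close> vanish, and Cramer's rule makes the \<open>k\<close> columns of
that minor a basis of the image (\<open>image_module_localization_free\<close>). Both halves of this are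
statements over \<open>A\<close> up to a factor \<open>s\<close>, which \<open>loc_module_free\<close> transfers to fractions.
\<close>

section \<open>Finite sums and products\<close>

lemma (in abelian_monoid) finsum_nested_swap:
  assumes "finite I" "finite J" "\<And>i j. i \<in> I \<Longrightarrow> j \<in> J \<Longrightarrow> f i j \<in> carrier G"
  shows "(\<Oplus>i\<in>I. \<Oplus>j\<in>J. f i j) = (\<Oplus>j\<in>J. \<Oplus>i\<in>I. f i j)"
  using assms(1,3)
proof (induction I rule: finite_induct)
  case empty
  then show ?case by simp
next
  case (insert x I)
  show ?case
  proof -
    have "(\<Oplus>j\<in>J. \<Oplus>i\<in>insert x I. f i j) = (\<Oplus>j\<in>J. f x j \<oplus> (\<Oplus>i\<in>I. f i j))"
      using insert by (intro finsum_cong') (auto intro!: finsum_closed)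
    also have "\<dots> = (\<Oplus>j\<in>J. f x j) \<oplus> (\<Oplus>j\<in>J. \<Oplus>i\<in>I. f i j)"
      using insert by (intro finsum_addf) (auto intro!: finsum_closed)
    finally show ?thesis using insert by (subst finsum_insert) (auto intro!: finsum_closed)
  qed
qed

lemma (in abelian_monoid) finsum_Times:
  assumes "finite I" "finite J" "\<And>i j. i \<in> I \<Longrightarrow> j \<in> J \<Longrightarrow> f (i, j) \<in> carrier G"
  shows "(\<Oplus>z\<in>I \<times> J. f z) = (\<Oplus>i\<in>I. \<Oplus>j\<in>J. f (i, j))"
  using assms(1,3)
proof (induction I rule: finite_induct)
  case empty
  then show ?case by simp
next
  case (insert x I)
  have "insert x I \<times> J = Pair x ` J \<union> I \<times> J" by auto
  moreover have "finsum G f (Pair x ` J) = (\<Oplus>j\<in>J. f (x, j))"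
    using insert.prems by (intro finsum_reindex) (auto simp: inj_on_def)
  moreover have "Pair x ` J \<inter> I \<times> J = {}" using insert.hyps by auto
  moreover have "f \<in> Pair x ` J \<rightarrow> carrier G" "f \<in> I \<times> J \<rightarrow> carrier G"
    using insert.prems by auto
  ultimately show ?case
    using insert assms(2) by (simp add: finsum_Un_disjoint)
qed

lemma (in abelian_monoid) finsum_single:
  assumes "finite I" "i \<in> I" "f i \<in> carrier G" "\<And>j. j \<in> I \<Longrightarrow> j \<noteq> i \<Longrightarrow> f j = \<zero>"
  shows "finsum G f I = f i"
proof -
  have "finsum G f I = finsum G f {i}"
    using assms by (intro add.finprod_mono_neutral_cong_right funcsetI) (auto, metis zero_closed)
  then show ?thesis using assms by simp
qed

lemma (in cring) finprod_zero_factor: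
  assumes "finite I" "i \<in> I" "f i = \<zero>" "f \<in> I \<rightarrow> carrier R"
  shows "(\<Otimes>j\<in>I. f j) = \<zero>"
proof -
  have "(\<Otimes>j\<in>insert i (I - {i}). f j) = f i \<otimes> (\<Otimes>j\<in>I - {i}. f j)"
    using assms by (intro finprod_insert) auto
  moreover have "insert i (I - {i}) = I" using assms by auto
  moreover have "(\<Otimes>j\<in>I - {i}. f j) \<in> carrier R"
    using assms by (intro finprod_closed) auto
  ultimately show ?thesis using assms by simp
qed

lemma (in cring) finprod_const_pow:
  assumes "c \<in> carrier R"
  shows "(\<Otimes>i\<in>{..<m::nat}. c) = c [^] m"
  using finprod_const[OF assms, of "{..<m}"] by simp

text \<open>
Expanding a product of sums produces one summand for each choice function \<open>g\<close>. This is the first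
step in the multiplicativity of the determinant.
\<close>

lemma (in cring) finprod_finsum_distrib:
  fixes n :: nat
  assumes "finite T" "\<And>i l. i < n \<Longrightarrow> l \<in> T \<Longrightarrow> f i l \<in> carrier R"
  shows "(\<Otimes>i\<in>{..<n}. \<Oplus>l\<in>T. f i l) = (\<Oplus>g\<in>{..<n} \<rightarrow>\<^sub>E T. \<Otimes>i\<in>{..<n}. f i (g i))"
  using assms(2)
proof (induction n)
  case 0
  then show ?case by simp
next
  case (Suc n)
  let ?E = "{..<n} \<rightarrow>\<^sub>E T"
  let ?h = "\<lambda>(l, g). g(n := l)"
  let ?p = "\<lambda>m g. \<Otimes>i\<in>{..<m}. f i (g i)"
  have fin: "finite ?E" using assms(1) by (simp add: finite_PiE)
  have cl: "?p m g \<in> carrier R" if "m \<le> Suc n" "g \<in> {..<m} \<rightarrow>\<^sub>E T" for m g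
    using that Suc.prems by (intro finprod_closed) (fastforce simp: PiE_def Pi_def)
  have upd: "g(n := l) \<in> {..<Suc n} \<rightarrow>\<^sub>E T" if "l \<in> T" "g \<in> ?E" for l g
    using that by (auto simp: lessThan_Suc PiE_insert_eq)
  have step: "?p (Suc n) (g(n := l)) = f n l \<otimes> ?p n g" if "l \<in> T" "g \<in> ?E" for l g
  proof -
    have "?p (Suc n) (g(n := l)) = f n l \<otimes> (\<Otimes>i\<in>{..<n}. f i ((g(n := l)) i))"
      unfolding lessThan_Suc using that Suc.prems
      by (subst finprod_insert) (auto simp: PiE_def Pi_def)
    also have "(\<Otimes>i\<in>{..<n}. f i ((g(n := l)) i)) = ?p n g"
      using that Suc.prems by (intro finprod_cong') (auto simp: PiE_def Pi_def)
    finally show ?thesis .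
  qed
  have "(\<Otimes>i\<in>{..<Suc n}. \<Oplus>l\<in>T. f i l) = (\<Oplus>l\<in>T. f n l) \<otimes> (\<Otimes>i\<in>{..<n}. \<Oplus>l\<in>T. f i l)"
    unfolding lessThan_Suc using Suc.prems
    by (subst finprod_insert) (auto intro!: finsum_closed)
  also have "\<dots> = (\<Oplus>l\<in>T. f n l) \<otimes> (\<Oplus>g\<in>?E. ?p n g)"
    using Suc by simp
  also have "\<dots> = (\<Oplus>l\<in>T. \<Oplus>g\<in>?E. f n l \<otimes> ?p n g)"
  proof -
    have "(\<Oplus>l\<in>T. f n l) \<otimes> (\<Oplus>g\<in>?E. ?p n g) = (\<Oplus>l\<in>T. f n l \<otimes> (\<Oplus>g\<in>?E. ?p n g))"
      using assms(1) Suc.prems cl[of n] by (intro finsum_ldistr) (auto intro!: finsum_closed)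
    also have "\<dots> = (\<Oplus>l\<in>T. \<Oplus>g\<in>?E. f n l \<otimes> ?p n g)"
      using Suc.prems cl[of n] fin
      by (intro finsum_cong') (auto simp del: finprod_closed intro!: finsum_closed finsum_rdistr)
    finally show ?thesis .
  qed
  also have "\<dots> = (\<Oplus>l\<in>T. \<Oplus>g\<in>?E. ?p (Suc n) (g(n := l)))"
    using cl upd
    by (intro finsum_cong' finsum_closed funcsetI step[symmetric] refl) blast+
  also have "\<dots> = (\<Oplus>z\<in>T \<times> ?E. ?p (Suc n) (?h z))"
    using finsum_Times[OF assms(1) fin, of "\<lambda>z. ?p (Suc n) (?h z)"] cl upd
    by (simp del: fun_upd_apply)
  also have "\<dots> = finsum R (?p (Suc n)) (?h ` (T \<times> ?E))"
    using upd cl by (intro finsum_reindex[symmetric]) (auto simp del: fun_upd_apply intro!: inj_combinator)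
  also have "?h ` (T \<times> ?E) = {..<Suc n} \<rightarrow>\<^sub>E T"
    by (simp add: lessThan_Suc PiE_insert_eq)
  finally show ?case .
qed

section \<open>Determinants over a commutative ring\<close>

text \<open>
Taking the sign of a permutation as a ring element, instead of an integer multiple, makes
the Leibniz formula an expression in the ring operations alone; ring homomorphisms and
distributivity then apply to it directly.
\<close>

definition perm_sign :: "('a, 'm) ring_scheme \<Rightarrow> (nat \<Rightarrow> nat) \<Rightarrow> 'a" where
  "perm_sign R p = (if evenperm p then \<one>\<^bsub>R\<^esub> else \<ominus>\<^bsub>R\<^esub> \<one>\<^bsub>R\<^esub>)"

context cring
begin

abbreviation perms :: "nat \<Rightarrow> (nat \<Rightarrow> nat) set" where
  "perms n \<equiv> {p. p permutes {..<n}}"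

lemma finite_perms: "finite (perms n)"
  by (simp add: finite_permutations)

lemma perm_lt: "p permutes {..<n::nat} \<Longrightarrow> i < n \<Longrightarrow> p i < n"
  by (metis lessThan_iff permutes_in_image)

lemma perm_permutation: "p permutes {..<n::nat} \<Longrightarrow> permutation p"
  using permutes_imp_permutation by blast

lemma perm_sign_closed [simp, intro]: "perm_sign R p \<in> carrier R"
  by (simp add: perm_sign_def)

lemma perm_sign_id [simp]: "perm_sign R id = \<one>"
  by (simp add: perm_sign_def)

lemma perm_sign_comp:
  "permutation p \<Longrightarrow> permutation q \<Longrightarrow> perm_sign R (p \<circ> q) = perm_sign R p \<otimes> perm_sign R q"
  by (auto simp: perm_sign_def evenperm_comp l_minus)

lemma perm_sign_inv: "permutation p \<Longrightarrow> perm_sign R (Hilbert_Choice.inv p) = perm_sign R p"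
  by (simp add: perm_sign_def evenperm_inv)

lemma perm_sign_square [simp]: "perm_sign R p \<otimes> perm_sign R p = \<one>"
  by (auto simp: perm_sign_def l_minus)

lemma perm_sign_transpose: "a \<noteq> b \<Longrightarrow> perm_sign R (transpose a b) = \<ominus> \<one>"
  by (simp add: perm_sign_def evenperm_swap)

lemma sign_add_pow: "x \<in> carrier R \<Longrightarrow> [sign p] \<cdot> x = perm_sign R p \<otimes> x"
  by (auto simp: perm_sign_def sign_def l_minus add_pow_int_ge add_pow_int_lt)

lemma is_matD: "is_mat R n F \<Longrightarrow> i < n \<Longrightarrow> j < n \<Longrightarrow> F i j \<in> carrier R"
  by (simp add: is_mat_def)

lemma perm_prod_closed:
  assumes "is_mat R n F" "p permutes {..<n}"
  shows "(\<Otimes>i\<in>{..<n}. F i (p i)) \<in> carrier R"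
  using assms by (intro finprod_closed) (auto simp: is_matD perm_lt)

lemma mat_det_perm_sign:
  assumes "is_mat R n F"
  shows "mat_det R n F = (\<Oplus>p\<in>perms n. perm_sign R p \<otimes> (\<Otimes>i\<in>{..<n}. F i (p i)))"
  unfolding mat_det_def
  by (intro finsum_cong') (auto simp: sign_add_pow perm_prod_closed assms)

lemma mat_det_closed:
  assumes "is_mat R n F"
  shows "mat_det R n F \<in> carrier R"
  unfolding mat_det_perm_sign[OF assms] by (auto simp: perm_prod_closed assms intro!: finsum_closed)

lemma mat_det_cong:
  assumes "is_mat R n F" "\<And>i j. i < n \<Longrightarrow> j < n \<Longrightarrow> F i j = G i j"
  shows "mat_det R n F = mat_det R n G"
proof -
  have G: "is_mat R n G" using assms by (simp add: is_mat_def)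
  have "(\<Otimes>i\<in>{..<n}. F i (p i)) = (\<Otimes>i\<in>{..<n}. G i (p i))" if "p permutes {..<n}" for p
    using that assms(2) by (intro finprod_cong') (auto simp: perm_lt is_matD[OF G])
  then show ?thesis
    unfolding mat_det_perm_sign[OF assms(1)] mat_det_perm_sign[OF G]
    by (intro finsum_cong') (auto simp: perm_prod_closed G)
qed

lemma finprod_permute:
  assumes "p permutes {..<n::nat}" "f \<in> {..<n} \<rightarrow> carrier R"
  shows "(\<Otimes>i\<in>{..<n}. f (p i)) = (\<Otimes>i\<in>{..<n}. f i)"
  using finprod_reindex[of f p "{..<n}"] assms
  by (simp add: permutes_image permutes_inj_on)

lemma finsum_perms_reindex:
  assumes "bij_betw \<phi> (perms n) (perms n)" "\<And>p. p \<in> perms n \<Longrightarrow> f p \<in> carrier R"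
  shows "(\<Oplus>p\<in>perms n. f p) = (\<Oplus>p\<in>perms n. f (\<phi> p))"
  using finsum_reindex[of f \<phi> "perms n"] assms
  by (auto simp: bij_betw_def Pi_def)

lemma bij_betw_perms_left:
  assumes "q permutes {..<n}"
  shows "bij_betw (\<lambda>p. q \<circ> p) (perms n) (perms n)"
  using assms permutes_inv[OF assms]
  by (intro bij_betw_byWitness[of _ "\<lambda>p. Hilbert_Choice.inv q \<circ> p"])
    (auto simp: comp_assoc[symmetric] permutes_inv_o[OF assms] intro: permutes_compose)

lemma bij_betw_perms_inv: "bij_betw Hilbert_Choice.inv (perms n) (perms n)"
  using inv_inj_on_permutes[of "{..<n}"] image_inverse_permutations[of "{..<n}"]
  unfolding bij_betw_def by (auto simp: image_def)

lemma mat_det_transpose: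
  assumes "is_mat R n F"
  shows "mat_det R n (\<lambda>i j. F j i) = mat_det R n F"
proof -
  have T: "is_mat R n (\<lambda>i j. F j i)" using assms by (simp add: is_mat_def)
  have "(\<Otimes>i\<in>{..<n}. F i (Hilbert_Choice.inv p i)) = (\<Otimes>i\<in>{..<n}. F (p i) i)" if "p permutes {..<n}" for p
    using finprod_permute[OF that, of "\<lambda>i. F i (Hilbert_Choice.inv p i)"] that
    by (auto simp: is_matD[OF assms] perm_lt permutes_inv permutes_inverses)
  then show ?thesis
    unfolding mat_det_perm_sign[OF assms] mat_det_perm_sign[OF T]
    by (subst (2) finsum_perms_reindex[OF bij_betw_perms_inv])
      (auto intro!: finsum_cong' simp: perm_prod_closed[OF assms] perm_prod_closed[OF T] perm_sign_inv perm_permutation)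
qed

lemma mat_det_permute_cols:
  assumes "is_mat R n F" "q permutes {..<n}"
  shows "mat_det R n (\<lambda>i j. F i (q j)) = perm_sign R q \<otimes> mat_det R n F"
proof -
  have Q: "is_mat R n (\<lambda>i j. F i (q j))" using assms by (simp add: is_mat_def perm_lt)
  let ?t = "\<lambda>p. perm_sign R p \<otimes> (\<Otimes>i\<in>{..<n}. F i (p i))"
  have "perm_sign R q \<otimes> mat_det R n F = perm_sign R q \<otimes> (\<Oplus>p\<in>perms n. ?t (q \<circ> p))"
    unfolding mat_det_perm_sign[OF assms(1)]
    by (subst finsum_perms_reindex[OF bij_betw_perms_left[OF assms(2)]])
       (auto simp: perm_prod_closed[OF assms(1)])
  also have "\<dots> = (\<Oplus>p\<in>perms n. perm_sign R q \<otimes> ?t (q \<circ> p))"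
    using perm_prod_closed[OF assms(1) permutes_compose[OF _ assms(2)]] 
    by (intro finsum_rdistr finite_perms) (auto simp: comp_def)
  also have "\<dots> = mat_det R n (\<lambda>i j. F i (q j))"
    unfolding mat_det_perm_sign[OF Q]
  proof (intro finsum_cong' refl funcsetI)
    fix p assume p: "p \<in> perms n"
    then have cl: "(\<Otimes>i\<in>{..<n}. F i (q (p i))) \<in> carrier R"
      using perm_prod_closed[OF Q, of p] by simp
    then show "perm_sign R p \<otimes> (\<Otimes>i\<in>{..<n}. F i (q (p i))) \<in> carrier R" by simp
    have "perm_sign R (q \<circ> p) = perm_sign R q \<otimes> perm_sign R p"
      using p assms(2) by (simp add: perm_sign_comp perm_permutation)
    moreover have "perm_sign R q \<otimes> (perm_sign R q \<otimes> perm_sign R p \<otimes> (\<Otimes>i\<in>{..<n}. F i (q (p i))))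
      = perm_sign R p \<otimes> (\<Otimes>i\<in>{..<n}. F i (q (p i)))"
      using cl by (simp add: m_assoc[symmetric])
    ultimately show "perm_sign R q \<otimes> ?t (q \<circ> p) = perm_sign R p \<otimes> (\<Otimes>i\<in>{..<n}. F i (q (p i)))"
      by simp
  qed
  finally show ?thesis by simp
qed

lemma mat_det_permute_rows:
  assumes "is_mat R n F" "q permutes {..<n}"
  shows "mat_det R n (\<lambda>i j. F (q i) j) = perm_sign R q \<otimes> mat_det R n F"
proof -
  have T: "is_mat R n (\<lambda>i j. F j i)" "is_mat R n (\<lambda>i j. F (q i) j)"
    using assms by (simp_all add: is_mat_def perm_lt)
  show ?thesis
    using mat_det_permute_cols[OF T(1) assms(2)] mat_det_transpose[OF T(2)] mat_det_transpose[OF assms(1)]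
    by simp
qed

text \<open>
In a ring where 2 may be a zero divisor, antisymmetry does not give this. The
transposition of the two rows pairs each even permutation with an odd one, and the two terms of
the Leibniz formula cancel.
\<close>

lemma mat_det_equal_rows:
  assumes F: "is_mat R n F" and ab: "a < n" "b < n" "a \<noteq> b"
    and eq: "\<And>j. j < n \<Longrightarrow> F a j = F b j"
  shows "mat_det R n F = \<zero>"
proof -
  let ?\<tau> = "transpose a b"
  let ?t = "\<lambda>p. perm_sign R p \<otimes> (\<Otimes>i\<in>{..<n}. F i (p i))"
  let ?E = "{p \<in> perms n. evenperm p}" and ?O = "{p \<in> perms n. \<not> evenperm p}"
  have \<tau>: "?\<tau> permutes {..<n}" using ab by (intro permutes_swap_id) auto
  have cl: "?t p \<in> carrier R" if "p \<in> perms n" for p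
    using that by (auto simp: perm_prod_closed[OF F])
  have neg: "?t (p \<circ> ?\<tau>) = \<ominus> ?t p" if p: "p \<in> perms n" for p
  proof -
    have "(\<Otimes>i\<in>{..<n}. F i ((p \<circ> ?\<tau>) i)) = (\<Otimes>i\<in>{..<n}. F (?\<tau> i) ((p \<circ> ?\<tau>) i))"
      using p \<tau> ab
      by (intro finprod_cong') (auto simp: is_matD[OF F] perm_lt eq transpose_def)
    also have "\<dots> = (\<Otimes>i\<in>{..<n}. F i (p i))"
      using finprod_permute[OF \<tau>, of "\<lambda>i. F i (p i)"] p by (auto simp: is_matD[OF F] perm_lt)
    finally have "(\<Otimes>i\<in>{..<n}. F i ((p \<circ> ?\<tau>) i)) = (\<Otimes>i\<in>{..<n}. F i (p i))" .
    moreover have "perm_sign R (p \<circ> ?\<tau>) = \<ominus> perm_sign R p"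
      using p \<tau> ab by (simp add: perm_sign_comp perm_permutation perm_sign_transpose r_minus)
    ultimately show ?thesis
      using p by (simp add: l_minus perm_prod_closed[OF F])
  qed
  have ev: "evenperm (p \<circ> ?\<tau>) \<longleftrightarrow> \<not> evenperm p" if "p permutes {..<n}" for p
    using evenperm_comp[OF perm_permutation[OF that] perm_permutation[OF \<tau>]] ab evenperm_swap by metis
  have inv: "p \<circ> ?\<tau> \<circ> ?\<tau> = p" for p :: "nat \<Rightarrow> nat"
    by (simp add: comp_assoc)
  have img: "(\<lambda>p. p \<circ> ?\<tau>) ` ?E = ?O"
  proof
    show "(\<lambda>p. p \<circ> ?\<tau>) ` ?E \<subseteq> ?O"
      using \<tau> ev by (auto intro!: permutes_compose)
    show "?O \<subseteq> (\<lambda>p. p \<circ> ?\<tau>) ` ?E"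
    proof
      fix p assume "p \<in> ?O"
      then have "p \<circ> ?\<tau> \<in> ?E" using \<tau> ev by (auto intro!: permutes_compose)
      then show "p \<in> (\<lambda>p. p \<circ> ?\<tau>) ` ?E" using inv[of p] by (metis (no_types, lifting) imageI)
    qed
  qed
  have "inj_on (\<lambda>p. p \<circ> ?\<tau>) ?E" by (metis (no_types, lifting) inj_onI inv)
  then have "finsum R ?t ?O = (\<Oplus>p\<in>?E. ?t (p \<circ> ?\<tau>))"
    unfolding img[symmetric] using cl \<tau>
    by (intro finsum_reindex) (auto intro!: perm_prod_closed[OF F] permutes_compose simp del: o_apply)
  also have "\<dots> = (\<Oplus>p\<in>?E. \<ominus> ?t p)"
    using cl neg by (intro finsum_cong') auto
  finally have O: "finsum R ?t ?O = (\<Oplus>p\<in>?E. \<ominus> ?t p)" .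
  have "mat_det R n F = finsum R ?t (?E \<union> ?O)"
    unfolding mat_det_perm_sign[OF F] by (rule arg_cong[of _ _ "finsum R ?t"]) auto
  also have "\<dots> = finsum R ?t ?E \<oplus> finsum R ?t ?O"
    using cl finite_perms by (intro finsum_Un_disjoint) auto
  also have "\<dots> = (\<Oplus>p\<in>?E. ?t p \<oplus> \<ominus> ?t p)"
    unfolding O using cl by (intro finsum_addf[symmetric]) auto
  also have "\<dots> = (\<Oplus>p\<in>?E. \<zero>)"
    using cl by (intro finsum_cong') (auto simp: r_neg)
  finally show ?thesis by simp
qed

lemma is_mat_mult:
  "is_mat R n F \<Longrightarrow> is_mat R n G \<Longrightarrow> is_mat R n (mat_mult R n F G)"
  unfolding is_mat_def mat_mult_def by (auto intro!: finsum_closed)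

text \<open>
Expanding every entry of the product, the summand of a choice function \<open>g\<close> is a multiple of
the determinant of the matrix with rows \<open>G (g i)\<close>. It vanishes if \<open>g\<close> repeats a row, and the
remaining \<open>g\<close> are the permutations, for which it is the signed determinant of \<open>G\<close>.
\<close>

lemma mat_det_mult:
  assumes F: "is_mat R n F" and G: "is_mat R n G"
  shows "mat_det R n (mat_mult R n F G) = mat_det R n F \<otimes> mat_det R n G"
proof -
  let ?E = "{..<n} \<rightarrow>\<^sub>E {..<n}"
  let ?P = "\<lambda>g. \<Otimes>i\<in>{..<n}. F i (g i)"
  let ?Q = "\<lambda>g p. \<Otimes>i\<in>{..<n}. G (g i) (p i)"
  have finE: "finite ?E" by (simp add: finite_PiE)
  have lt: "g i < n" if "g \<in> ?E \<or> g \<in> perms n" "i < n" for g i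
    using that by (auto simp: perm_lt)
  have P: "?P g \<in> carrier R" if "g \<in> ?E \<or> g \<in> perms n" for g
    using lt[OF that] by (intro finprod_closed) (auto simp: is_matD[OF F])
  have Q: "?Q g p \<in> carrier R" if "g \<in> ?E \<or> g \<in> perms n" "p \<in> perms n" for g p
    using lt[OF that(1)] lt[of p] that(2) by (intro finprod_closed) (auto simp: is_matD[OF G])
  have G': "is_mat R n (\<lambda>i j. G (g i) j)" if "g \<in> ?E \<or> g \<in> perms n" for g
    using lt[OF that] by (simp add: is_mat_def is_matD[OF G])
  have expand: "(\<Otimes>i\<in>{..<n}. mat_mult R n F G i (p i)) = (\<Oplus>g\<in>?E. ?P g \<otimes> ?Q g p)"
    if p: "p \<in> perms n" for p
  proof -
    have "(\<Otimes>i\<in>{..<n}. mat_mult R n F G i (p i))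
        = (\<Oplus>g\<in>?E. \<Otimes>i\<in>{..<n}. F i (g i) \<otimes> G (g i) (p i))"
      unfolding mat_mult_def using p
      by (intro finprod_finsum_distrib) (auto simp: is_matD[OF F] is_matD[OF G] perm_lt)
    also have "\<dots> = (\<Oplus>g\<in>?E. ?P g \<otimes> ?Q g p)"
    proof (intro finsum_cong' refl funcsetI)
      fix g assume g: "g \<in> ?E"
      show "?P g \<otimes> ?Q g p \<in> carrier R" using P Q g p by blast
      show "(\<Otimes>i\<in>{..<n}. F i (g i) \<otimes> G (g i) (p i)) = ?P g \<otimes> ?Q g p"
        using g p lt by (intro finprod_multf) (auto simp: is_matD[OF F] is_matD[OF G])
    qed
    finally show ?thesis .
  qed
  have rows: "(\<Oplus>p\<in>perms n. perm_sign R p \<otimes> (?P g \<otimes> ?Q g p)) = ?P g \<otimes> mat_det R n (\<lambda>i j. G (g i) j)"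
    if g: "g \<in> ?E" for g
  proof -
    have "?P g \<otimes> mat_det R n (\<lambda>i j. G (g i) j) = (\<Oplus>p\<in>perms n. ?P g \<otimes> (perm_sign R p \<otimes> ?Q g p))"
      unfolding mat_det_perm_sign[OF G'[OF disjI1[OF g]]] using P Q g
      by (intro finsum_rdistr finite_perms) auto
    also have "\<dots> = (\<Oplus>p\<in>perms n. perm_sign R p \<otimes> (?P g \<otimes> ?Q g p))"
      using P Q g by (intro finsum_cong') (auto simp: m_lcomm)
    finally show ?thesis by simp
  qed
  have zero: "mat_det R n (\<lambda>i j. G (g i) j) = \<zero>" if g: "g \<in> ?E" "\<not> inj_on g {..<n}" for g
  proof -
    obtain a b where "a < n" "b < n" "a \<noteq> b" "g a = g b"
      using g(2) by (auto simp: inj_on_def)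
    then show ?thesis
      using G'[of g] g(1) by (intro mat_det_equal_rows[of n _ a b]) auto
  qed
  \<comment> \<open>Choice functions are extensional, while permutations are the identity off \<open>{..<n}\<close>.\<close>
  have img: "(\<lambda>p. restrict p {..<n}) ` perms n = {g \<in> ?E. inj_on g {..<n}}"
  proof (intro equalityI subsetI)
    fix g assume "g \<in> (\<lambda>p. restrict p {..<n}) ` perms n"
    then obtain p where p: "p permutes {..<n}" "g = restrict p {..<n}" by auto
    then have "inj_on g {..<n}" by (simp add: permutes_inj_on)
    then show "g \<in> {g \<in> ?E. inj_on g {..<n}}" using p by (auto simp: perm_lt)
  next
    fix g assume g: "g \<in> {g \<in> ?E. inj_on g {..<n}}"
    let ?p = "\<lambda>i. if i \<in> {..<n} then g i else i"
    have "g ` {..<n} \<subseteq> {..<n}" using g by (auto simp: PiE_def Pi_def)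
    then have "g ` {..<n} = {..<n}" using g by (intro endo_inj_surj) simp_all
    then have "bij_betw g {..<n} {..<n}" using g by (simp add: bij_betw_def)
    then have "bij_betw ?p {..<n} {..<n}" by (subst bij_betw_cong[of _ _ g]) simp_all
    then have "?p permutes {..<n}" by (intro bij_imp_permutes) auto
    moreover have "restrict ?p {..<n} = g"
      using g by (auto simp: fun_eq_iff PiE_def extensional_def)
    ultimately show "g \<in> (\<lambda>p. restrict p {..<n}) ` perms n" 
      by (intro image_eqI[of _ _ ?p]) simp_all
  qed
  have inj: "inj_on (\<lambda>p. restrict p {..<n}) (perms n)"
  proof (rule inj_onI)
    fix p q assume pq: "p \<in> perms n" "q \<in> perms n" "restrict p {..<n} = restrict q {..<n}"
    show "p = q"
    proof
      fix i show "p i = q i"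
        using pq(1,2) fun_cong[OF pq(3), of i] by (cases "i < n") (auto simp: permutes_not_in)
    qed
  qed
  let ?T = "\<lambda>g. ?P g \<otimes> mat_det R n (\<lambda>i j. G (g i) j)"
  have T: "?T g \<in> carrier R" if "g \<in> ?E" for g
    using P[of g] mat_det_closed[OF G'[of g]] that by simp
  have "mat_det R n (mat_mult R n F G) = (\<Oplus>p\<in>perms n. perm_sign R p \<otimes> (\<Oplus>g\<in>?E. ?P g \<otimes> ?Q g p))"
    unfolding mat_det_perm_sign[OF is_mat_mult[OF F G]]
    using P Q by (intro finsum_cong' refl) (auto simp: expand intro!: finsum_closed)
  also have "\<dots> = (\<Oplus>p\<in>perms n. \<Oplus>g\<in>?E. perm_sign R p \<otimes> (?P g \<otimes> ?Q g p))"
    using P Q finE by (intro finsum_cong' refl finsum_rdistr) (auto intro!: finsum_closed)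
  also have "\<dots> = (\<Oplus>g\<in>?E. \<Oplus>p\<in>perms n. perm_sign R p \<otimes> (?P g \<otimes> ?Q g p))"
    using P Q finE finite_perms by (intro finsum_nested_swap) auto
  also have "\<dots> = (\<Oplus>g\<in>?E. ?T g)"
    using T rows by (intro finsum_cong') auto
  also have "\<dots> = (\<Oplus>g\<in>{g \<in> ?E. inj_on g {..<n}}. ?T g)"
    using finE T zero P by (intro add.finprod_mono_neutral_cong_right) auto
  also have "\<dots> = (\<Oplus>p\<in>perms n. ?T (restrict p {..<n}))"
    unfolding img[symmetric] using T img by (intro finsum_reindex inj) blast
  also have "\<dots> = (\<Oplus>p\<in>perms n. perm_sign R p \<otimes> ?P p \<otimes> mat_det R n G)"
  proof (intro finsum_cong' refl funcsetI)
    fix p assume p: "p \<in> perms n"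
    show "perm_sign R p \<otimes> ?P p \<otimes> mat_det R n G \<in> carrier R"
      using P p mat_det_closed[OF G] by simp
    have "?P (restrict p {..<n}) = ?P p"
      using p by (intro finprod_cong') (auto simp: is_matD[OF F] perm_lt)
    moreover have "mat_det R n (\<lambda>i j. G (restrict p {..<n} i) j) = mat_det R n (\<lambda>i j. G (p i) j)"
      using p G'[of p] by (intro mat_det_cong[symmetric]) auto
    ultimately show "?T (restrict p {..<n}) = perm_sign R p \<otimes> ?P p \<otimes> mat_det R n G"
      using mat_det_permute_rows[OF G, of p] p P[of p] mat_det_closed[OF G] by (simp add: m_ac)
  qed
  also have "\<dots> = mat_det R n F \<otimes> mat_det R n G"
    unfolding mat_det_perm_sign[OF F] using P mat_det_closed[OF G]
    by (intro finsum_ldistr[symmetric] finite_perms) auto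
  finally show ?thesis .
qed

lemma mat_det_scale_rows:
  assumes F: "is_mat R n F" and c: "c \<in> {..<n} \<rightarrow> carrier R"
  shows "mat_det R n (\<lambda>i j. c i \<otimes> F i j) = (\<Otimes>i\<in>{..<n}. c i) \<otimes> mat_det R n F"
proof -
  have cF: "is_mat R n (\<lambda>i j. c i \<otimes> F i j)" using F c by (auto simp: is_mat_def)
  have C: "(\<Otimes>i\<in>{..<n}. c i) \<in> carrier R" using c by (intro finprod_closed)
  have "(\<Otimes>i\<in>{..<n}. c i) \<otimes> mat_det R n F =
      (\<Oplus>p\<in>perms n. (\<Otimes>i\<in>{..<n}. c i) \<otimes> (perm_sign R p \<otimes> (\<Otimes>i\<in>{..<n}. F i (p i))))"
    unfolding mat_det_perm_sign[OF F] using C perm_prod_closed[OF F]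
    by (intro finsum_rdistr finite_perms) auto
  also have "\<dots> = mat_det R n (\<lambda>i j. c i \<otimes> F i j)"
    unfolding mat_det_perm_sign[OF cF]
  proof (intro finsum_cong' refl funcsetI)
    fix p assume p: "p \<in> perms n"
    show "perm_sign R p \<otimes> (\<Otimes>i\<in>{..<n}. c i \<otimes> F i (p i)) \<in> carrier R"
      using perm_prod_closed[OF cF] p by simp
    have "(\<Otimes>i\<in>{..<n}. c i \<otimes> F i (p i)) = (\<Otimes>i\<in>{..<n}. c i) \<otimes> (\<Otimes>i\<in>{..<n}. F i (p i))"
      using p c by (intro finprod_multf) (auto simp: is_matD[OF F] perm_lt)
    then show "(\<Otimes>i\<in>{..<n}. c i) \<otimes> (perm_sign R p \<otimes> (\<Otimes>i\<in>{..<n}. F i (p i))) =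
        perm_sign R p \<otimes> (\<Otimes>i\<in>{..<n}. c i \<otimes> F i (p i))"
      using C perm_prod_closed[OF F] p by (simp add: m_lcomm)
  qed
  finally show ?thesis by simp
qed

text \<open>
A block-triangular determinant in the one case that is used here: if the last rows are unit vectors, a
permutation contributes only if it fixes the last indices.
\<close>

lemma mat_det_unit_rows:
  assumes F: "is_mat R n F" and mn: "m \<le> n"
    and unit: "\<And>i j. m \<le> i \<Longrightarrow> i < n \<Longrightarrow> j < n \<Longrightarrow> F i j = (if i = j then \<one> else \<zero>)"
  shows "mat_det R n F = mat_det R m F"
proof -
  have Fm: "is_mat R m F" using F mn by (simp add: is_mat_def)
  have sub: "perms m \<subseteq> perms n"
    using mn by (auto intro: permutes_subset)
  have "(\<Oplus>p\<in>perms n. perm_sign R p \<otimes> (\<Otimes>i\<in>{..<n}. F i (p i))) =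
      (\<Oplus>p\<in>perms m. perm_sign R p \<otimes> (\<Otimes>i\<in>{..<m}. F i (p i)))"
  proof (intro add.finprod_mono_neutral_cong_right finite_perms sub funcsetI)
    fix p assume p: "p \<in> perms n - perms m"
    then obtain i where i: "m \<le> i" "i < n" "p i \<noteq> i"
      using permutes_superset[of p "{..<n}" "{..<m}"] by force
    then have "F i (p i) = \<zero>" using unit[of i "p i"] p by (auto simp: perm_lt)
    then have "(\<Otimes>i\<in>{..<n}. F i (p i)) = \<zero>"
      using i p by (intro finprod_zero_factor[of _ i]) (auto simp: is_matD[OF F] perm_lt)
    then show "perm_sign R p \<otimes> (\<Otimes>i\<in>{..<n}. F i (p i)) = \<zero>" by simp
  next
    fix p assume p: "p \<in> perms m"
    then have "p \<in> perms n" using sub by blast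
    then have "(\<Otimes>i\<in>{..<n}. F i (p i)) = (\<Otimes>i\<in>{..<m}. F i (p i))"
      using p mn unit
      by (intro finprod_mono_neutral_cong_right) (auto simp: is_matD[OF F] perm_lt permutes_not_in)
    then show "perm_sign R p \<otimes> (\<Otimes>i\<in>{..<n}. F i (p i)) = perm_sign R p \<otimes> (\<Otimes>i\<in>{..<m}. F i (p i))"
      by simp
  next
    fix p assume "p \<in> perms n"
    then show "perm_sign R p \<otimes> (\<Otimes>i\<in>{..<n}. F i (p i)) \<in> carrier R"
      by (simp add: perm_prod_closed[OF F])
  qed
  then show ?thesis by (simp add: mat_det_perm_sign F Fm)
qed

lemma mat_det_one: "mat_det R n (\<lambda>i j. if i = j then \<one> else \<zero>) = \<one>"
proof -
  have "mat_det R n (\<lambda>i j. if i = j then \<one> else \<zero>) = mat_det R 0 (\<lambda>i j. if i = j then \<one> else \<zero>)"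
    by (intro mat_det_unit_rows) (auto simp: is_mat_def)
  also have "\<dots> = \<one>"
    by (subst mat_det_perm_sign) (auto simp: is_mat_def)
  finally show ?thesis .
qed

lemma is_mat_update_row:
  "is_mat R n F \<Longrightarrow> v \<in> {..<n} \<rightarrow> carrier R \<Longrightarrow> is_mat R n (F(a := v))"
  by (auto simp: is_mat_def)

text \<open>
Laplace expansion, with the cofactor of position \<open>(a, j)\<close> written as the determinant in which
row \<open>a\<close> is replaced by the unit vector \<open>e\<^sub>j\<close>. In this form the cofactors visibly do not depend on
row \<open>a\<close>, and no signs or reindexings appear.
\<close>

lemma mat_det_row_expansion:
  assumes F: "is_mat R n F" and a: "a < n"
  shows "mat_det R n F =
    (\<Oplus>j\<in>{..<n}. F a j \<otimes> mat_det R n (F(a := (\<lambda>l. if l = j then \<one> else \<zero>))))"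
proof -
  let ?e = "\<lambda>j l. if l = j then \<one> else \<zero>"
  let ?F = "\<lambda>j. F(a := ?e j)"
  have Fe: "is_mat R n (?F j)" for j by (intro is_mat_update_row F) auto
  let ?t = "\<lambda>j p. F a j \<otimes> (perm_sign R p \<otimes> (\<Otimes>i\<in>{..<n}. ?F j i (p i)))"
  have t: "?t j p \<in> carrier R" if "j < n" "p \<in> perms n" for j p
    using that a perm_prod_closed[OF Fe] is_matD[OF F] by simp
  have split: "(\<Otimes>i\<in>{..<n}. f i) = f a \<otimes> (\<Otimes>i\<in>{..<n} - {a}. f i)"
    if "f \<in> {..<n} \<rightarrow> carrier R" for f
  proof -
    have "(\<Otimes>i\<in>insert a ({..<n} - {a}). f i) = f a \<otimes> (\<Otimes>i\<in>{..<n} - {a}. f i)"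
      using that a by (intro finprod_insert) auto
    then show ?thesis using a by (simp add: insert_absorb)
  qed
  have inner: "(\<Oplus>j\<in>{..<n}. ?t j p) = perm_sign R p \<otimes> (\<Otimes>i\<in>{..<n}. F i (p i))"
    if p: "p \<in> perms n" for p
  proof -
    have rest: "(\<Otimes>i\<in>{..<n} - {a}. ?F (p a) i (p i)) = (\<Otimes>i\<in>{..<n} - {a}. F i (p i))"
      using p by (intro finprod_cong') (auto simp: is_matD[OF F] perm_lt)
    have cl: "(\<Otimes>i\<in>{..<n} - {a}. F i (p i)) \<in> carrier R"
      using p by (intro finprod_closed) (auto simp: is_matD[OF F] perm_lt)
    have "(\<Otimes>i\<in>{..<n}. ?F (p a) i (p i)) = (\<Otimes>i\<in>{..<n} - {a}. F i (p i))"
      using p cl a by (subst split) (auto simp: is_matD[OF F] perm_lt rest[unfolded fun_upd_def])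
    moreover have "(\<Otimes>i\<in>{..<n}. F i (p i)) = F a (p a) \<otimes> (\<Otimes>i\<in>{..<n} - {a}. F i (p i))"
      using p by (intro split) (auto simp: is_matD[OF F] perm_lt)
    ultimately have "?t (p a) p = perm_sign R p \<otimes> (\<Otimes>i\<in>{..<n}. F i (p i))"
      using cl p a by (simp add: is_matD[OF F] perm_lt m_lcomm)
    moreover have "(\<Oplus>j\<in>{..<n}. ?t j p) = ?t (p a) p"
    proof (rule finsum_single)
      show "p a \<in> {..<n}" "?t (p a) p \<in> carrier R" using p a t[of "p a" p] by (auto simp: perm_lt)
      fix j assume j: "j \<in> {..<n}" "j \<noteq> p a"
      then have "(\<Otimes>i\<in>{..<n}. ?F j i (p i)) = \<zero>"
        using p a by (intro finprod_zero_factor[of _ a]) (auto simp: is_matD[OF F] perm_lt)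
      then show "?t j p = \<zero>" using j a by (simp add: is_matD[OF F])
    qed simp
    ultimately show ?thesis by simp
  qed
  have "(\<Oplus>j\<in>{..<n}. F a j \<otimes> mat_det R n (?F j)) = (\<Oplus>j\<in>{..<n}. \<Oplus>p\<in>perms n. ?t j p)"
    unfolding mat_det_perm_sign[OF Fe] using a t perm_prod_closed[OF Fe]
    by (intro finsum_cong' refl finsum_rdistr finite_perms) (auto simp: is_matD[OF F] intro!: finsum_closed)
  also have "\<dots> = (\<Oplus>p\<in>perms n. \<Oplus>j\<in>{..<n}. ?t j p)"
    using t by (intro finsum_nested_swap finite_perms) auto
  also have "\<dots> = mat_det R n F"
    unfolding mat_det_perm_sign[OF F]
    using perm_prod_closed[OF F] inner by (intro finsum_cong') auto
  finally show ?thesis by simp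
qed

text \<open>
The sum is the expansion along row \<open>b\<close> of the matrix whose row \<open>b\<close> has been overwritten by
row \<open>a\<close>, so it is zero by a repeated row unless \<open>a = b\<close>.
\<close>

lemma right_adjugate:
  assumes F: "is_mat R n F" and ab: "a < n" "b < n"
  shows "(\<Oplus>l\<in>{..<n}. F a l \<otimes> mat_det R n (F(b := (\<lambda>j. if j = l then \<one> else \<zero>)))) =
    (if a = b then mat_det R n F else \<zero>)"
proof -
  have G: "is_mat R n (F(b := F a))" using ab by (intro is_mat_update_row F) (auto simp: is_matD[OF F])
  have "mat_det R n (F(b := F a)) = (if a = b then mat_det R n F else \<zero>)"
    using ab mat_det_equal_rows[OF G ab] by auto
  then show ?thesis using mat_det_row_expansion[OF G ab(2)] by simp
qed

lemma left_adjugate_exists: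
  assumes F: "is_mat R n F"
  shows "\<exists>C. is_mat R n C \<and> (\<forall>a<n. \<forall>b<n.
    (\<Oplus>l\<in>{..<n}. C a l \<otimes> F l b) = (if a = b then mat_det R n F else \<zero>))"
proof (intro exI conjI allI impI)
  let ?T = "\<lambda>i j. F j i"
  let ?C = "\<lambda>a l. mat_det R n (?T(a := (\<lambda>j. if j = l then \<one> else \<zero>)))"
  have T: "is_mat R n ?T" using F by (simp add: is_mat_def)
  show C: "is_mat R n ?C"
    unfolding is_mat_def by (auto intro!: mat_det_closed is_mat_update_row T)
  fix a b assume ab: "a < n" "b < n"
  have "(\<Oplus>l\<in>{..<n}. ?C a l \<otimes> F l b) = (\<Oplus>l\<in>{..<n}. ?T b l \<otimes> ?C a l)"
    using ab by (intro finsum_cong') (auto simp: is_matD[OF C] is_matD[OF F] m_comm)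
  then show "(\<Oplus>l\<in>{..<n}. ?C a l \<otimes> F l b) = (if a = b then mat_det R n F else \<zero>)"
    using right_adjugate[OF T ab(2,1)] mat_det_transpose[OF F] by auto
qed

end

lemma (in ring_hom_cring) hom_perm_sign: "h (perm_sign R p) = perm_sign S p"
  by (simp add: perm_sign_def)

lemma (in ring_hom_cring) hom_mat_det:
  assumes F: "is_mat R n F"
  shows "h (mat_det R n F) = mat_det S n (\<lambda>i j. h (F i j))"
proof -
  have hF: "is_mat S n (\<lambda>i j. h (F i j))" using F by (simp add: is_mat_def)
  have "h (mat_det R n F) = (\<Oplus>\<^bsub>S\<^esub>p\<in>{p. p permutes {..<n}}. h (perm_sign R p \<otimes> (\<Otimes>i\<in>{..<n}. F i (p i))))"
    unfolding R.mat_det_perm_sign[OF F]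
    using hom_finsum[of "\<lambda>p. perm_sign R p \<otimes> (\<Otimes>i\<in>{..<n}. F i (p i))" "{p. p permutes {..<n}}"] R.perm_prod_closed[OF F]
    by (auto simp: comp_def)
  also have "\<dots> = mat_det S n (\<lambda>i j. h (F i j))"
    unfolding S.mat_det_perm_sign[OF hF]
  proof (intro S.finsum_cong' refl funcsetI)
    fix p assume p: "p \<in> {p. p permutes {..<n}}"
    then show "perm_sign S p \<otimes>\<^bsub>S\<^esub> (\<Otimes>\<^bsub>S\<^esub>i\<in>{..<n}. h (F i (p i))) \<in> carrier S"
      using S.perm_prod_closed[OF hF, of p] by simp
    have "h (\<Otimes>i\<in>{..<n}. F i (p i)) = (\<Otimes>\<^bsub>S\<^esub>i\<in>{..<n}. h (F i (p i)))"
      using hom_finprod[of "\<lambda>i. F i (p i)" "{..<n}"] p by (auto simp: R.is_matD[OF F] R.perm_lt comp_def)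
    then show "h (perm_sign R p \<otimes> (\<Otimes>i\<in>{..<n}. F i (p i))) = perm_sign S p \<otimes>\<^bsub>S\<^esub> (\<Otimes>\<^bsub>S\<^esub>i\<in>{..<n}. h (F i (p i)))"
      using p by (simp add: R.perm_prod_closed[OF F] hom_perm_sign)
  qed
  finally show ?thesis .
qed

section \<open>Linear combinations of the identity and an idempotent matrix\<close>

definition lin_mat ::
  "('a, 'm) ring_scheme \<Rightarrow> 'a \<Rightarrow> 'a \<Rightarrow> (nat \<Rightarrow> nat \<Rightarrow> 'a) \<Rightarrow> nat \<Rightarrow> nat \<Rightarrow> 'a" where
  "lin_mat R a b F i j = (if i = j then a else \<zero>\<^bsub>R\<^esub>) \<oplus>\<^bsub>R\<^esub> b \<otimes>\<^bsub>R\<^esub> F i j"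

context cring
begin

lemma is_mat_lin_mat:
  "is_mat R n F \<Longrightarrow> a \<in> carrier R \<Longrightarrow> b \<in> carrier R \<Longrightarrow> is_mat R n (lin_mat R a b F)"
  by (simp add: is_mat_def lin_mat_def)

lemma lin_mat_mult:
  assumes F: "is_mat R n F" "idempotent_mat R n F"
    and [simp]: "a \<in> carrier R" "b \<in> carrier R" "c \<in> carrier R" "d \<in> carrier R"
    and ij: "i < n" "j < n"
  shows "mat_mult R n (lin_mat R a b F) (lin_mat R c d F) i j =
    lin_mat R (a \<otimes> c) (a \<otimes> d \<oplus> b \<otimes> c \<oplus> b \<otimes> d) F i j"
proof -
  note [simp] = is_matD[OF F(1)]
  have idem: "(\<Oplus>l\<in>{..<n}. F i l \<otimes> F l j) = F i j"
    using F(2) ij by (simp add: idempotent_mat_def mat_mult_def)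
  let ?u = "\<lambda>l. (if i = l then a else \<zero>) \<otimes> ((if l = j then c else \<zero>) \<oplus> d \<otimes> F l j)"
  let ?v = "\<lambda>l. b \<otimes> F i l \<otimes> (if l = j then c else \<zero>)"
  let ?w = "\<lambda>l. (b \<otimes> d) \<otimes> (F i l \<otimes> F l j)"
  have "mat_mult R n (lin_mat R a b F) (lin_mat R c d F) i j = (\<Oplus>l\<in>{..<n}. ?u l \<oplus> (?v l \<oplus> ?w l))"
    unfolding mat_mult_def lin_mat_def
  proof (intro finsum_cong' refl funcsetI)
    fix l assume l: "l \<in> {..<n}"
    show "?u l \<oplus> (?v l \<oplus> ?w l) \<in> carrier R" using l ij by auto
    have "(x \<oplus> b \<otimes> F i l) \<otimes> (y \<oplus> d \<otimes> F l j) =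
        x \<otimes> (y \<oplus> d \<otimes> F l j) \<oplus> (b \<otimes> F i l \<otimes> y \<oplus> (b \<otimes> d) \<otimes> (F i l \<otimes> F l j))"
      if "x \<in> carrier R" "y \<in> carrier R" for x y
      using that l ij by (simp add: l_distr r_distr m_ac a_ac)
    then show "((if i = l then a else \<zero>) \<oplus> b \<otimes> F i l) \<otimes> ((if l = j then c else \<zero>) \<oplus> d \<otimes> F l j) =
        ?u l \<oplus> (?v l \<oplus> ?w l)" by simp
  qed
  also have "\<dots> = (\<Oplus>l\<in>{..<n}. ?u l) \<oplus> ((\<Oplus>l\<in>{..<n}. ?v l) \<oplus> (\<Oplus>l\<in>{..<n}. ?w l))"
    using ij by (subst finsum_addf; (subst finsum_addf)?) (auto intro!: finsum_closed)
  also have "(\<Oplus>l\<in>{..<n}. ?u l) = ?u i"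
    using ij by (intro finsum_single) auto
  also have "(\<Oplus>l\<in>{..<n}. ?v l) = ?v j"
    using ij by (intro finsum_single) auto
  also have "(\<Oplus>l\<in>{..<n}. ?w l) = (b \<otimes> d) \<otimes> F i j"
    using ij by (subst finsum_rdistr[symmetric]) (auto simp: idem)
  finally have "mat_mult R n (lin_mat R a b F) (lin_mat R c d F) i j = ?u i \<oplus> (?v j \<oplus> (b \<otimes> d) \<otimes> F i j)" .
  moreover have "lin_mat R (a \<otimes> c) (a \<otimes> d \<oplus> b \<otimes> c \<oplus> b \<otimes> d) F i j = ?u i \<oplus> (?v j \<oplus> (b \<otimes> d) \<otimes> F i j)"
    using ij by (auto simp: lin_mat_def l_distr r_distr m_ac a_ac)
  ultimately show ?thesis by simp
qed

text \<open>
The matrices \<open>a I + b F\<close> form a commutative ring because \<open>F\<^sup>2 = F\<close>. With \<open>a = 1\<close> and \<open>b = X - 1\<close>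
they give a one-parameter family \<open>(I - F) + X F\<close> that is multiplicative in \<open>X\<close>.
\<close>

lemma mat_det_lin_mat_mult:
  assumes F: "is_mat R n F" "idempotent_mat R n F"
    and abcd: "a \<in> carrier R" "b \<in> carrier R" "c \<in> carrier R" "d \<in> carrier R"
  shows "mat_det R n (lin_mat R a b F) \<otimes> mat_det R n (lin_mat R c d F) =
    mat_det R n (lin_mat R (a \<otimes> c) (a \<otimes> d \<oplus> b \<otimes> c \<oplus> b \<otimes> d) F)"
  using abcd
  by (subst mat_det_mult[symmetric])
    (auto intro!: mat_det_cong is_mat_mult is_mat_lin_mat simp: lin_mat_mult F)

end

lemma (in ring_hom_cring) hom_mat_det_lin_mat:
  assumes "is_mat R n F" "a \<in> carrier R" "b \<in> carrier R"
  shows "h (mat_det R n (lin_mat R a b F)) = mat_det S n (lin_mat S (h a) (h b) (\<lambda>i j. h (F i j)))"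
proof -
  have "h (mat_det R n (lin_mat R a b F)) = mat_det S n (\<lambda>i j. h (lin_mat R a b F i j))"
    using assms by (intro hom_mat_det R.is_mat_lin_mat)
  also have "\<dots> = mat_det S n (lin_mat S (h a) (h b) (\<lambda>i j. h (F i j)))"
    using assms R.is_mat_lin_mat[OF assms]
    by (intro S.mat_det_cong) (auto simp: lin_mat_def is_mat_def R.is_matD)
  finally show ?thesis .
qed

section \<open>The rank polynomial\<close>

context UP_cring
begin

abbreviation const :: "'a \<Rightarrow> nat \<Rightarrow> 'a" where
  "const a \<equiv> monom P a 0"

abbreviation var :: "nat \<Rightarrow> 'a" where
  "var \<equiv> monom P \<one> (Suc 0)"

abbreviation const_mat :: "(nat \<Rightarrow> nat \<Rightarrow> 'a) \<Rightarrow> nat \<Rightarrow> nat \<Rightarrow> nat \<Rightarrow> 'a" where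
  "const_mat F \<equiv> \<lambda>i j. const (F i j)"

definition subst_poly :: "(nat \<Rightarrow> 'a) \<Rightarrow> (nat \<Rightarrow> 'a) \<Rightarrow> nat \<Rightarrow> 'a" where
  "subst_poly q = eval R P (\<lambda>a. monom P a 0) q"

lemma const_univ_prop: "UP_pre_univ_prop R P const"
  by (intro UP_pre_univ_propI R.is_cring UP_cring const_ring_hom)

lemma subst_poly_hom:
  assumes "q \<in> carrier P"
  shows "ring_hom_cring P P (subst_poly q)"
proof -
  interpret U: UP_pre_univ_prop R P const P
    by (rule const_univ_prop, rule P_def)
  show ?thesis
    unfolding subst_poly_def by (intro ring_hom_cringI UP_cring U.eval_ring_hom assms)
qed

lemma subst_poly_monom:
  assumes "q \<in> carrier P" "a \<in> carrier R"
  shows "subst_poly q (monom P a k) = const a \<otimes>\<^bsub>P\<^esub> q [^]\<^bsub>P\<^esub> k"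
proof -
  interpret U: UP_pre_univ_prop R P const P
    by (rule const_univ_prop, rule P_def)
  show ?thesis unfolding subst_poly_def using assms by (intro U.eval_monom)
qed

lemma subst_poly_const: "q \<in> carrier P \<Longrightarrow> a \<in> carrier R \<Longrightarrow> subst_poly q (const a) = const a"
  by (simp add: subst_poly_monom)

lemma subst_poly_var: "q \<in> carrier P \<Longrightarrow> subst_poly q var = q"
  by (simp add: subst_poly_monom)

text \<open>
The uniqueness part of the universal property of \<open>R[X]\<close>.
\<close>

lemma hom_fixing_var_id:
  assumes h: "ring_hom_cring P P h" and "\<And>a. a \<in> carrier R \<Longrightarrow> h (const a) = const a" "h var = var"
    and p: "p \<in> carrier P"
  shows "h p = p"
proof -
  interpret U: UP_pre_univ_prop R P const P
    by (rule const_univ_prop, rule P_def)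
  have "ring_hom_cring P P id"
    by (intro ring_hom_cringI UP_cring) (auto simp: ring_hom_def)
  then have "h p = id p"
    using U.UP_hom_unique[OF h _ _ _ _ _ p, of var id] assms by simp
  then show ?thesis by simp
qed

text \<open>
The substitution \<open>X \<mapsto> 1 + X\<close> is injective; this makes the polynomial \<open>R(X)\<close> defined by
\<open>R(1 + X) = det (I + X F)\<close> unique.
\<close>

lemma subst_poly_translate_inverse:
  assumes p: "p \<in> carrier P"
  shows "subst_poly (var \<ominus>\<^bsub>P\<^esub> \<one>\<^bsub>P\<^esub>) (subst_poly (\<one>\<^bsub>P\<^esub> \<oplus>\<^bsub>P\<^esub> var) p) = p"
proof -
  let ?f = "subst_poly (\<one>\<^bsub>P\<^esub> \<oplus>\<^bsub>P\<^esub> var)" and ?g = "subst_poly (var \<ominus>\<^bsub>P\<^esub> \<one>\<^bsub>P\<^esub>)"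
  interpret f: ring_hom_cring P P ?f by (intro subst_poly_hom) simp
  interpret g: ring_hom_cring P P ?g by (intro subst_poly_hom) simp
  have "ring_hom_cring P P (\<lambda>p. ?g (?f p))"
    by (intro ring_hom_cringI UP_cring) (auto simp: ring_hom_def)
  moreover have "?g (?f var) = var"
  proof -
    have "?g (?f var) = \<one>\<^bsub>P\<^esub> \<oplus>\<^bsub>P\<^esub> (var \<ominus>\<^bsub>P\<^esub> \<one>\<^bsub>P\<^esub>)"
      using subst_poly_var[of "\<one>\<^bsub>P\<^esub> \<oplus>\<^bsub>P\<^esub> var"] subst_poly_var[of "var \<ominus>\<^bsub>P\<^esub> \<one>\<^bsub>P\<^esub>"] by simp
    also have "\<dots> = var" using monom_closed[OF R.one_closed, of "Suc 0"] by algebra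
    finally show ?thesis .
  qed
  moreover have "?g (?f (const a)) = const a" if "a \<in> carrier R" for a
    using that by (simp add: subst_poly_const)
  ultimately show ?thesis
    using hom_fixing_var_id[of "\<lambda>p. ?g (?f p)", OF _ _ _ p] by blast
qed

lemma is_mat_const: "is_mat R n F \<Longrightarrow> is_mat P n (const_mat F)"
  by (simp add: is_mat_def)

lemma idempotent_mat_const:
  assumes "is_mat R n F" "idempotent_mat R n F"
  shows "idempotent_mat P n (const_mat F)"
proof -
  interpret c: ring_hom_cring R P const by (intro ring_hom_cringI R.is_cring UP_cring const_ring_hom)
  have "mat_mult P n (const_mat F) (const_mat F) i j = const (F i j)" if "i < n" "j < n" for i j
  proof -
    have "const (mat_mult R n F F i j) = (\<Oplus>\<^bsub>P\<^esub>l\<in>{..<n}. const (F i l \<otimes> F l j))"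
      unfolding mat_mult_def using that assms(1) c.hom_finsum[of "\<lambda>l. F i l \<otimes> F l j" "{..<n}"]
      by (auto simp: R.is_matD comp_def)
    also have "\<dots> = mat_mult P n (const_mat F) (const_mat F) i j"
      unfolding mat_mult_def using that assms(1) by (intro P.finsum_cong') (auto simp: R.is_matD)
    finally show ?thesis using assms(2) that by (simp add: idempotent_mat_def)
  qed
  then show ?thesis by (simp add: idempotent_mat_def)
qed

text \<open>
Substituting \<open>X - 1\<close> for \<open>X\<close> in \<open>det (I + X F)\<close> gives the rank polynomial explicitly, as the
determinant of \<open>(I - F) + X F\<close>.
\<close>

definition rank_det :: "nat \<Rightarrow> (nat \<Rightarrow> nat \<Rightarrow> 'a) \<Rightarrow> nat \<Rightarrow> 'a" where
  "rank_det n F = mat_det P n (lin_mat P \<one>\<^bsub>P\<^esub> (var \<ominus>\<^bsub>P\<^esub> \<one>\<^bsub>P\<^esub>) (const_mat F))"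

lemma rank_det_closed: "is_mat R n F \<Longrightarrow> rank_det n F \<in> carrier P"
  unfolding rank_det_def by (intro P.mat_det_closed P.is_mat_lin_mat is_mat_const) auto

lemma subst_poly_lin_det:
  assumes F: "is_mat R n F" and q: "q \<in> carrier P" and a: "a \<in> carrier P"  "b \<in> carrier P"
  shows "subst_poly q (mat_det P n (lin_mat P a b (const_mat F))) =
    mat_det P n (lin_mat P (subst_poly q a) (subst_poly q b) (const_mat F))"
proof -
  interpret h: ring_hom_cring P P "subst_poly q" by (intro subst_poly_hom q)
  have "is_mat P n (lin_mat P (subst_poly q a) (subst_poly q b) (\<lambda>i j. subst_poly q (const_mat F i j)))"
    using F a by (intro P.is_mat_lin_mat) (auto simp: is_mat_def)
  then show ?thesis
    unfolding h.hom_mat_det_lin_mat[OF is_mat_const[OF F] a]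
    by (rule P.mat_det_cong) (simp add: lin_mat_def subst_poly_const q R.is_matD[OF F])
qed

lemma subst_poly_rank_det:
  assumes F: "is_mat R n F" and q: "q \<in> carrier P"
  shows "subst_poly q (rank_det n F) = mat_det P n (lin_mat P \<one>\<^bsub>P\<^esub> (q \<ominus>\<^bsub>P\<^esub> \<one>\<^bsub>P\<^esub>) (const_mat F))"
proof -
  interpret h: ring_hom_cring P P "subst_poly q" by (intro subst_poly_hom q)
  have "subst_poly q (var \<ominus>\<^bsub>P\<^esub> \<one>\<^bsub>P\<^esub>) = q \<ominus>\<^bsub>P\<^esub> \<one>\<^bsub>P\<^esub>"
    using subst_poly_var[OF q] by (simp add: a_minus_def)
  then show ?thesis
    unfolding rank_det_def using F q by (subst subst_poly_lin_det) auto
qed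

lemma deg_finsum_le:
  assumes "finite I" "\<And>i. i \<in> I \<Longrightarrow> f i \<in> carrier P \<and> deg R (f i) \<le> d"
  shows "deg R (\<Oplus>\<^bsub>P\<^esub>i\<in>I. f i) \<le> d"
  using assms
proof (induction I rule: finite_induct)
  case empty
  then show ?case by simp
next
  case (insert x I)
  then have f: "f \<in> I \<rightarrow> carrier P" "f x \<in> carrier P" by auto
  have "deg R (f x \<oplus>\<^bsub>P\<^esub> (\<Oplus>\<^bsub>P\<^esub>i\<in>I. f i)) \<le> max (deg R (f x)) (deg R (\<Oplus>\<^bsub>P\<^esub>i\<in>I. f i))"
    using f by (intro deg_add P.finsum_closed)
  also have "\<dots> \<le> d" using insert by simp
  finally show ?case using f insert.hyps by simp
qed

lemma deg_finprod_le:
  assumes "\<And>i. i < n \<Longrightarrow> f i \<in> carrier P \<and> deg R (f i) \<le> 1"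
  shows "deg R (\<Otimes>\<^bsub>P\<^esub>i\<in>{..<n::nat}. f i) \<le> n"
  using assms
proof (induction n)
  case 0
  then show ?case by simp
next
  case (Suc n)
  then have f: "f \<in> {..<n} \<rightarrow> carrier P" "f n \<in> carrier P" by auto
  have "deg R (f n \<otimes>\<^bsub>P\<^esub> (\<Otimes>\<^bsub>P\<^esub>i\<in>{..<n}. f i)) \<le> deg R (f n) + deg R (\<Otimes>\<^bsub>P\<^esub>i\<in>{..<n}. f i)"
    using f by (intro deg_mult_ring P.finprod_closed)
  also have "\<dots> \<le> Suc n" using Suc.IH Suc.prems[of n] Suc.prems by fastforce
  finally show ?case using f by (simp add: lessThan_Suc)
qed

lemma deg_rank_det:
  assumes F: "is_mat R n F"
  shows "deg R (rank_det n F) \<le> n"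
proof -
  let ?G = "lin_mat P \<one>\<^bsub>P\<^esub> (var \<ominus>\<^bsub>P\<^esub> \<one>\<^bsub>P\<^esub>) (const_mat F)"
  have G: "is_mat P n ?G" by (intro P.is_mat_lin_mat is_mat_const F) auto
  have "deg R (?G i j) \<le> 1" if "i < n" "j < n" for i j
  proof -
    have "?G i j = (if i = j then \<one>\<^bsub>P\<^esub> else \<zero>\<^bsub>P\<^esub>) \<oplus>\<^bsub>P\<^esub> F i j \<odot>\<^bsub>P\<^esub> (var \<ominus>\<^bsub>P\<^esub> \<one>\<^bsub>P\<^esub>)"
      using that F by (simp add: lin_mat_def R.is_matD monom_mult_is_smult[symmetric] P.m_comm)
    then show ?thesis
      using that F by (intro deg_aboveI) (auto simp: R.is_matD a_minus_def)
  qed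
  then have prod: "deg R (\<Otimes>\<^bsub>P\<^esub>i\<in>{..<n}. ?G i (p i)) \<le> n" if "p permutes {..<n}" for p
    using that G by (intro deg_finprod_le) (auto simp: is_mat_def R.perm_lt)
  have "deg R (perm_sign P p) = 0" for p
    by (simp add: perm_sign_def deg_uminus)
  then have "deg R (perm_sign P p \<otimes>\<^bsub>P\<^esub> (\<Otimes>\<^bsub>P\<^esub>i\<in>{..<n}. ?G i (p i))) \<le> n" if "p permutes {..<n}" for p
    using deg_mult_ring[OF P.perm_sign_closed P.perm_prod_closed[OF G that], of p] prod[OF that] by simp
  then show ?thesis
    unfolding rank_det_def P.mat_det_perm_sign[OF G]
    by (intro deg_finsum_le R.finite_perms) (auto simp: P.perm_prod_closed[OF G])
qed

lemma rank_polynomial_eq_rank_det: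
  assumes F: "is_mat R n F"
  shows "rank_polynomial R n F = rank_det n F"
proof -
  have sub: "eval R (UP R) (poly_const R) (\<one>\<^bsub>UP R\<^esub> \<oplus>\<^bsub>UP R\<^esub> poly_var R) = subst_poly (\<one>\<^bsub>P\<^esub> \<oplus>\<^bsub>P\<^esub> var)"
    by (simp add: subst_poly_def P_def poly_const_def[abs_def] poly_var_def)
  have mat: "one_plus_X_mat R F = lin_mat P \<one>\<^bsub>P\<^esub> var (const_mat F)"
    by (simp add: fun_eq_iff one_plus_X_mat_def lin_mat_def P_def poly_const_def poly_var_def)
  have ok: "subst_poly (\<one>\<^bsub>P\<^esub> \<oplus>\<^bsub>P\<^esub> var) (rank_det n F) = mat_det P n (lin_mat P \<one>\<^bsub>P\<^esub> var (const_mat F))"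
  proof -
    have "\<one>\<^bsub>P\<^esub> \<oplus>\<^bsub>P\<^esub> var \<ominus>\<^bsub>P\<^esub> \<one>\<^bsub>P\<^esub> = var" using monom_closed[OF R.one_closed, of "Suc 0"] by algebra
    then show ?thesis using subst_poly_rank_det[OF F, of "\<one>\<^bsub>P\<^esub> \<oplus>\<^bsub>P\<^esub> var"] by simp
  qed
  show ?thesis
    unfolding rank_polynomial_def sub mat unfolding P_def[symmetric]
  proof (rule the_equality)
    show "rank_det n F \<in> carrier P \<and> deg R (rank_det n F) \<le> n \<and>
        subst_poly (\<one>\<^bsub>P\<^esub> \<oplus>\<^bsub>P\<^esub> var) (rank_det n F) = mat_det P n (lin_mat P \<one>\<^bsub>P\<^esub> var (const_mat F))"
      using rank_det_closed[OF F] deg_rank_det[OF F] ok by simp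
  next
    fix Q
    assume "Q \<in> carrier P \<and> deg R Q \<le> n \<and>
        subst_poly (\<one>\<^bsub>P\<^esub> \<oplus>\<^bsub>P\<^esub> var) Q = mat_det P n (lin_mat P \<one>\<^bsub>P\<^esub> var (const_mat F))"
    then show "Q = rank_det n F"
      using ok subst_poly_translate_inverse[of Q] subst_poly_translate_inverse[OF rank_det_closed[OF F]] by simp
  qed
qed

end

section \<open>The idempotents and the vanishing minors\<close>

text \<open>
This reduces an arbitrary minor to a leading one: after a permutation of the rows and one of the
columns, the rows and columns of the minor come first.
\<close>

lemma inj_on_extends_to_permutation:
  fixes f :: "nat \<Rightarrow> nat"
  assumes inj: "inj_on f {..<m}" and img: "f ` {..<m} \<subseteq> {..<n}"
  obtains p where "p permutes {..<n}" "\<And>i. i < m \<Longrightarrow> p i = f i"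
proof -
  have mn: "m \<le> n" using card_inj_on_le[OF inj img] by simp
  have "card ({..<n} - {..<m}) = card ({..<n} - f ` {..<m})"
    using mn img inj by (simp add: card_Diff_subset card_image)
  then obtain h where h: "bij_betw h ({..<n} - {..<m}) ({..<n} - f ` {..<m})"
    using finite_same_card_bij[of "{..<n} - {..<m}" "{..<n} - f ` {..<m}"] by auto
  define p where "p i = (if i \<in> {..<m} then f i else if i \<in> {..<n} then h i else i)" for i
  have "bij_betw p {..<m} (f ` {..<m})"
    using inj by (subst bij_betw_cong[of _ _ f]) (auto simp: p_def bij_betw_def)
  moreover have "bij_betw p ({..<n} - {..<m}) ({..<n} - f ` {..<m})"
    using h by (subst bij_betw_cong[of _ _ h]) (auto simp: p_def)
  ultimately have "bij_betw p ({..<m} \<union> ({..<n} - {..<m})) (f ` {..<m} \<union> ({..<n} - f ` {..<m}))"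
    by (rule bij_betw_combine) auto
  moreover have "{..<m} \<union> ({..<n} - {..<m}) = {..<n}" "f ` {..<m} \<union> ({..<n} - f ` {..<m}) = {..<n}"
    using mn img by auto
  ultimately have "p permutes {..<n}"
    using mn by (intro bij_imp_permutes) (auto simp: p_def)
  then show ?thesis by (rule that) (simp add: p_def)
qed

context UP_cring
begin

abbreviation rank_idem :: "nat \<Rightarrow> (nat \<Rightarrow> nat \<Rightarrow> 'a) \<Rightarrow> nat \<Rightarrow> 'a" where
  "rank_idem n F \<equiv> coeff P (rank_det n F)"

lemma rank_idem_closed: "is_mat R n F \<Longrightarrow> rank_idem n F k \<in> carrier R"
  by (simp add: rank_det_closed)

lemma rank_idem_above: "is_mat R n F \<Longrightarrow> n < k \<Longrightarrow> rank_idem n F k = \<zero>"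
  using deg_rank_det[of n F] by (intro deg_aboveD) (auto simp: rank_det_closed)

lemma rank_det_repr:
  "is_mat R n F \<Longrightarrow> rank_det n F = (\<Oplus>\<^bsub>P\<^esub>i\<in>{..n}. monom P (rank_idem n F i) i)"
  by (simp add: up_repr_le deg_rank_det rank_det_closed)

lemma var_pow: "var [^]\<^bsub>P\<^esub> m = monom P \<one> m"
  using monom_pow[of \<one> "Suc 0" m] by simp

lemma subst_poly_power_rank_det:
  assumes F: "is_mat R n F"
  shows "subst_poly (monom P \<one> m) (rank_det n F) = (\<Oplus>\<^bsub>P\<^esub>i\<in>{..n}. monom P (rank_idem n F i) (m * i))"
proof -
  interpret h: ring_hom_cring P P "subst_poly (monom P \<one> m)" by (intro subst_poly_hom) simp
  have "subst_poly (monom P \<one> m) (rank_det n F) =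
      (\<Oplus>\<^bsub>P\<^esub>i\<in>{..n}. subst_poly (monom P \<one> m) (monom P (rank_idem n F i) i))"
    using h.hom_finsum[of "\<lambda>i. monom P (rank_idem n F i) i" "{..n}"] rank_idem_closed[OF F]
    by (subst rank_det_repr[OF F]) (simp add: comp_def Pi_def)
  also have "\<dots> = (\<Oplus>\<^bsub>P\<^esub>i\<in>{..n}. monom P (rank_idem n F i) (m * i))"
    using rank_idem_closed[OF F]
    by (intro P.finsum_cong') (auto simp: subst_poly_monom monom_pow monom_mult[symmetric] simp del: monom_mult)
  finally show ?thesis .
qed

text \<open>
With \<open>G(X) = (I - F) + X F\<close> the identity is the determinant of \<open>G(X) G(X\<^sup>m) = G(X\<^sup>m\<^sup>+\<^sup>1)\<close>.
\<close>

lemma rank_det_multiplicative: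
  assumes F: "is_mat R n F" "idempotent_mat R n F"
  shows "rank_det n F \<otimes>\<^bsub>P\<^esub> subst_poly (monom P \<one> m) (rank_det n F) =
    subst_poly (monom P \<one> (Suc m)) (rank_det n F)"
proof -
  let ?Y = "monom P \<one> m"
  have Y: "?Y \<in> carrier P" "var \<in> carrier P" by simp_all
  have "\<one>\<^bsub>P\<^esub> \<otimes>\<^bsub>P\<^esub> (?Y \<ominus>\<^bsub>P\<^esub> \<one>\<^bsub>P\<^esub>) \<oplus>\<^bsub>P\<^esub> (var \<ominus>\<^bsub>P\<^esub> \<one>\<^bsub>P\<^esub>) \<otimes>\<^bsub>P\<^esub> \<one>\<^bsub>P\<^esub> \<oplus>\<^bsub>P\<^esub>
      (var \<ominus>\<^bsub>P\<^esub> \<one>\<^bsub>P\<^esub>) \<otimes>\<^bsub>P\<^esub> (?Y \<ominus>\<^bsub>P\<^esub> \<one>\<^bsub>P\<^esub>) = var \<otimes>\<^bsub>P\<^esub> ?Y \<ominus>\<^bsub>P\<^esub> \<one>\<^bsub>P\<^esub>"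
    using Y by algebra
  moreover have "var \<otimes>\<^bsub>P\<^esub> ?Y = monom P \<one> (Suc m)"
    using monom_mult[of \<one> \<one> "Suc 0" m] by simp
  ultimately show ?thesis
    using P.mat_det_lin_mat_mult[OF is_mat_const[OF F(1)] idempotent_mat_const[OF F], of "\<one>\<^bsub>P\<^esub>" "var \<ominus>\<^bsub>P\<^esub> \<one>\<^bsub>P\<^esub>" "\<one>\<^bsub>P\<^esub>" "?Y \<ominus>\<^bsub>P\<^esub> \<one>\<^bsub>P\<^esub>"]
    by (simp add: subst_poly_rank_det[OF F(1)]) (simp add: rank_det_def)
qed

lemma coeff_sum_monom:
  assumes "finite I" "k \<in> I" "inj_on e I" "\<And>i. i \<in> I \<Longrightarrow> c i \<in> carrier R"
  shows "coeff P (\<Oplus>\<^bsub>P\<^esub>i\<in>I. monom P (c i) (e i)) (e k) = c k"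
proof -
  have "coeff P (\<Oplus>\<^bsub>P\<^esub>i\<in>I. monom P (c i) (e i)) (e k) = (\<Oplus>i\<in>I. coeff P (monom P (c i) (e i)) (e k))"
    using assms by (intro coeff_finsum) auto
  also have "\<dots> = coeff P (monom P (c k) (e k)) (e k)"
    using assms by (intro R.finsum_single) (auto dest: inj_onD)
  finally show ?thesis using assms by simp
qed

lemma coeff_sum_monom_notin:
  assumes "finite I" "d \<notin> e ` I" "\<And>i. i \<in> I \<Longrightarrow> c i \<in> carrier R"
  shows "coeff P (\<Oplus>\<^bsub>P\<^esub>i\<in>I. monom P (c i) (e i)) d = \<zero>"
proof -
  have "coeff P (\<Oplus>\<^bsub>P\<^esub>i\<in>I. monom P (c i) (e i)) d = (\<Oplus>i\<in>I. coeff P (monom P (c i) (e i)) d)"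
    using assms by (intro coeff_finsum) auto
  also have "\<dots> = (\<Oplus>i\<in>I. \<zero>)"
    using assms by (intro R.finsum_cong') auto
  finally show ?thesis by simp
qed

text \<open>
Uniqueness of base \<open>n + 1\<close> digits. Substituting \<open>X\<^sup>n\<^sup>+\<^sup>1\<close> for a second variable therefore loses no
information on polynomials of degree at most \<open>n\<close> in each variable.
\<close>

lemma kronecker_exponent_eq:
  assumes "i \<le> n" "a \<le> n" "i + Suc n * j = a + Suc n * b"
  shows "i = a \<and> j = b"
proof -
  have "(i + Suc n * j) div Suc n = j" "(a + Suc n * b) div Suc n = b"
    using assms(1,2) by (simp_all del: mult_Suc)
  then show ?thesis using assms(3) by simp
qed

text \<open>
In two variables the reason is \<open>R(X) R(Y) = R(X Y)\<close>: compare the coefficients of \<open>X\<^sup>a Y\<^sup>b\<close>. The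
proof puts \<open>Y = X\<^sup>n\<^sup>+\<^sup>1\<close>, which keeps all monomials with \<open>a, b \<le> n\<close> distinct, so that no second
variable is needed.
\<close>

lemma rank_idem_mult:
  assumes F: "is_mat R n F" "idempotent_mat R n F" and ab: "a \<le> n" "b \<le> n"
  shows "rank_idem n F a \<otimes> rank_idem n F b = (if a = b then rank_idem n F a else \<zero>)"
proof -
  let ?r = "rank_idem n F"
  note r = rank_idem_closed[OF F(1)]
  \<comment> \<open>Coefficient and exponent of the term of \<open>R(X) R(X\<^sup>n\<^sup>+\<^sup>1)\<close> indexed by \<open>(i, j)\<close>.\<close>
  let ?c = "\<lambda>(i, j). ?r i \<otimes> ?r j" and ?e = "\<lambda>(i, j). i + Suc n * j"
  have inj: "inj_on ?e ({..n} \<times> {..n})"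
    unfolding inj_on_def by (auto simp del: mult_Suc dest: kronecker_exponent_eq)
  have "rank_det n F \<otimes>\<^bsub>P\<^esub> subst_poly (monom P \<one> (Suc n)) (rank_det n F) =
      (\<Oplus>\<^bsub>P\<^esub>i\<in>{..n}. monom P (?r i) i) \<otimes>\<^bsub>P\<^esub> (\<Oplus>\<^bsub>P\<^esub>j\<in>{..n}. monom P (?r j) (Suc n * j))"
    by (subst subst_poly_power_rank_det[OF F(1)], subst rank_det_repr[OF F(1)]) (rule refl)
  also have "\<dots> = (\<Oplus>\<^bsub>P\<^esub>i\<in>{..n}. monom P (?r i) i \<otimes>\<^bsub>P\<^esub> (\<Oplus>\<^bsub>P\<^esub>j\<in>{..n}. monom P (?r j) (Suc n * j)))"
    using r by (intro P.finsum_ldistr) (auto intro!: P.finsum_closed)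
  also have "\<dots> = (\<Oplus>\<^bsub>P\<^esub>i\<in>{..n}. \<Oplus>\<^bsub>P\<^esub>j\<in>{..n}. monom P (?r i) i \<otimes>\<^bsub>P\<^esub> monom P (?r j) (Suc n * j))"
    using r by (intro P.finsum_cong' refl P.finsum_rdistr) (auto intro!: P.finsum_closed simp del: monom_mult)
  also have "\<dots> = (\<Oplus>\<^bsub>P\<^esub>z\<in>{..n} \<times> {..n}. monom P (?c z) (?e z))"
    using r by (subst P.finsum_Times) (auto simp: monom_mult)
  finally have "coeff P (\<Oplus>\<^bsub>P\<^esub>z\<in>{..n} \<times> {..n}. monom P (?c z) (?e z)) (?e (a, b)) =
      coeff P (\<Oplus>\<^bsub>P\<^esub>l\<in>{..n}. monom P (?r l) (Suc (Suc n) * l)) (?e (a, b))"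
    using rank_det_multiplicative[OF F, of "Suc n"] subst_poly_power_rank_det[OF F(1), of "Suc (Suc n)"]
    by simp
  moreover have "coeff P (\<Oplus>\<^bsub>P\<^esub>z\<in>{..n} \<times> {..n}. monom P (?c z) (?e z)) (?e (a, b)) = ?c (a, b)"
    using ab r inj by (intro coeff_sum_monom) auto
  moreover have "coeff P (\<Oplus>\<^bsub>P\<^esub>l\<in>{..n}. monom P (?r l) (Suc (Suc n) * l)) (?e (a, b)) =
      (if a = b then ?r a else \<zero>)"
  proof (cases "a = b")
    case True
    then have "?e (a, b) = Suc (Suc n) * a" by simp
    moreover have "coeff P (\<Oplus>\<^bsub>P\<^esub>l\<in>{..n}. monom P (?r l) (Suc (Suc n) * l)) (Suc (Suc n) * a) = ?r a"
      using ab r by (intro coeff_sum_monom[of _ _ "\<lambda>l. Suc (Suc n) * l"]) (auto simp: inj_on_def simp del: mult_Suc)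
    ultimately show ?thesis using True by (simp only: simp_thms if_True)
  next
    case False
    have "?e (a, b) \<notin> (\<lambda>l. Suc (Suc n) * l) ` {..n}"
    proof
      assume "?e (a, b) \<in> (\<lambda>l. Suc (Suc n) * l) ` {..n}"
      then obtain l where "l \<le> n" "a + Suc n * b = l + Suc n * l" by auto
      then show False using False kronecker_exponent_eq[of a n l b l] ab by simp
    qed
    then show ?thesis
      using False r by (subst coeff_sum_monom_notin) auto
  qed
  ultimately show ?thesis by simp
qed

text \<open>
Setting \<open>X = 1\<close> turns \<open>(I - F) + X F\<close> into the identity matrix.
\<close>

lemma rank_idem_sum:
  assumes F: "is_mat R n F"
  shows "(\<Oplus>i\<in>{..n}. rank_idem n F i) = \<one>"
proof -
  interpret U: UP_pre_univ_prop R R id P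
    by (rule UP_pre_univ_propI[OF R.is_cring R.is_cring], simp add: ring_hom_def, rule P_def)
  let ?h = "eval R R id \<one>"
  interpret h: ring_hom_cring P R ?h
    by (intro ring_hom_cringI UP_cring R.is_cring U.eval_ring_hom) simp
  note r = rank_idem_closed[OF F]
  have "?h (rank_det n F) = (\<Oplus>i\<in>{..n}. ?h (monom P (rank_idem n F i) i))"
    using h.hom_finsum[of "\<lambda>i. monom P (rank_idem n F i) i" "{..n}"] r
    by (subst rank_det_repr[OF F]) (simp add: comp_def Pi_def)
  also have "\<dots> = (\<Oplus>i\<in>{..n}. rank_idem n F i)"
    using r by (intro R.finsum_cong') (auto simp: U.eval_monom)
  finally have sum: "?h (rank_det n F) = (\<Oplus>i\<in>{..n}. rank_idem n F i)" .
  have "?h (var \<ominus>\<^bsub>P\<^esub> \<one>\<^bsub>P\<^esub>) = \<zero>"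
    using U.eval_monom[of \<one> \<one> "Suc 0"] by (simp add: a_minus_def R.r_neg)
  then have "?h (rank_det n F) = mat_det R n (lin_mat R \<one> \<zero> (\<lambda>i j. ?h (const (F i j))))"
    unfolding rank_det_def by (subst h.hom_mat_det_lin_mat) (auto simp: is_mat_const F)
  also have "\<dots> = mat_det R n (\<lambda>i j. if i = j then \<one> else \<zero>)"
    using F by (intro R.mat_det_cong R.is_mat_lin_mat) (auto simp: is_mat_def lin_mat_def)
  finally show ?thesis using sum R.mat_det_one by simp
qed

lemma const_rank_idem_mult_rank_det:
  assumes F: "is_mat R n F" "idempotent_mat R n F" and k: "k \<le> n"
  shows "const (rank_idem n F k) \<otimes>\<^bsub>P\<^esub> rank_det n F = monom P (rank_idem n F k) k"
proof (rule up_eqI)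
  note r = rank_idem_closed[OF F(1)] and d = rank_det_closed[OF F(1)]
  show "const (rank_idem n F k) \<otimes>\<^bsub>P\<^esub> rank_det n F \<in> carrier P" "monom P (rank_idem n F k) k \<in> carrier P"
    using r d by simp_all
  fix i
  have "coeff P (const (rank_idem n F k) \<otimes>\<^bsub>P\<^esub> rank_det n F) i = rank_idem n F k \<otimes> rank_idem n F i"
    using r d by (simp add: monom_mult_is_smult del: coeff_mult)
  also have "\<dots> = coeff P (monom P (rank_idem n F k) k) i"
    using r rank_idem_mult[OF F k, of i] rank_idem_above[OF F(1), of i] k
    by (cases "i \<le> n") auto
  finally show "coeff P (const (rank_idem n F k) \<otimes>\<^bsub>P\<^esub> rank_det n F) i =
      coeff P (monom P (rank_idem n F k) k) i" .
qed

lemma coeff_0_hom: "ring_hom_cring P R (\<lambda>p. coeff P p 0)"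
  by (intro ring_hom_cringI UP_cring R.is_cring) (auto simp: ring_hom_def)

lemma coeff_monom_mult_below:
  assumes "a \<in> carrier R" "p \<in> carrier P" "k < m"
  shows "coeff P (monom P a m \<otimes>\<^bsub>P\<^esub> p) k = \<zero>"
proof -
  have "coeff P (monom P a m \<otimes>\<^bsub>P\<^esub> p) k = (\<Oplus>i\<in>{..k}. coeff P (monom P a m) i \<otimes> coeff P p (k - i))"
    using assms by (intro coeff_mult) auto
  also have "\<dots> = (\<Oplus>i\<in>{..k}. \<zero>)"
    using assms by (intro R.finsum_cong') auto
  finally show ?thesis by simp
qed

text \<open>
Let \<open>G = (I - F) + X F\<close> and \<open>H = X (I - F) + F\<close>, so \<open>H G = X I\<close>. If \<open>N\<close> consists of \<open>k + 1\<close> rows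
of \<open>H\<close> completed by unit vectors, then \<open>N G\<close> has \<open>k + 1\<close> rows divisible by \<open>X\<close>, and hence
\<open>X\<^sup>k\<^sup>+\<^sup>1\<close> divides \<open>det N det G\<close>. But \<open>r\<^sub>k det G = r\<^sub>k X\<^sup>k\<close>, so \<open>X\<close> divides \<open>r\<^sub>k det N\<close>, whose
constant coefficient is \<open>r\<^sub>k\<close> times a minor of \<open>F\<close>, since \<open>H\<close> becomes \<open>F\<close> at \<open>X = 0\<close>.

The row and column selections \<open>f\<close> and \<open>g\<close> are arbitrary maps, neither increasing nor injective:
the bordered minors in the proof of freeness have this shape.
\<close>

lemma rank_idem_minor_zero:
  assumes F: "is_mat R n F" "idempotent_mat R n F" and k: "k \<le> n"
    and f: "\<And>a. a < Suc k \<Longrightarrow> f a < n" and g: "\<And>b. b < Suc k \<Longrightarrow> g b < n"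
  shows "rank_idem n F k \<otimes> mat_det R (Suc k) (\<lambda>a b. F (f a) (g b)) = \<zero>"
proof -
  let ?m = "Suc k"
  let ?M = "\<lambda>a b. F (f a) (g b)"
  note r = rank_idem_closed[OF F(1)]
  have M: "is_mat R ?m ?M" using F f g by (simp add: is_mat_def)
  consider "\<not> inj_on f {..<?m}" | "\<not> inj_on g {..<?m}" | "inj_on f {..<?m}" "inj_on g {..<?m}"
    by blast
  then show ?thesis
  proof cases
    case 1
    then obtain a b where "a < ?m" "b < ?m" "a \<noteq> b" "f a = f b" by (auto simp: inj_on_def)
    then have "mat_det R ?m ?M = \<zero>" using M by (intro R.mat_det_equal_rows[of _ _ a b]) auto
    then show ?thesis using r by simp
  next
    case 2
    then obtain a b where "a < ?m" "b < ?m" "a \<noteq> b" "g a = g b" by (auto simp: inj_on_def)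
    then have "mat_det R ?m (\<lambda>i j. ?M j i) = \<zero>"
      using M by (intro R.mat_det_equal_rows[of _ _ a b]) (auto simp: is_mat_def)
    then show ?thesis using r R.mat_det_transpose[OF M] by simp
  next
    case 3
    obtain \<sigma> where \<sigma>: "\<sigma> permutes {..<n}" "\<And>a. a < ?m \<Longrightarrow> \<sigma> a = f a"
      using inj_on_extends_to_permutation[OF 3(1), of n] f by blast
    obtain \<tau> where \<tau>: "\<tau> permutes {..<n}" "\<And>b. b < ?m \<Longrightarrow> \<tau> b = g b"
      using inj_on_extends_to_permutation[OF 3(2), of n] g by blast
    have mn: "?m \<le> n" using card_inj_on_le[OF 3(1), of "{..<n}"] f by (auto simp: image_subset_iff)
    have lt: "\<sigma> i < n" "\<tau> i < n" if "i < n" for i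
      using that \<sigma>(1) \<tau>(1) by (auto intro: R.perm_lt)
    note F' = is_mat_const[OF F(1)] idempotent_mat_const[OF F]
    have X: "var \<in> carrier P" by simp
    define G where "G = lin_mat P \<one>\<^bsub>P\<^esub> (var \<ominus>\<^bsub>P\<^esub> \<one>\<^bsub>P\<^esub>) (const_mat F)"
    define H where "H = lin_mat P var (\<one>\<^bsub>P\<^esub> \<ominus>\<^bsub>P\<^esub> var) (const_mat F)"
    define G' where "G' i j = G (\<tau> i) (\<sigma> j)" for i j
    define H' where "H' i j = H (\<sigma> i) (\<tau> j)" for i j
    have G: "is_mat P n G" and H: "is_mat P n H"
      unfolding G_def H_def using X by (auto intro!: P.is_mat_lin_mat F')
    have G': "is_mat P n G'" and H': "is_mat P n H'"
      using G H lt by (auto simp: is_mat_def G'_def H'_def)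
    have HG: "mat_mult P n H G i j = (if i = j then var else \<zero>\<^bsub>P\<^esub>)" if "i < n" "j < n" for i j
    proof -
      have "mat_mult P n H G i j = lin_mat P (var \<otimes>\<^bsub>P\<^esub> \<one>\<^bsub>P\<^esub>) (var \<otimes>\<^bsub>P\<^esub> (var \<ominus>\<^bsub>P\<^esub> \<one>\<^bsub>P\<^esub>) \<oplus>\<^bsub>P\<^esub>
          (\<one>\<^bsub>P\<^esub> \<ominus>\<^bsub>P\<^esub> var) \<otimes>\<^bsub>P\<^esub> \<one>\<^bsub>P\<^esub> \<oplus>\<^bsub>P\<^esub> (\<one>\<^bsub>P\<^esub> \<ominus>\<^bsub>P\<^esub> var) \<otimes>\<^bsub>P\<^esub> (var \<ominus>\<^bsub>P\<^esub> \<one>\<^bsub>P\<^esub>)) (const_mat F) i j"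
        unfolding G_def H_def using X that by (intro P.lin_mat_mult F') auto
      moreover have "var \<otimes>\<^bsub>P\<^esub> (var \<ominus>\<^bsub>P\<^esub> \<one>\<^bsub>P\<^esub>) \<oplus>\<^bsub>P\<^esub>
          (\<one>\<^bsub>P\<^esub> \<ominus>\<^bsub>P\<^esub> var) \<otimes>\<^bsub>P\<^esub> \<one>\<^bsub>P\<^esub> \<oplus>\<^bsub>P\<^esub> (\<one>\<^bsub>P\<^esub> \<ominus>\<^bsub>P\<^esub> var) \<otimes>\<^bsub>P\<^esub> (var \<ominus>\<^bsub>P\<^esub> \<one>\<^bsub>P\<^esub>) = \<zero>\<^bsub>P\<^esub>"
        using X by algebra
      ultimately show ?thesis using that X F(1) by (simp add: lin_mat_def R.is_matD)
    qed
    have HG': "(\<Oplus>\<^bsub>P\<^esub>l\<in>{..<n}. H' i l \<otimes>\<^bsub>P\<^esub> G' l j) = (if i = j then var else \<zero>\<^bsub>P\<^esub>)" if "i < n" "j < n" for i j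
    proof -
      have "(\<Oplus>\<^bsub>P\<^esub>l\<in>{..<n}. H' i l \<otimes>\<^bsub>P\<^esub> G' l j) = (\<Oplus>\<^bsub>P\<^esub>l\<in>\<tau> ` {..<n}. H (\<sigma> i) l \<otimes>\<^bsub>P\<^esub> G l (\<sigma> j))"
        unfolding H'_def G'_def using G H that lt permutes_inj_on[OF \<tau>(1)]
        by (intro P.finsum_reindex[symmetric]) (auto simp: P.is_matD)
      also have "\<dots> = mat_mult P n H G (\<sigma> i) (\<sigma> j)"
        by (simp add: permutes_image[OF \<tau>(1)] mat_mult_def)
      also have "\<dots> = (if i = j then var else \<zero>\<^bsub>P\<^esub>)"
        using that lt HG by (simp add: inj_eq[OF permutes_inj[OF \<sigma>(1)]])
      finally show ?thesis .
    qed
    \<comment> \<open>The rows of the minor come from \<open>H\<close>; the unit rows below them leave its determinant unchanged.\<close>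
    define N where "N i j = (if i < ?m then H' i j else if i = j then \<one>\<^bsub>P\<^esub> else \<zero>\<^bsub>P\<^esub>)" for i j
    define K where "K i j = (if i < ?m then if i = j then \<one>\<^bsub>P\<^esub> else \<zero>\<^bsub>P\<^esub> else G' i j)" for i j
    \<comment> \<open>The product of \<open>N\<close> with the permuted \<open>G\<close> is \<open>diag(c) K\<close>.\<close>
    define c where "c i = (if i < ?m then var else \<one>\<^bsub>P\<^esub>)" for i
    have N: "is_mat P n N" and K: "is_mat P n K" and c: "c \<in> {..<n} \<rightarrow> carrier P"
      using G' H' by (auto simp: is_mat_def N_def K_def c_def)
    have NG': "mat_mult P n N G' i j = c i \<otimes>\<^bsub>P\<^esub> K i j" if ij: "i < n" "j < n" for i j
    proof (cases "i < ?m")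
      case True
      then have "mat_mult P n N G' i j = (\<Oplus>\<^bsub>P\<^esub>l\<in>{..<n}. H' i l \<otimes>\<^bsub>P\<^esub> G' l j)"
        by (simp add: mat_mult_def N_def)
      then show ?thesis using True HG'[OF ij] by (simp add: c_def K_def)
    next
      case False
      have "mat_mult P n N G' i j = N i i \<otimes>\<^bsub>P\<^esub> G' i j"
        unfolding mat_mult_def using False ij G'
        by (intro P.finsum_single) (auto simp: N_def P.is_matD)
      then show ?thesis using False ij G' by (simp add: N_def c_def K_def P.is_matD)
    qed
    have prod_c: "(\<Otimes>\<^bsub>P\<^esub>i\<in>{..<n}. c i) = monom P \<one> ?m"
    proof -
      have "(\<Otimes>\<^bsub>P\<^esub>i\<in>{..<n}. c i) = (\<Otimes>\<^bsub>P\<^esub>i\<in>{..<?m}. var)"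
        using mn c by (intro P.finprod_mono_neutral_cong_right) (auto simp: c_def)
      then show ?thesis by (simp only: P.finprod_const_pow[OF X] var_pow)
    qed
    let ?s = "perm_sign P \<sigma>" and ?t = "perm_sign P \<tau>"
    note dets = P.mat_det_closed[OF N] P.mat_det_closed[OF K] P.mat_det_closed[OF G] rank_det_closed[OF F(1)]
    have "is_mat P n (\<lambda>i j. G i (\<sigma> j))" using G lt by (simp add: is_mat_def)
    then have detG': "mat_det P n G' = ?t \<otimes>\<^bsub>P\<^esub> (?s \<otimes>\<^bsub>P\<^esub> rank_det n F)"
      unfolding G'_def[abs_def] rank_det_def G_def[symmetric]
      using P.mat_det_permute_rows[OF _ \<tau>(1), of "\<lambda>i j. G i (\<sigma> j)"] P.mat_det_permute_cols[OF G \<sigma>(1)] by simp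
    have "mat_det P n N \<otimes>\<^bsub>P\<^esub> mat_det P n G' = mat_det P n (mat_mult P n N G')"
      by (rule P.mat_det_mult[OF N G', symmetric])
    also have "\<dots> = mat_det P n (\<lambda>i j. c i \<otimes>\<^bsub>P\<^esub> K i j)"
      by (rule P.mat_det_cong[OF P.is_mat_mult[OF N G']]) (rule NG')
    also have "\<dots> = monom P \<one> ?m \<otimes>\<^bsub>P\<^esub> mat_det P n K"
      using P.mat_det_scale_rows[OF K c] by (simp add: prod_c)
    finally have "mat_det P n N \<otimes>\<^bsub>P\<^esub> (?t \<otimes>\<^bsub>P\<^esub> (?s \<otimes>\<^bsub>P\<^esub> rank_det n F)) = monom P \<one> ?m \<otimes>\<^bsub>P\<^esub> mat_det P n K"
      by (simp only: detG')
    \<comment> \<open>The signs are units, being their own inverses, so they can be moved to the right-hand side.\<close>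
    then have "?s \<otimes>\<^bsub>P\<^esub> ?t \<otimes>\<^bsub>P\<^esub> (mat_det P n N \<otimes>\<^bsub>P\<^esub> (?t \<otimes>\<^bsub>P\<^esub> (?s \<otimes>\<^bsub>P\<^esub> rank_det n F))) =
        ?s \<otimes>\<^bsub>P\<^esub> ?t \<otimes>\<^bsub>P\<^esub> (monom P \<one> ?m \<otimes>\<^bsub>P\<^esub> mat_det P n K)" by simp
    moreover have "?s \<otimes>\<^bsub>P\<^esub> ?t \<otimes>\<^bsub>P\<^esub> (mat_det P n N \<otimes>\<^bsub>P\<^esub> (?t \<otimes>\<^bsub>P\<^esub> (?s \<otimes>\<^bsub>P\<^esub> rank_det n F))) =
        (?s \<otimes>\<^bsub>P\<^esub> ?s) \<otimes>\<^bsub>P\<^esub> (?t \<otimes>\<^bsub>P\<^esub> ?t) \<otimes>\<^bsub>P\<^esub> (mat_det P n N \<otimes>\<^bsub>P\<^esub> rank_det n F)"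
      using dets by (simp add: P.m_ac del: P.perm_sign_square)
    ultimately have main: "mat_det P n N \<otimes>\<^bsub>P\<^esub> rank_det n F =
        monom P \<one> ?m \<otimes>\<^bsub>P\<^esub> (?s \<otimes>\<^bsub>P\<^esub> ?t \<otimes>\<^bsub>P\<^esub> mat_det P n K)"
      using dets by (simp add: P.m_ac)
    let ?r = "rank_idem n F k"
    let ?q = "?s \<otimes>\<^bsub>P\<^esub> ?t \<otimes>\<^bsub>P\<^esub> mat_det P n K"
    have rk: "?r \<in> carrier R" and q: "?q \<in> carrier P" using r dets by simp_all
    have "monom P ?r k \<otimes>\<^bsub>P\<^esub> mat_det P n N = const ?r \<otimes>\<^bsub>P\<^esub> (mat_det P n N \<otimes>\<^bsub>P\<^esub> rank_det n F)"
      unfolding const_rank_idem_mult_rank_det[OF F k, symmetric] using dets rk by (simp add: P.m_ac)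
    also have "\<dots> = monom P ?r ?m \<otimes>\<^bsub>P\<^esub> ?q"
    proof -
      have "monom P ?r ?m = const ?r \<otimes>\<^bsub>P\<^esub> monom P \<one> ?m"
        using monom_mult[OF rk R.one_closed, of 0 ?m] rk by simp
      then show ?thesis unfolding main using rk q by (simp add: P.m_assoc del: monom_mult)
    qed
    finally have "coeff P (monom P ?r k \<otimes>\<^bsub>P\<^esub> mat_det P n N) k = \<zero>"
      using coeff_monom_mult_below[OF rk q, of k ?m] by simp
    then have "?r \<otimes> coeff P (mat_det P n N) 0 = \<zero>"
      using coeff_monom_mult[OF rk dets(1), of k 0] by simp
    moreover have "coeff P (mat_det P n N) 0 = mat_det R ?m ?M"
    proof -
      interpret e: ring_hom_cring P R "\<lambda>p. coeff P p 0" by (rule coeff_0_hom)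
      have Nm: "is_mat P ?m N" using N mn by (auto simp: is_mat_def)
      have "mat_det P n N = mat_det P ?m N"
        using mn by (intro P.mat_det_unit_rows N) (auto simp: N_def)
      then have "coeff P (mat_det P n N) 0 = coeff P (mat_det P ?m N) 0" by simp
      also have "\<dots> = mat_det R ?m (\<lambda>i j. coeff P (N i j) 0)"
        by (rule e.hom_mat_det[OF Nm])
      also have "\<dots> = mat_det R ?m ?M"
      proof (rule R.mat_det_cong[symmetric, OF M])
        fix i j assume ij: "i < ?m" "j < ?m"
        then have "F (\<sigma> i) (\<tau> j) \<in> carrier R" using F(1) lt mn by (intro R.is_matD[of n]) auto
        then show "?M i j = coeff P (N i j) 0"
          using ij X \<sigma>(2) \<tau>(2) by (auto simp: N_def H'_def H_def lin_mat_def a_minus_def)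
      qed
      finally show ?thesis .
    qed
    ultimately show ?thesis by simp
  qed
qed

end

section \<open>Localization of modules\<close>

lemma (in module) free_of_rankI:
  assumes b: "b \<in> {..<k} \<rightarrow> carrier M"
    and span: "\<And>x. x \<in> carrier M \<Longrightarrow> \<exists>v \<in> {..<k} \<rightarrow> carrier R. x = (\<Oplus>\<^bsub>M\<^esub>i\<in>{..<k}. v i \<odot>\<^bsub>M\<^esub> b i)"
    and indep: "\<And>v i. v \<in> {..<k} \<rightarrow> carrier R \<Longrightarrow> (\<Oplus>\<^bsub>M\<^esub>i\<in>{..<k}. v i \<odot>\<^bsub>M\<^esub> b i) = \<zero>\<^bsub>M\<^esub> \<Longrightarrow> i < k \<Longrightarrow> v i = \<zero>"
  shows "free_of_rank R M k"
proof -
  let ?h = "\<lambda>v. \<Oplus>\<^bsub>M\<^esub>i\<in>{..<k}. v i \<odot>\<^bsub>M\<^esub> b i"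
  let ?C = "{..<k} \<rightarrow>\<^sub>E carrier R"
  have summand: "v i \<odot>\<^bsub>M\<^esub> b i \<in> carrier M" if "v \<in> {..<k} \<rightarrow> carrier R" "i < k" for v i
    using that b by auto
  have add: "?h (\<lambda>i\<in>{..<k}. v i \<oplus> w i) = ?h v \<oplus>\<^bsub>M\<^esub> ?h w"
    if v: "v \<in> {..<k} \<rightarrow> carrier R" and w: "w \<in> {..<k} \<rightarrow> carrier R" for v w
  proof -
    have "?h (\<lambda>i\<in>{..<k}. v i \<oplus> w i) = (\<Oplus>\<^bsub>M\<^esub>i\<in>{..<k}. v i \<odot>\<^bsub>M\<^esub> b i \<oplus>\<^bsub>M\<^esub> w i \<odot>\<^bsub>M\<^esub> b i)"
      using v w b by (intro M.finsum_cong') (auto simp: Pi_iff smult_l_distr)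
    also have "\<dots> = ?h v \<oplus>\<^bsub>M\<^esub> ?h w"
      using v w summand by (intro M.finsum_addf) auto
    finally show ?thesis .
  qed
  have smult: "?h (\<lambda>i\<in>{..<k}. a \<otimes> v i) = a \<odot>\<^bsub>M\<^esub> ?h v"
    if a: "a \<in> carrier R" and v: "v \<in> {..<k} \<rightarrow> carrier R" for a v
  proof -
    have "a \<odot>\<^bsub>M\<^esub> ?h v = (\<Oplus>\<^bsub>M\<^esub>i\<in>{..<k}. a \<odot>\<^bsub>M\<^esub> (v i \<odot>\<^bsub>M\<^esub> b i))"
      using a v summand by (intro finsum_smult_ldistr) auto
    also have "\<dots> = ?h (\<lambda>i\<in>{..<k}. a \<otimes> v i)"
      using a v b by (intro M.finsum_cong') (auto simp: Pi_iff smult_assoc1)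
    finally show ?thesis by simp
  qed
  have closed: "?h v \<in> carrier M" if "v \<in> {..<k} \<rightarrow> carrier R" for v
    using that summand by (intro M.finsum_closed) auto
  have "inj_on ?h ?C"
  proof (rule inj_onI)
    fix v w assume vw: "v \<in> ?C" "w \<in> ?C" "?h v = ?h w"
    then have v: "v \<in> {..<k} \<rightarrow> carrier R" and w: "w \<in> {..<k} \<rightarrow> carrier R" by auto
    define u where "u = (\<lambda>i\<in>{..<k}. v i \<oplus> (\<lambda>i\<in>{..<k}. (\<ominus> \<one>) \<otimes> w i) i)"
    have w': "(\<lambda>i\<in>{..<k}. (\<ominus> \<one>) \<otimes> w i) \<in> {..<k} \<rightarrow> carrier R" using w by auto
    have "?h u = ?h v \<oplus>\<^bsub>M\<^esub> (\<ominus> \<one>) \<odot>\<^bsub>M\<^esub> ?h w"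
      unfolding u_def using add[OF v w'] smult[OF _ w, of "\<ominus> \<one>"] by simp
    also have "\<dots> = \<zero>\<^bsub>M\<^esub>"
      using vw closed[OF w] by (simp add: smult_l_minus M.r_neg)
    finally have "?h u = \<zero>\<^bsub>M\<^esub>" .
    moreover have "u \<in> {..<k} \<rightarrow> carrier R" using v w by (auto simp: u_def Pi_iff)
    ultimately have u: "u i = \<zero>" if "i < k" for i using indep that by blast
    show "v = w"
    proof
      fix i
      show "v i = w i"
      proof (cases "i < k")
        case True
        then have "v i \<in> carrier R" "w i \<in> carrier R" using v w by auto
        moreover have "v i \<oplus> \<ominus> w i = \<zero>"
          using u[OF True] True w by (auto simp: u_def l_minus Pi_iff)
        ultimately show ?thesis using R.minus_equality R.minus_minus R.a_inv_closed R.add.m_comm by metis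
      next
        case False
        then show ?thesis using vw by (auto simp: PiE_def extensional_def)
      qed
    qed
  qed
  moreover have "?h ` ?C = carrier M"
  proof
    show "?h ` ?C \<subseteq> carrier M" using closed by auto
    show "carrier M \<subseteq> ?h ` ?C"
    proof
      fix x assume "x \<in> carrier M"
      then obtain v where v: "v \<in> {..<k} \<rightarrow> carrier R" "x = ?h v" using span by blast
      have "?h (restrict v {..<k}) = ?h v"
        using v(1) summand by (intro M.finsum_cong') auto
      moreover have "restrict v {..<k} \<in> ?C" using v(1) by auto
      ultimately show "x \<in> ?h ` ?C" unfolding v(2) by (intro image_eqI[of _ _ "restrict v {..<k}"]) simp_all
    qed
  qed
  ultimately have "bij_betw ?h ?C (carrier M)" by (simp add: bij_betw_def)
  then have "?h \<in> module_iso R (standard_module R k) M"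
    using add smult by (simp add: module_iso_def standard_module_def PiE_def)
  then show ?thesis
    using module_axioms unfolding free_of_rank_def by blast
qed

text \<open>
Operations on classes of fractions are unions over all representatives; this evaluates such a
union once independence of the representatives is known.
\<close>

lemma UN_UN_constant:
  assumes "x \<in> X" "y \<in> Y" "\<And>a b c d. (a, b) \<in> X \<Longrightarrow> (c, d) \<in> Y \<Longrightarrow> f a b c d = C"
  shows "(\<Union>(a, b)\<in>X. \<Union>(c, d)\<in>Y. f a b c d) = C"
proof -
  have "(\<Union>(c, d)\<in>Y. f a b c d) = C" if "(a, b) \<in> X" for a b
  proof -
    have "(\<Union>(c, d)\<in>Y. f a b c d) = (\<Union>z\<in>Y. C)"
      using assms(3)[OF that] by (intro SUP_cong) auto
    then show ?thesis using assms(2) by auto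
  qed
  then have "(\<Union>(a, b)\<in>X. \<Union>(c, d)\<in>Y. f a b c d) = (\<Union>z\<in>X. C)"
    by (intro SUP_cong refl) (simp add: split_beta)
  then show ?thesis using assms(1) by auto
qed

text \<open>
The axioms of the localized ring are those of the localized module of the regular module, so the calculus of
fractions is developed once for modules and then specialized.
\<close>

locale localization = module R M for R (structure) and M (structure) +
  fixes S
  assumes S_subset: "S \<subseteq> carrier R" and S_one: "\<one> \<in> S"
    and S_mult: "s \<in> S \<Longrightarrow> t \<in> S \<Longrightarrow> s \<otimes> t \<in> S"
begin

abbreviation L where "L \<equiv> loc_module R M S"
abbreviation RS where "RS \<equiv> loc_ring R S"

lemma S_carrier: "s \<in> S \<Longrightarrow> s \<in> carrier R"
  using S_subset by blast

lemma smult_lcomm: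
  "a \<in> carrier R \<Longrightarrow> b \<in> carrier R \<Longrightarrow> x \<in> carrier M \<Longrightarrow> a \<odot>\<^bsub>M\<^esub> (b \<odot>\<^bsub>M\<^esub> x) = b \<odot>\<^bsub>M\<^esub> (a \<odot>\<^bsub>M\<^esub> x)"
  by (metis R.m_comm smult_assoc1)

lemma frac_rel_iff:
  "((x, s), (y, t)) \<in> frac_rel M S \<longleftrightarrow> x \<in> carrier M \<and> y \<in> carrier M \<and> s \<in> S \<and> t \<in> S \<and>
    (\<exists>u\<in>S. u \<odot>\<^bsub>M\<^esub> (t \<odot>\<^bsub>M\<^esub> x) = u \<odot>\<^bsub>M\<^esub> (s \<odot>\<^bsub>M\<^esub> y))"
  by (auto simp: frac_rel_def)

lemma frac_rel_trans:
  assumes "((x, s), (y, t)) \<in> frac_rel M S" "((y, t), (z, r)) \<in> frac_rel M S"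
  shows "((x, s), (z, r)) \<in> frac_rel M S"
proof -
  obtain u where u: "u \<in> S" "u \<odot>\<^bsub>M\<^esub> (t \<odot>\<^bsub>M\<^esub> x) = u \<odot>\<^bsub>M\<^esub> (s \<odot>\<^bsub>M\<^esub> y)"
    using assms(1) by (auto simp: frac_rel_iff)
  obtain v where v: "v \<in> S" "v \<odot>\<^bsub>M\<^esub> (r \<odot>\<^bsub>M\<^esub> y) = v \<odot>\<^bsub>M\<^esub> (t \<odot>\<^bsub>M\<^esub> z)"
    using assms(2) by (auto simp: frac_rel_iff)
  have S: "s \<in> S" "t \<in> S" "r \<in> S" and M: "x \<in> carrier M" "y \<in> carrier M" "z \<in> carrier M"
    using assms by (auto simp: frac_rel_iff)
  note [simp] = S_carrier[OF S(1)] S_carrier[OF S(2)] S_carrier[OF S(3)] S_carrier[OF u(1)] S_carrier[OF v(1)] M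
  have "(u \<otimes> v \<otimes> t) \<odot>\<^bsub>M\<^esub> (r \<odot>\<^bsub>M\<^esub> x) = (v \<otimes> r) \<odot>\<^bsub>M\<^esub> (u \<odot>\<^bsub>M\<^esub> (t \<odot>\<^bsub>M\<^esub> x))"
    by (simp add: smult_assoc1[symmetric] R.m_ac)
  also have "\<dots> = (u \<otimes> s) \<odot>\<^bsub>M\<^esub> (v \<odot>\<^bsub>M\<^esub> (r \<odot>\<^bsub>M\<^esub> y))"
    unfolding u(2) by (simp add: smult_assoc1[symmetric] R.m_ac)
  also have "\<dots> = (u \<otimes> v \<otimes> t) \<odot>\<^bsub>M\<^esub> (s \<odot>\<^bsub>M\<^esub> z)"
    unfolding v(2) by (simp add: smult_assoc1[symmetric] R.m_ac)
  finally show ?thesis using S M u v S_mult unfolding frac_rel_iff by blast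
qed

lemma frac_rel_equiv: "equiv (carrier M \<times> S) (frac_rel M S)"
proof (rule equivI)
  show "frac_rel M S \<subseteq> (carrier M \<times> S) \<times> (carrier M \<times> S)" by (auto simp: frac_rel_iff)
  show "refl_on (carrier M \<times> S) (frac_rel M S)"
    using S_one by (auto simp: refl_on_def frac_rel_iff)
  show "sym (frac_rel M S)" by (auto simp: sym_def frac_rel_iff) metis
  show "trans (frac_rel M S)" by (rule transI) (metis frac_rel_trans prod.collapse)
qed

lemma frac_eq_iff:
  assumes "x \<in> carrier M" "s \<in> S" "y \<in> carrier M" "t \<in> S"
  shows "frac M S x s = frac M S y t \<longleftrightarrow> (\<exists>u\<in>S. u \<odot>\<^bsub>M\<^esub> (t \<odot>\<^bsub>M\<^esub> x) = u \<odot>\<^bsub>M\<^esub> (s \<odot>\<^bsub>M\<^esub> y))"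
  unfolding frac_def using eq_equiv_class_iff[OF frac_rel_equiv, of "(x, s)" "(y, t)"] assms
  by (simp add: frac_rel_iff)

lemma frac_eqI:
  assumes "x \<in> carrier M" "s \<in> S" "y \<in> carrier M" "t \<in> S" "t \<odot>\<^bsub>M\<^esub> x = s \<odot>\<^bsub>M\<^esub> y"
  shows "frac M S x s = frac M S y t"
  using assms S_one by (auto simp: frac_eq_iff)

lemma frac_cancel:
  assumes "x \<in> carrier M" "s \<in> S" "t \<in> S"
  shows "frac M S (t \<odot>\<^bsub>M\<^esub> x) (t \<otimes> s) = frac M S x s"
  using assms S_mult S_carrier by (intro frac_eqI) (auto simp: smult_assoc1 smult_lcomm)

lemma mem_frac_iff:
  "(y, t) \<in> frac M S x s \<longleftrightarrow> x \<in> carrier M \<and> y \<in> carrier M \<and> s \<in> S \<and> t \<in> S \<and>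
    (\<exists>u\<in>S. u \<odot>\<^bsub>M\<^esub> (t \<odot>\<^bsub>M\<^esub> x) = u \<odot>\<^bsub>M\<^esub> (s \<odot>\<^bsub>M\<^esub> y))"
  by (auto simp: frac_def frac_rel_iff)

lemma frac_self: "x \<in> carrier M \<Longrightarrow> s \<in> S \<Longrightarrow> (x, s) \<in> frac M S x s"
  using S_one by (auto simp: mem_frac_iff)

lemma L_carrier: "carrier L = {frac M S x s |x s. x \<in> carrier M \<and> s \<in> S}"
  by (simp add: loc_module_def)

lemma frac_closed: "x \<in> carrier M \<Longrightarrow> s \<in> S \<Longrightarrow> frac M S x s \<in> carrier L"
  by (auto simp: L_carrier)

lemma L_cases:
  assumes "X \<in> carrier L"
  obtains x s where "x \<in> carrier M" "s \<in> S" "X = frac M S x s"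
  using assms by (auto simp: L_carrier)

lemma L_zero: "\<zero>\<^bsub>L\<^esub> = frac M S \<zero>\<^bsub>M\<^esub> \<one>"
  by (simp add: loc_module_def)

lemma frac_add:
  assumes xs: "x \<in> carrier M" "s \<in> S" and yt: "y \<in> carrier M" "t \<in> S"
  shows "frac M S x s \<oplus>\<^bsub>L\<^esub> frac M S y t = frac M S (t \<odot>\<^bsub>M\<^esub> x \<oplus>\<^bsub>M\<^esub> s \<odot>\<^bsub>M\<^esub> y) (s \<otimes> t)"
proof -
  have "frac M S x s \<oplus>\<^bsub>L\<^esub> frac M S y t =
      (\<Union>(x, s)\<in>frac M S x s. \<Union>(y, t)\<in>frac M S y t. frac M S (t \<odot>\<^bsub>M\<^esub> x \<oplus>\<^bsub>M\<^esub> s \<odot>\<^bsub>M\<^esub> y) (s \<otimes> t))"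
    by (simp add: loc_module_def)
  also have "\<dots> = frac M S (t \<odot>\<^bsub>M\<^esub> x \<oplus>\<^bsub>M\<^esub> s \<odot>\<^bsub>M\<^esub> y) (s \<otimes> t)"
  proof (rule UN_UN_constant[OF frac_self[OF xs] frac_self[OF yt]])
    fix x' s' y' t'
    assume "(x', s') \<in> frac M S x s" "(y', t') \<in> frac M S y t"
    then obtain u v where
      x': "x' \<in> carrier M" "s' \<in> S" "u \<in> S" "u \<odot>\<^bsub>M\<^esub> (s' \<odot>\<^bsub>M\<^esub> x) = u \<odot>\<^bsub>M\<^esub> (s \<odot>\<^bsub>M\<^esub> x')" and
      y': "y' \<in> carrier M" "t' \<in> S" "v \<in> S" "v \<odot>\<^bsub>M\<^esub> (t' \<odot>\<^bsub>M\<^esub> y) = v \<odot>\<^bsub>M\<^esub> (t \<odot>\<^bsub>M\<^esub> y')"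
      by (auto simp: mem_frac_iff)
    note [simp] = xs(1) yt(1) x'(1) y'(1) S_carrier[OF xs(2)] S_carrier[OF yt(2)] S_carrier[OF x'(2)]
      S_carrier[OF x'(3)] S_carrier[OF y'(2)] S_carrier[OF y'(3)]
    have 1: "(u \<otimes> v) \<odot>\<^bsub>M\<^esub> ((s \<otimes> t) \<odot>\<^bsub>M\<^esub> (t' \<odot>\<^bsub>M\<^esub> x')) = (u \<otimes> v) \<odot>\<^bsub>M\<^esub> ((s' \<otimes> t') \<odot>\<^bsub>M\<^esub> (t \<odot>\<^bsub>M\<^esub> x))"
    proof -
      have "(u \<otimes> v) \<odot>\<^bsub>M\<^esub> ((s \<otimes> t) \<odot>\<^bsub>M\<^esub> (t' \<odot>\<^bsub>M\<^esub> x')) = (v \<otimes> t \<otimes> t') \<odot>\<^bsub>M\<^esub> (u \<odot>\<^bsub>M\<^esub> (s \<odot>\<^bsub>M\<^esub> x'))"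
        by (simp add: smult_assoc1[symmetric] R.m_ac)
      also have "\<dots> = (u \<otimes> v) \<odot>\<^bsub>M\<^esub> ((s' \<otimes> t') \<odot>\<^bsub>M\<^esub> (t \<odot>\<^bsub>M\<^esub> x))"
        unfolding x'(4)[symmetric] by (simp add: smult_assoc1[symmetric] R.m_ac)
      finally show ?thesis .
    qed
    have 2: "(u \<otimes> v) \<odot>\<^bsub>M\<^esub> ((s \<otimes> t) \<odot>\<^bsub>M\<^esub> (s' \<odot>\<^bsub>M\<^esub> y')) = (u \<otimes> v) \<odot>\<^bsub>M\<^esub> ((s' \<otimes> t') \<odot>\<^bsub>M\<^esub> (s \<odot>\<^bsub>M\<^esub> y))"
    proof -
      have "(u \<otimes> v) \<odot>\<^bsub>M\<^esub> ((s \<otimes> t) \<odot>\<^bsub>M\<^esub> (s' \<odot>\<^bsub>M\<^esub> y')) = (u \<otimes> s \<otimes> s') \<odot>\<^bsub>M\<^esub> (v \<odot>\<^bsub>M\<^esub> (t \<odot>\<^bsub>M\<^esub> y'))"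
        by (simp add: smult_assoc1[symmetric] R.m_ac)
      also have "\<dots> = (u \<otimes> v) \<odot>\<^bsub>M\<^esub> ((s' \<otimes> t') \<odot>\<^bsub>M\<^esub> (s \<odot>\<^bsub>M\<^esub> y))"
        unfolding y'(4)[symmetric] by (simp add: smult_assoc1[symmetric] R.m_ac)
      finally show ?thesis .
    qed
    have "(u \<otimes> v) \<odot>\<^bsub>M\<^esub> ((s \<otimes> t) \<odot>\<^bsub>M\<^esub> (t' \<odot>\<^bsub>M\<^esub> x' \<oplus>\<^bsub>M\<^esub> s' \<odot>\<^bsub>M\<^esub> y')) =
        (u \<otimes> v) \<odot>\<^bsub>M\<^esub> ((s' \<otimes> t') \<odot>\<^bsub>M\<^esub> (t \<odot>\<^bsub>M\<^esub> x \<oplus>\<^bsub>M\<^esub> s \<odot>\<^bsub>M\<^esub> y))"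
      using 1 2 by (simp add: smult_r_distr)
    then show "frac M S (t' \<odot>\<^bsub>M\<^esub> x' \<oplus>\<^bsub>M\<^esub> s' \<odot>\<^bsub>M\<^esub> y') (s' \<otimes> t') =
        frac M S (t \<odot>\<^bsub>M\<^esub> x \<oplus>\<^bsub>M\<^esub> s \<odot>\<^bsub>M\<^esub> y) (s \<otimes> t)"
      using xs yt x' y' S_mult by (subst frac_eq_iff) auto
  qed
  finally show ?thesis .
qed

lemma frac_add_same:
  assumes "x \<in> carrier M" "y \<in> carrier M" "s \<in> S"
  shows "frac M S x s \<oplus>\<^bsub>L\<^esub> frac M S y s = frac M S (x \<oplus>\<^bsub>M\<^esub> y) s"
  using assms frac_cancel[of "x \<oplus>\<^bsub>M\<^esub> y" s s]
  by (simp add: frac_add smult_r_distr[symmetric] S_carrier)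

lemma frac_zero: "s \<in> S \<Longrightarrow> frac M S \<zero>\<^bsub>M\<^esub> s = \<zero>\<^bsub>L\<^esub>"
  unfolding L_zero using S_one by (intro frac_eqI) (auto simp: S_carrier)

lemma common_denominator2:
  assumes "X \<in> carrier L" "Y \<in> carrier L"
  obtains x y s where "x \<in> carrier M" "y \<in> carrier M" "s \<in> S" "X = frac M S x s" "Y = frac M S y s"
proof -
  obtain x s y t where xy: "x \<in> carrier M" "s \<in> S" "X = frac M S x s" "y \<in> carrier M" "t \<in> S" "Y = frac M S y t"
    using assms by (metis L_cases)
  show ?thesis
    using xy frac_cancel[of x s t] frac_cancel[of y t s] S_mult
    by (intro that[of "t \<odot>\<^bsub>M\<^esub> x" "s \<odot>\<^bsub>M\<^esub> y" "t \<otimes> s"]) (auto simp: S_carrier R.m_comm)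
qed

lemma common_denominator:
  assumes "finite I" "\<And>i. i \<in> I \<Longrightarrow> X i \<in> carrier L"
  shows "\<exists>s\<in>S. \<exists>x. \<forall>i\<in>I. x i \<in> carrier M \<and> X i = frac M S (x i) s"
  using assms
proof (induction I rule: finite_induct)
    case empty
    then show ?case using S_one by auto
  next
    case (insert j I)
    have "\<exists>s\<in>S. \<exists>x. \<forall>i\<in>I. x i \<in> carrier M \<and> X i = frac M S (x i) s"
      using insert by auto
    then obtain s x where s: "s \<in> S" and x: "\<And>i. i \<in> I \<Longrightarrow> x i \<in> carrier M \<and> X i = frac M S (x i) s"
      by blast
    obtain y t where y: "y \<in> carrier M" "t \<in> S" "X j = frac M S y t"
      using insert.prems by (meson L_cases insertI1)
    let ?x = "\<lambda>i. if i = j then s \<odot>\<^bsub>M\<^esub> y else t \<odot>\<^bsub>M\<^esub> x i"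
    have "?x i \<in> carrier M \<and> X i = frac M S (?x i) (t \<otimes> s)" if "i \<in> insert j I" for i
    proof (cases "i = j")
      case True
      then show ?thesis
        using y s frac_cancel[OF y(1,2) s] R.m_comm[of t s] by (simp add: S_carrier)
    next
      case False
      then have "x i \<in> carrier M" "X i = frac M S (x i) s" using that x by auto
      then show ?thesis
        using y s frac_cancel[of "x i" s t] False by (simp add: S_carrier)
    qed
    then show ?case using S_mult[OF y(2) s]
      by (intro bexI[of _ "t \<otimes> s"] exI[of _ ?x]) blast+
qed

lemma L_abelian_group: "abelian_group L"
proof (rule abelian_groupI)
  fix X Y assume XY: "X \<in> carrier L" "Y \<in> carrier L"
  then obtain x y s where xy: "x \<in> carrier M" "y \<in> carrier M" "s \<in> S" "X = frac M S x s" "Y = frac M S y s"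
    by (rule common_denominator2)
  show "X \<oplus>\<^bsub>L\<^esub> Y \<in> carrier L" using xy by (simp add: frac_add_same frac_closed)
  show "X \<oplus>\<^bsub>L\<^esub> Y = Y \<oplus>\<^bsub>L\<^esub> X" using xy by (simp add: frac_add_same M.a_comm)
  fix Z assume "Z \<in> carrier L"
  then obtain z t where z: "z \<in> carrier M" "t \<in> S" "Z = frac M S z t" by (rule L_cases)
  have "X = frac M S (t \<odot>\<^bsub>M\<^esub> x) (t \<otimes> s)" "Y = frac M S (t \<odot>\<^bsub>M\<^esub> y) (t \<otimes> s)" "Z = frac M S (s \<odot>\<^bsub>M\<^esub> z) (t \<otimes> s)"
    using xy z frac_cancel[of x s t] frac_cancel[of y s t] frac_cancel[of z t s] by (auto simp: S_carrier R.m_comm)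
  then show "X \<oplus>\<^bsub>L\<^esub> Y \<oplus>\<^bsub>L\<^esub> Z = X \<oplus>\<^bsub>L\<^esub> (Y \<oplus>\<^bsub>L\<^esub> Z)"
    using xy z S_mult by (simp add: frac_add_same M.a_assoc S_carrier)
next
  show "\<zero>\<^bsub>L\<^esub> \<in> carrier L" using S_one by (simp add: L_zero frac_closed)
next
  fix X assume "X \<in> carrier L"
  then obtain x s where x: "x \<in> carrier M" "s \<in> S" "X = frac M S x s" by (rule L_cases)
  then show "\<zero>\<^bsub>L\<^esub> \<oplus>\<^bsub>L\<^esub> X = X"
    by (simp add: frac_zero[OF x(2), symmetric] frac_add_same)
  have "frac M S (\<ominus>\<^bsub>M\<^esub> x) s \<oplus>\<^bsub>L\<^esub> X = \<zero>\<^bsub>L\<^esub>"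
    using x by (simp add: frac_add_same M.l_neg frac_zero)
  then show "\<exists>Y\<in>carrier L. Y \<oplus>\<^bsub>L\<^esub> X = \<zero>\<^bsub>L\<^esub>"
    using x by (metis M.a_inv_closed frac_closed)
qed

lemma finsum_frac:
  assumes "finite I" "\<And>i. i \<in> I \<Longrightarrow> x i \<in> carrier M" "s \<in> S"
  shows "(\<Oplus>\<^bsub>L\<^esub>i\<in>I. frac M S (x i) s) = frac M S (\<Oplus>\<^bsub>M\<^esub>i\<in>I. x i) s"
proof -
  interpret L: abelian_group L by (rule L_abelian_group)
  show ?thesis
    using assms
  proof (induction I rule: finite_induct)
    case empty
    then show ?case by (simp add: frac_zero)
  next
    case (insert j I)
    then have "x \<in> I \<rightarrow> carrier M" "(\<lambda>i. frac M S (x i) s) \<in> I \<rightarrow> carrier L" by (auto simp: frac_closed)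
    then show ?case using insert by (simp add: frac_closed frac_add_same)
  qed
qed

lemma regular_localization: "localization R (regular_module R) S"
proof -
  have "module R (regular_module R)"
  proof (rule moduleI)
    show "cring R" by (rule R.is_cring)
    show "abelian_group (regular_module R)"
      by (rule abelian_groupI)
        (auto simp: regular_module_def R.a_ac intro: R.l_neg bexI[of _ "\<ominus> _"])
  qed (auto simp: regular_module_def R.l_distr R.r_distr R.m_assoc)
  then show ?thesis
    using S_subset S_one S_mult by (intro localization.intro localization_axioms.intro)
qed

lemma frac_smult:
  assumes as: "a \<in> carrier R" "s \<in> S" and yt: "y \<in> carrier M" "t \<in> S"
  shows "frac (regular_module R) S a s \<odot>\<^bsub>L\<^esub> frac M S y t = frac M S (a \<odot>\<^bsub>M\<^esub> y) (s \<otimes> t)"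
proof -
  interpret reg: localization R "regular_module R" S by (rule regular_localization)
  have reg [simp]: "carrier (regular_module R) = carrier R" "smult (regular_module R) = monoid.mult R"
    by (simp_all add: regular_module_def)
  have "frac (regular_module R) S a s \<odot>\<^bsub>L\<^esub> frac M S y t =
      (\<Union>(a, s)\<in>frac (regular_module R) S a s. \<Union>(y, t)\<in>frac M S y t. frac M S (a \<odot>\<^bsub>M\<^esub> y) (s \<otimes> t))"
    by (simp add: loc_module_def)
  also have "\<dots> = frac M S (a \<odot>\<^bsub>M\<^esub> y) (s \<otimes> t)"
  proof (rule UN_UN_constant)
    show "(a, s) \<in> frac (regular_module R) S a s" "(y, t) \<in> frac M S y t"
      using reg.frac_self[of a s] as frac_self[OF yt] by simp_all
    fix a' s' y' t'
    assume "(a', s') \<in> frac (regular_module R) S a s" "(y', t') \<in> frac M S y t"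
    then obtain u v where
      a': "a' \<in> carrier R" "s' \<in> S" "u \<in> S" "u \<otimes> (s' \<otimes> a) = u \<otimes> (s \<otimes> a')" and
      y': "y' \<in> carrier M" "t' \<in> S" "v \<in> S" "v \<odot>\<^bsub>M\<^esub> (t' \<odot>\<^bsub>M\<^esub> y) = v \<odot>\<^bsub>M\<^esub> (t \<odot>\<^bsub>M\<^esub> y')"
      by (auto simp: mem_frac_iff reg.mem_frac_iff)
    note [simp] = as(1) yt(1) a'(1) y'(1) S_carrier[OF as(2)] S_carrier[OF yt(2)] S_carrier[OF a'(2)]
      S_carrier[OF a'(3)] S_carrier[OF y'(2)] S_carrier[OF y'(3)]
    have "(u \<otimes> v) \<odot>\<^bsub>M\<^esub> ((s \<otimes> t) \<odot>\<^bsub>M\<^esub> (a' \<odot>\<^bsub>M\<^esub> y')) = (u \<otimes> (s \<otimes> a')) \<odot>\<^bsub>M\<^esub> (v \<odot>\<^bsub>M\<^esub> (t \<odot>\<^bsub>M\<^esub> y'))"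
      by (simp add: smult_assoc1[symmetric] R.m_ac)
    also have "\<dots> = (u \<otimes> v) \<odot>\<^bsub>M\<^esub> ((s' \<otimes> t') \<odot>\<^bsub>M\<^esub> (a \<odot>\<^bsub>M\<^esub> y))"
      unfolding a'(4)[symmetric] y'(4)[symmetric] by (simp add: smult_assoc1[symmetric] R.m_ac)
    finally show "frac M S (a' \<odot>\<^bsub>M\<^esub> y') (s' \<otimes> t') = frac M S (a \<odot>\<^bsub>M\<^esub> y) (s \<otimes> t)"
      using as yt a' y' S_mult by (subst frac_eq_iff) auto
  qed
  finally show ?thesis .
qed

text \<open>
Addition in \<open>S\<^sup>-\<^sup>1R\<close> is that of the localized regular module, and multiplication is its scalar
multiplication.
\<close>

lemma loc_ring_as_loc_module:
  "carrier RS = carrier (loc_module R (regular_module R) S)"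
  "add RS = add (loc_module R (regular_module R) S)"
  "zero RS = zero (loc_module R (regular_module R) S)"
  "monoid.mult RS = smult (loc_module R (regular_module R) S)"
  "monoid.one RS = frac (regular_module R) S \<one> \<one>"
  by (simp_all add: loc_ring_def loc_module_def regular_module_def Let_def)

lemma RS_cases:
  assumes "A \<in> carrier RS"
  obtains a s where "a \<in> carrier R" "s \<in> S" "A = frac (regular_module R) S a s"
  using assms by (auto simp: loc_ring_def Let_def)

lemma loc_smult_laws:
  assumes A: "A \<in> carrier RS" and X: "X \<in> carrier L"
  shows "A \<odot>\<^bsub>L\<^esub> X \<in> carrier L"
    and "B \<in> carrier RS \<Longrightarrow> (A \<oplus>\<^bsub>RS\<^esub> B) \<odot>\<^bsub>L\<^esub> X = A \<odot>\<^bsub>L\<^esub> X \<oplus>\<^bsub>L\<^esub> B \<odot>\<^bsub>L\<^esub> X"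
    and "Y \<in> carrier L \<Longrightarrow> A \<odot>\<^bsub>L\<^esub> (X \<oplus>\<^bsub>L\<^esub> Y) = A \<odot>\<^bsub>L\<^esub> X \<oplus>\<^bsub>L\<^esub> A \<odot>\<^bsub>L\<^esub> Y"
    and "B \<in> carrier RS \<Longrightarrow> (A \<otimes>\<^bsub>RS\<^esub> B) \<odot>\<^bsub>L\<^esub> X = A \<odot>\<^bsub>L\<^esub> (B \<odot>\<^bsub>L\<^esub> X)"
proof -
  interpret reg: localization R "regular_module R" S by (rule regular_localization)
  have reg [simp]: "carrier (regular_module R) = carrier R" "smult (regular_module R) = monoid.mult R"
    "add (regular_module R) = add R"
    by (simp_all add: regular_module_def)
  let ?q = "frac (regular_module R) S"
  note [simp] = S_carrier S_mult S_one
  obtain a s where a: "a \<in> carrier R" "s \<in> S" "A = ?q a s"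
    using A by (rule RS_cases)
  obtain x t where x: "x \<in> carrier M" "t \<in> S" "X = frac M S x t"
    using X by (rule L_cases)
  show "A \<odot>\<^bsub>L\<^esub> X \<in> carrier L" using a x by (simp add: frac_smult frac_closed)
  {
    assume Y: "Y \<in> carrier L"
    obtain x y r where xy: "x \<in> carrier M" "y \<in> carrier M" "r \<in> S" "X = frac M S x r" "Y = frac M S y r"
      using X Y by (rule common_denominator2)
    then show "A \<odot>\<^bsub>L\<^esub> (X \<oplus>\<^bsub>L\<^esub> Y) = A \<odot>\<^bsub>L\<^esub> X \<oplus>\<^bsub>L\<^esub> A \<odot>\<^bsub>L\<^esub> Y"
      using a by (simp add: frac_add_same frac_smult smult_r_distr)
  }
  assume B: "B \<in> carrier RS"
  show "(A \<oplus>\<^bsub>RS\<^esub> B) \<odot>\<^bsub>L\<^esub> X = A \<odot>\<^bsub>L\<^esub> X \<oplus>\<^bsub>L\<^esub> B \<odot>\<^bsub>L\<^esub> X"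
  proof -
    obtain a b r where ab: "a \<in> carrier R" "b \<in> carrier R" "r \<in> S" "A = ?q a r" "B = ?q b r"
      using A B unfolding loc_ring_as_loc_module by (metis reg(1) reg.common_denominator2)
    then show ?thesis
      using x reg.frac_add_same[of a b r]
      by (simp add: loc_ring_as_loc_module frac_add_same frac_smult smult_l_distr)
  qed
  obtain b r where b: "b \<in> carrier R" "r \<in> S" "B = ?q b r"
    using B by (rule RS_cases)
  show "(A \<otimes>\<^bsub>RS\<^esub> B) \<odot>\<^bsub>L\<^esub> X = A \<odot>\<^bsub>L\<^esub> (B \<odot>\<^bsub>L\<^esub> X)"
    using a b x reg.frac_smult[of a s b r]
    by (simp add: loc_ring_as_loc_module frac_smult smult_assoc1 R.m_assoc)
qed

lemma loc_smult_one: "X \<in> carrier L \<Longrightarrow> \<one>\<^bsub>RS\<^esub> \<odot>\<^bsub>L\<^esub> X = X"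
  by (auto simp: L_carrier loc_ring_as_loc_module frac_smult S_one S_carrier)

lemma loc_ring_cring: "cring RS"
proof -
  interpret reg: localization R "regular_module R" S by (rule regular_localization)
  have reg [simp]: "carrier (regular_module R) = carrier R" "smult (regular_module R) = monoid.mult R"
    by (simp_all add: regular_module_def)
  interpret regL: abelian_group reg.L by (rule reg.L_abelian_group)
  have ab: "abelian_group RS"
  proof (rule abelian_groupI)
    fix X assume "X \<in> carrier RS"
    then show "\<exists>Y\<in>carrier RS. Y \<oplus>\<^bsub>RS\<^esub> X = \<zero>\<^bsub>RS\<^esub>"
      unfolding loc_ring_as_loc_module using regL.l_neg regL.a_inv_closed by blast
  qed (simp_all add: loc_ring_as_loc_module regL.a_ac)
  have comm: "A \<otimes>\<^bsub>RS\<^esub> B = B \<otimes>\<^bsub>RS\<^esub> A" if A: "A \<in> carrier RS" and B: "B \<in> carrier RS" for A B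
  proof -
    obtain a s where "a \<in> carrier R" "s \<in> S" "A = frac (regular_module R) S a s"
      using A by (rule RS_cases)
    moreover obtain b t where "b \<in> carrier R" "t \<in> S" "B = frac (regular_module R) S b t"
      using B by (rule RS_cases)
    ultimately show ?thesis
      by (simp add: loc_ring_as_loc_module reg.frac_smult R.m_comm S_carrier)
  qed
  note laws = reg.loc_smult_laws[folded loc_ring_as_loc_module] reg.loc_smult_one[folded loc_ring_as_loc_module]
  have one: "\<one>\<^bsub>RS\<^esub> \<in> carrier RS"
    using reg.frac_closed[of \<one> \<one>] S_one by (simp add: loc_ring_as_loc_module)
  show ?thesis
  proof (rule cringI[OF ab])
    show "comm_monoid RS"
      using laws one comm by (intro comm_monoidI) auto
  qed (use laws in auto)
qed

lemma loc_module_module: "module RS L"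
  by (intro moduleI loc_ring_cring L_abelian_group loc_smult_laws loc_smult_one)

text \<open>
A basis of \<open>S\<^sup>-\<^sup>1M\<close> coming from \<open>M\<close>: spanning and independence need to hold only up to multiplication by
elements of \<open>S\<close>. If \<open>0 \<in> S\<close>, both conditions hold for every family, in accordance with the trivial module
over the trivial ring being free of every rank.
\<close>

lemma loc_module_free:
  assumes b: "b \<in> {..<k} \<rightarrow> carrier M"
    and span: "\<And>x. x \<in> carrier M \<Longrightarrow>
      \<exists>w\<in>S. \<exists>v\<in>{..<k} \<rightarrow> carrier R. w \<odot>\<^bsub>M\<^esub> x = (\<Oplus>\<^bsub>M\<^esub>i\<in>{..<k}. v i \<odot>\<^bsub>M\<^esub> b i)"
    and indep: "\<And>v. v \<in> {..<k} \<rightarrow> carrier R \<Longrightarrow> (\<Oplus>\<^bsub>M\<^esub>i\<in>{..<k}. v i \<odot>\<^bsub>M\<^esub> b i) = \<zero>\<^bsub>M\<^esub> \<Longrightarrow>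
      \<exists>w\<in>S. \<forall>i<k. w \<otimes> v i = \<zero>"
  shows "free_of_rank RS L k"
proof -
  interpret reg: localization R "regular_module R" S by (rule regular_localization)
  interpret Lm: module RS L by (rule loc_module_module)
  have reg [simp]: "carrier (regular_module R) = carrier R" "smult (regular_module R) = monoid.mult R"
    "zero (regular_module R) = \<zero>"
    by (simp_all add: regular_module_def)
  let ?q = "frac (regular_module R) S"
  let ?b = "\<lambda>i. frac M S (b i) \<one>"
  have comb: "(\<Oplus>\<^bsub>L\<^esub>i\<in>{..<k}. ?q (v i) s \<odot>\<^bsub>L\<^esub> ?b i) = frac M S (\<Oplus>\<^bsub>M\<^esub>i\<in>{..<k}. v i \<odot>\<^bsub>M\<^esub> b i) s"
    if v: "v \<in> {..<k} \<rightarrow> carrier R" and s: "s \<in> S" for v s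
  proof -
    have "(\<Oplus>\<^bsub>L\<^esub>i\<in>{..<k}. ?q (v i) s \<odot>\<^bsub>L\<^esub> ?b i) = (\<Oplus>\<^bsub>L\<^esub>i\<in>{..<k}. frac M S (v i \<odot>\<^bsub>M\<^esub> b i) s)"
      using b v s S_one by (intro Lm.finsum_cong') (auto simp: Pi_iff frac_smult frac_closed S_carrier)
    also have "\<dots> = frac M S (\<Oplus>\<^bsub>M\<^esub>i\<in>{..<k}. v i \<odot>\<^bsub>M\<^esub> b i) s"
      using b v s by (intro finsum_frac) auto
    finally show ?thesis .
  qed
  have sum_closed: "(\<Oplus>\<^bsub>M\<^esub>i\<in>{..<k}. v i \<odot>\<^bsub>M\<^esub> b i) \<in> carrier M" if "v \<in> {..<k} \<rightarrow> carrier R" for v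
    using that b by (intro M.finsum_closed) auto
  show ?thesis
  proof (rule Lm.free_of_rankI[of ?b])
    show "?b \<in> {..<k} \<rightarrow> carrier L" using b S_one by (auto simp: Pi_iff intro!: frac_closed)
  next
    fix X assume "X \<in> carrier L"
    then obtain x s where x: "x \<in> carrier M" "s \<in> S" "X = frac M S x s" by (rule L_cases)
    obtain w v where w: "w \<in> S" and v: "v \<in> {..<k} \<rightarrow> carrier R"
      and eq: "w \<odot>\<^bsub>M\<^esub> x = (\<Oplus>\<^bsub>M\<^esub>i\<in>{..<k}. v i \<odot>\<^bsub>M\<^esub> b i)"
      using span[OF x(1)] by blast
    have ws: "w \<otimes> s \<in> S" using w x S_mult by simp
    have "X = (\<Oplus>\<^bsub>L\<^esub>i\<in>{..<k}. ?q (v i) (w \<otimes> s) \<odot>\<^bsub>L\<^esub> ?b i)"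
      using frac_cancel[OF x(1,2) w] x(3) eq comb[OF v ws] by simp
    moreover have "(\<lambda>i. ?q (v i) (w \<otimes> s)) \<in> {..<k} \<rightarrow> carrier RS"
      using v ws reg.frac_closed by (auto simp: loc_ring_as_loc_module)
    ultimately show "\<exists>V\<in>{..<k} \<rightarrow> carrier RS. X = (\<Oplus>\<^bsub>L\<^esub>i\<in>{..<k}. V i \<odot>\<^bsub>L\<^esub> ?b i)"
      by (intro bexI[of _ "\<lambda>i. ?q (v i) (w \<otimes> s)"])
  next
    fix V i
    assume V: "V \<in> {..<k} \<rightarrow> carrier RS" and zero: "(\<Oplus>\<^bsub>L\<^esub>i\<in>{..<k}. V i \<odot>\<^bsub>L\<^esub> ?b i) = \<zero>\<^bsub>L\<^esub>" and i: "i < k"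
    have "V i \<in> carrier reg.L" if "i \<in> {..<k}" for i
      using V that by (auto simp: loc_ring_as_loc_module)
    then have "\<exists>s\<in>S. \<exists>v. \<forall>i\<in>{..<k}. v i \<in> carrier R \<and> V i = ?q (v i) s"
      using reg.common_denominator[of "{..<k}" V] by simp
    then obtain v s where s: "s \<in> S" and v: "\<And>i. i < k \<Longrightarrow> v i \<in> carrier R" "\<And>i. i < k \<Longrightarrow> V i = ?q (v i) s"
      by blast
    have v': "v \<in> {..<k} \<rightarrow> carrier R" using v by auto
    have "(\<Oplus>\<^bsub>L\<^esub>i\<in>{..<k}. V i \<odot>\<^bsub>L\<^esub> ?b i) = (\<Oplus>\<^bsub>L\<^esub>i\<in>{..<k}. ?q (v i) s \<odot>\<^bsub>L\<^esub> ?b i)"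
      using v b s S_one by (intro Lm.finsum_cong') (auto simp: Pi_iff frac_smult frac_closed S_carrier S_mult)
    then have "frac M S (\<Oplus>\<^bsub>M\<^esub>i\<in>{..<k}. v i \<odot>\<^bsub>M\<^esub> b i) s = frac M S \<zero>\<^bsub>M\<^esub> s"
      using zero comb[OF v' s] frac_zero[OF s] by simp
    then obtain u where u: "u \<in> S" "u \<odot>\<^bsub>M\<^esub> (s \<odot>\<^bsub>M\<^esub> (\<Oplus>\<^bsub>M\<^esub>i\<in>{..<k}. v i \<odot>\<^bsub>M\<^esub> b i)) = \<zero>\<^bsub>M\<^esub>"
      using s sum_closed[OF v'] by (auto simp: frac_eq_iff S_carrier)
    let ?us = "u \<otimes> s"
    have us: "?us \<in> S" using u s S_mult by simp
    have "(\<Oplus>\<^bsub>M\<^esub>i\<in>{..<k}. (?us \<otimes> v i) \<odot>\<^bsub>M\<^esub> b i) = (\<Oplus>\<^bsub>M\<^esub>i\<in>{..<k}. ?us \<odot>\<^bsub>M\<^esub> (v i \<odot>\<^bsub>M\<^esub> b i))"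
      using v b us by (intro M.finsum_cong') (auto simp: Pi_iff smult_assoc1 S_carrier)
    also have "\<dots> = ?us \<odot>\<^bsub>M\<^esub> (\<Oplus>\<^bsub>M\<^esub>i\<in>{..<k}. v i \<odot>\<^bsub>M\<^esub> b i)"
      using v b us by (intro finsum_smult_ldistr[symmetric]) (auto simp: S_carrier)
    also have "\<dots> = \<zero>\<^bsub>M\<^esub>"
      using u s sum_closed[OF v'] by (simp add: smult_assoc1 S_carrier)
    finally obtain w where w: "w \<in> S" "w \<otimes> (?us \<otimes> v i) = \<zero>"
      using indep[of "\<lambda>i. ?us \<otimes> v i"] v us i by (auto simp: S_carrier)
    have "?q (v i) s = ?q \<zero> s"
      using w us s v(1)[OF i] S_mult u
      by (subst reg.frac_eq_iff) (auto simp: S_carrier R.m_assoc intro!: bexI[of _ "w \<otimes> u"])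
    then show "V i = \<zero>\<^bsub>RS\<^esub>"
      using v(2)[OF i] reg.frac_zero[OF s] by (simp add: loc_ring_as_loc_module)
  qed
qed

end

section \<open>The image of a matrix after inverting a maximal minor\<close>

context cring
begin

lemma idem_ring_hom:
  assumes e: "e \<in> carrier R" "e \<otimes> e = e"
  shows "ring_hom_cring R (idem_ring R e) (\<lambda>a. e \<otimes> a)"
proof (rule ring_hom_cringI)
  let ?E = "idem_ring R e"
  have E [simp]: "carrier ?E = {e \<otimes> a |a. a \<in> carrier R}" "add ?E = add R" "zero ?E = \<zero>"
    "monoid.mult ?E = monoid.mult R" "monoid.one ?E = e"
    by (simp_all add: idem_ring_def)
  have mult: "e \<otimes> a \<otimes> (e \<otimes> b) = e \<otimes> (a \<otimes> b)" if "a \<in> carrier R" "b \<in> carrier R" for a b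
  proof -
    have "e \<otimes> a \<otimes> (e \<otimes> b) = (e \<otimes> e) \<otimes> (a \<otimes> b)" using that e(1) by (simp add: m_ac)
    then show ?thesis by (simp add: e(2))
  qed
  have sub: "x \<in> carrier R" if "x \<in> carrier ?E" for x using that e by auto
  have add_closed: "x \<oplus> y \<in> carrier ?E" if x: "x \<in> carrier ?E" and y: "y \<in> carrier ?E" for x y
  proof -
    obtain a b where "a \<in> carrier R" "b \<in> carrier R" "x = e \<otimes> a" "y = e \<otimes> b" using x y by auto
    then show ?thesis using e by (auto simp: r_distr[symmetric])
  qed
  have mult_closed: "x \<otimes> y \<in> carrier ?E" if x: "x \<in> carrier ?E" and y: "y \<in> carrier ?E" for x y
  proof -
    obtain a b where "a \<in> carrier R" "b \<in> carrier R" "x = e \<otimes> a" "y = e \<otimes> b" using x y by auto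
    then show ?thesis by (auto simp: mult)
  qed
  have unit: "e \<otimes> x = x" if x: "x \<in> carrier ?E" for x
  proof -
    obtain a where "a \<in> carrier R" "x = e \<otimes> a" using x by auto
    then show ?thesis using e by (simp add: m_assoc[symmetric])
  qed
  have e_in: "e \<in> carrier ?E" using e by (auto intro!: exI[of _ \<one>])
  have neg: "\<exists>y\<in>carrier ?E. y \<oplus> x = \<zero>" if x: "x \<in> carrier ?E" for x
  proof -
    obtain a where a: "a \<in> carrier R" "x = e \<otimes> a" using x by auto
    then have "e \<otimes> (\<ominus> a) \<in> carrier ?E" "e \<otimes> (\<ominus> a) \<oplus> x = \<zero>"
      using e by (auto simp: r_distr[symmetric] l_neg)
    then show ?thesis by blast
  qed
  have zero_in: "\<zero> \<in> carrier ?E" using e by (auto intro!: exI[of _ \<zero>])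
  have "abelian_group ?E"
    using add_closed zero_in sub neg
    by (intro abelian_groupI) (simp_all del: E(1) add: a_ac)
  moreover have "comm_monoid ?E"
    using mult_closed e_in sub unit
    by (intro comm_monoidI) (simp_all del: E(1) add: m_ac)
  ultimately show "cring ?E"
    using sub by (intro cringI) (simp_all del: E(1) add: l_distr)
  show "cring R" by (rule is_cring)
  show "(\<lambda>a. e \<otimes> a) \<in> ring_hom R ?E"
    using e by (auto simp: ring_hom_def r_distr mult)
qed

text \<open>
Multiplication by \<open>e\<close> is a ring homomorphism onto \<open>eR\<close>, and determinants commute with
homomorphisms. For the empty matrix both sides are the unit \<open>e\<close> of \<open>eR\<close>.
\<close>

lemma mat_det_idem_ring:
  assumes e: "e \<in> carrier R" "e \<otimes> e = e" and G: "is_mat R m G"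
  shows "mat_det (idem_ring R e) m (\<lambda>i j. e \<otimes> G i j) = e \<otimes> mat_det R m G"
  using ring_hom_cring.hom_mat_det[OF idem_ring_hom[OF e] G] by simp

lemma standard_module_module: "module R (standard_module R n)"
proof -
  let ?V = "standard_module R n"
  have V [simp]: "carrier ?V = {..<n} \<rightarrow>\<^sub>E carrier R" "zero ?V = (\<lambda>i\<in>{..<n}. \<zero>)"
    "add ?V = (\<lambda>v w. \<lambda>i\<in>{..<n}. v i \<oplus> w i)" "smult ?V = (\<lambda>a v. \<lambda>i\<in>{..<n}. a \<otimes> v i)"
    by (simp_all add: standard_module_def)
  have eqI: "v = w" if "v \<in> {..<n} \<rightarrow>\<^sub>E carrier R" "w \<in> {..<n} \<rightarrow>\<^sub>E carrier R" "\<And>i. i < n \<Longrightarrow> v i = w i"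
    for v w :: "nat \<Rightarrow> 'a"
    using that by (intro PiE_ext[of v "{..<n}" "\<lambda>_. carrier R" w]) auto
  have at: "v i \<in> carrier R" if "v \<in> {..<n} \<rightarrow>\<^sub>E carrier R" "i < n" for v i
    using that by auto
  show "module R ?V"
  proof (rule moduleI)
    show "cring R" by (rule is_cring)
    show "abelian_group ?V"
    proof (rule abelian_groupI)
      fix v assume "v \<in> carrier ?V"
      then have v: "v \<in> {..<n} \<rightarrow>\<^sub>E carrier R" by simp
      then have "(\<lambda>i\<in>{..<n}. \<ominus> v i) \<in> carrier ?V" "(\<lambda>i\<in>{..<n}. \<ominus> v i) \<oplus>\<^bsub>?V\<^esub> v = \<zero>\<^bsub>?V\<^esub>"
        using at[OF v] by (auto simp: l_neg fun_eq_iff)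
      then show "\<exists>w\<in>carrier ?V. w \<oplus>\<^bsub>?V\<^esub> v = \<zero>\<^bsub>?V\<^esub>" by blast
    next
      fix u v w assume "u \<in> carrier ?V" "v \<in> carrier ?V" "w \<in> carrier ?V"
      then have "u \<in> {..<n} \<rightarrow>\<^sub>E carrier R" "v \<in> {..<n} \<rightarrow>\<^sub>E carrier R" "w \<in> {..<n} \<rightarrow>\<^sub>E carrier R"
        by simp_all
      note at' = at[OF this(1)] at[OF this(2)] at[OF this(3)]
      show "u \<oplus>\<^bsub>?V\<^esub> v \<in> carrier ?V" using at' by simp
      show "u \<oplus>\<^bsub>?V\<^esub> v \<oplus>\<^bsub>?V\<^esub> w = u \<oplus>\<^bsub>?V\<^esub> (v \<oplus>\<^bsub>?V\<^esub> w)"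
        using at' by (simp add: a_assoc cong: restrict_cong)
      show "u \<oplus>\<^bsub>?V\<^esub> v = v \<oplus>\<^bsub>?V\<^esub> u"
        using at' by (simp add: a_comm cong: restrict_cong)
    next
      fix v assume "v \<in> carrier ?V"
      then have v: "v \<in> {..<n} \<rightarrow>\<^sub>E carrier R" by simp
      show "\<zero>\<^bsub>?V\<^esub> \<oplus>\<^bsub>?V\<^esub> v = v"
        using at[OF v] v by (intro eqI) auto
    qed simp
    fix a b v w
    assume ab: "a \<in> carrier R" "b \<in> carrier R" and "v \<in> carrier ?V" "w \<in> carrier ?V"
    then have v: "v \<in> {..<n} \<rightarrow>\<^sub>E carrier R" and w: "w \<in> {..<n} \<rightarrow>\<^sub>E carrier R" by simp_all
    show "a \<odot>\<^bsub>?V\<^esub> v \<in> carrier ?V" using ab at[OF v] by simp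
    show "(a \<oplus> b) \<odot>\<^bsub>?V\<^esub> v = a \<odot>\<^bsub>?V\<^esub> v \<oplus>\<^bsub>?V\<^esub> b \<odot>\<^bsub>?V\<^esub> v"
      using ab at[OF v] by (simp add: l_distr cong: restrict_cong)
    show "a \<odot>\<^bsub>?V\<^esub> (v \<oplus>\<^bsub>?V\<^esub> w) = a \<odot>\<^bsub>?V\<^esub> v \<oplus>\<^bsub>?V\<^esub> a \<odot>\<^bsub>?V\<^esub> w"
      using ab at[OF v] at[OF w] by (simp add: r_distr cong: restrict_cong)
    show "(a \<otimes> b) \<odot>\<^bsub>?V\<^esub> v = a \<odot>\<^bsub>?V\<^esub> (b \<odot>\<^bsub>?V\<^esub> v)"
      using ab at[OF v] by (simp add: m_assoc cong: restrict_cong)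
  next
    fix v assume "v \<in> carrier ?V"
    then have v: "v \<in> {..<n} \<rightarrow>\<^sub>E carrier R" by simp
    show "\<one> \<odot>\<^bsub>?V\<^esub> v = v"
      using at[OF v] v by (intro eqI) auto
  qed
qed

lemma mat_vec_closed:
  assumes "is_mat R n F" "v \<in> {..<n} \<rightarrow>\<^sub>E carrier R"
  shows "mat_vec R n F v \<in> {..<n} \<rightarrow>\<^sub>E carrier R"
proof -
  have "(\<Oplus>j\<in>{..<n}. F i j \<otimes> v j) \<in> carrier R" if "i < n" for i
    using that assms by (intro finsum_closed funcsetI m_closed) (auto simp: is_matD)
  then show ?thesis by (simp add: mat_vec_def)
qed

lemma carrier_image_module_subset:
  "is_mat R n F \<Longrightarrow> carrier (image_module R n F) \<subseteq> {..<n} \<rightarrow>\<^sub>E carrier R"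
  using mat_vec_closed by (simp add: image_module_def standard_module_def image_subset_iff)

lemma image_module_module:
  assumes F: "is_mat R n F"
  shows "module R (image_module R n F)"
proof -
  let ?V = "standard_module R n"
  interpret V: module R ?V by (rule standard_module_module)
  have V [simp]: "carrier ?V = {..<n} \<rightarrow>\<^sub>E carrier R" "zero ?V = (\<lambda>i\<in>{..<n}. \<zero>)"
    "add ?V = (\<lambda>v w. \<lambda>i\<in>{..<n}. v i \<oplus> w i)" "smult ?V = (\<lambda>a v. \<lambda>i\<in>{..<n}. a \<otimes> v i)"
    by (simp_all add: standard_module_def)
  let ?f = "mat_vec R n F"
  have summand: "F i j \<otimes> v j \<in> carrier R" if "v \<in> {..<n} \<rightarrow>\<^sub>E carrier R" "i < n" "j < n" for v i j
    using that F by (auto simp: is_matD PiE_iff)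
  have closed: "?f v \<in> {..<n} \<rightarrow>\<^sub>E carrier R" if "v \<in> {..<n} \<rightarrow>\<^sub>E carrier R" for v
    using that by (rule mat_vec_closed[OF F])
  have add: "?f v \<oplus>\<^bsub>?V\<^esub> ?f w = ?f (v \<oplus>\<^bsub>?V\<^esub> w)"
    if v: "v \<in> {..<n} \<rightarrow>\<^sub>E carrier R" and w: "w \<in> {..<n} \<rightarrow>\<^sub>E carrier R" for v w
  proof
    fix i
    show "(?f v \<oplus>\<^bsub>?V\<^esub> ?f w) i = ?f (v \<oplus>\<^bsub>?V\<^esub> w) i"
    proof (cases "i < n")
      case True
      have "(\<Oplus>j\<in>{..<n}. F i j \<otimes> (v \<oplus>\<^bsub>?V\<^esub> w) j) = (\<Oplus>j\<in>{..<n}. F i j \<otimes> v j \<oplus> F i j \<otimes> w j)"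
        using v w F True by (intro finsum_cong') (auto simp: r_distr is_matD PiE_iff)
      also have "\<dots> = (\<Oplus>j\<in>{..<n}. F i j \<otimes> v j) \<oplus> (\<Oplus>j\<in>{..<n}. F i j \<otimes> w j)"
        using summand v w True by (intro finsum_addf) auto
      finally show ?thesis using True by (simp add: mat_vec_def)
    qed (simp add: mat_vec_def)
  qed
  have smult: "a \<odot>\<^bsub>?V\<^esub> ?f v = ?f (a \<odot>\<^bsub>?V\<^esub> v)"
    if a: "a \<in> carrier R" and v: "v \<in> {..<n} \<rightarrow>\<^sub>E carrier R" for a v
  proof
    fix i
    show "(a \<odot>\<^bsub>?V\<^esub> ?f v) i = ?f (a \<odot>\<^bsub>?V\<^esub> v) i"
    proof (cases "i < n")
      case True
      have "(\<Oplus>j\<in>{..<n}. F i j \<otimes> (a \<odot>\<^bsub>?V\<^esub> v) j) = (\<Oplus>j\<in>{..<n}. a \<otimes> (F i j \<otimes> v j))"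
        using v a F True by (intro finsum_cong') (auto simp: m_lcomm is_matD PiE_iff)
      also have "\<dots> = a \<otimes> (\<Oplus>j\<in>{..<n}. F i j \<otimes> v j)"
        using summand v a True by (intro finsum_rdistr[symmetric]) auto
      finally show ?thesis using True by (simp add: mat_vec_def)
    qed (simp add: mat_vec_def)
  qed
  have img: "x \<in> ?f ` carrier ?V \<longleftrightarrow> (\<exists>v. v \<in> carrier ?V \<and> x = ?f v)" for x by auto
  have smult_closed: "a \<odot>\<^bsub>?V\<^esub> x \<in> ?f ` carrier ?V"
    if "a \<in> carrier R" "x \<in> ?f ` carrier ?V" for a x
    using that smult V.smult_closed unfolding img by (metis V(1))
  have "submodule (?f ` carrier ?V) R ?V"
  proof (rule V.submoduleI)
    show sub: "?f ` carrier ?V \<subseteq> carrier ?V" using closed by auto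
    show "\<ominus>\<^bsub>?V\<^esub> x \<in> ?f ` carrier ?V" if x: "x \<in> ?f ` carrier ?V" for x
    proof -
      have "x \<in> carrier ?V" using x sub by blast
      then have "(\<ominus> \<one>) \<odot>\<^bsub>?V\<^esub> x = \<ominus>\<^bsub>?V\<^esub> x"
        by (simp only: V.smult_l_minus one_closed V.smult_one)
      then show ?thesis using smult_closed[of "\<ominus> \<one>" x] x by (simp only: a_inv_closed one_closed)
    qed
    have "\<zero>\<^bsub>?V\<^esub> \<in> carrier ?V" by (rule V.zero_closed)
    then show "\<zero>\<^bsub>?V\<^esub> \<in> ?f ` carrier ?V"
      using smult_closed[of \<zero> "?f \<zero>\<^bsub>?V\<^esub>"] V.smult_l_null[of "?f \<zero>\<^bsub>?V\<^esub>"] closed[of "\<zero>\<^bsub>?V\<^esub>"] by auto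
    show "x \<oplus>\<^bsub>?V\<^esub> y \<in> ?f ` carrier ?V" if "x \<in> ?f ` carrier ?V" "y \<in> ?f ` carrier ?V" for x y
      using that add V.a_closed unfolding img by (metis V(1))
  qed (rule smult_closed)
  then show ?thesis
    unfolding image_module_def by (rule submodule.submodule_is_module) (rule V.module_axioms)
qed

lemma finsum_image_module_apply:
  assumes F: "is_mat R n F" and "finite I" "\<And>i. i \<in> I \<Longrightarrow> x i \<in> carrier (image_module R n F)" "l < n"
  shows "(\<Oplus>\<^bsub>image_module R n F\<^esub>i\<in>I. x i) l = (\<Oplus>i\<in>I. x i l)"
proof -
  let ?M = "image_module R n F"
  interpret M: module R ?M by (rule image_module_module[OF F])
  have M: "zero ?M = (\<lambda>i\<in>{..<n}. \<zero>)" "add ?M = (\<lambda>v w. \<lambda>i\<in>{..<n}. v i \<oplus> w i)"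
    by (simp_all add: image_module_def standard_module_def)
  have at: "v l \<in> carrier R" if "v \<in> carrier ?M" for v
    using that \<open>l < n\<close> carrier_image_module_subset[OF F] by auto
  show ?thesis
    using assms(2,3)
  proof (induction I rule: finite_induct)
    case empty
    then show ?case using \<open>l < n\<close> by (simp add: M(1))
  next
    case (insert j I)
    then have "x \<in> I \<rightarrow> carrier ?M" "(\<lambda>i. x i l) \<in> I \<rightarrow> carrier R" using at by auto
    then show ?case using insert at \<open>l < n\<close> by (simp add: M(2))
  qed
qed

lemma powers_localization:
  assumes "module R M" "s \<in> carrier R"
  shows "localization R M (powers R s)"
proof -
  have "s [^] i \<otimes> s [^] j \<in> powers R s" for i j :: nat
    using assms(2) by (auto simp: powers_def nat_pow_mult)
  moreover have "\<one> \<in> powers R s" by (auto simp: powers_def intro!: exI[of _ "0::nat"])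
  moreover have "powers R s \<subseteq> carrier R" using assms(2) by (auto simp: powers_def)
  ultimately show ?thesis
    using assms(1) by (intro localization.intro localization_axioms.intro) (auto simp: powers_def)
qed

text \<open>
The columns of \<open>F\<close> with indices \<open>e 0, \<dots>, e (k - 1)\<close> are a basis of the image after inverting \<open>s\<close>.
They are independent because the adjugate of the minor's matrix, whose determinant is \<open>t\<close>,
recovers \<open>t v\<close> from the coordinates \<open>e 0, \<dots>, e (k - 1)\<close> of the combination with coefficients \<open>v\<close>. They span because each bordered minor, expanded along its last
row, expresses \<open>s F i j\<close> as a combination of the \<open>F i (e b)\<close> whose coefficients do not depend on \<open>i\<close>.
\<close>

lemma image_module_localization_free:
  assumes F: "is_mat R n F" and r: "r \<in> carrier R" and e: "\<And>a. a < k \<Longrightarrow> e a < n"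
    and bordered: "\<And>i j. i < n \<Longrightarrow> j < n \<Longrightarrow>
      r \<otimes> mat_det R (Suc k) (\<lambda>a b. F ((e(k := i)) a) ((e(k := j)) b)) = \<zero>"
    and s: "s = r \<otimes> mat_det R k (\<lambda>a b. F (e a) (e b))"
  shows "free_of_rank (loc_ring R (powers R s)) (loc_module R (image_module R n F) (powers R s)) k"
proof -
  let ?M = "image_module R n F"
  let ?B = "\<lambda>a b. F (e a) (e b)"
  have B: "is_mat R k ?B" using F e by (simp add: is_mat_def)
  define t where "t = mat_det R k ?B"
  have t: "t \<in> carrier R" unfolding t_def by (rule mat_det_closed[OF B])
  have sc: "s \<in> carrier R" using s r t by (simp add: t_def)
  interpret M: module R ?M by (rule image_module_module[OF F])
  interpret loc: localization R ?M "powers R s" by (rule powers_localization[OF M.module_axioms sc])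
  have s_pow: "s \<in> powers R s"
    using sc by (auto simp: powers_def intro!: exI[of _ "1::nat"])
  have smult_M: "smult ?M = (\<lambda>a v. \<lambda>i\<in>{..<n}. a \<otimes> v i)"
    by (simp add: image_module_def standard_module_def)
  have zero_M: "\<zero>\<^bsub>?M\<^esub> = (\<lambda>i\<in>{..<n}. \<zero>)"
    by (simp add: image_module_def standard_module_def)
  have carrier_M: "carrier ?M = mat_vec R n F ` ({..<n} \<rightarrow>\<^sub>E carrier R)"
    by (simp add: image_module_def standard_module_def)
  let ?b = "\<lambda>a. \<lambda>l\<in>{..<n}. F l (e a)"
  have b: "?b a \<in> carrier ?M" if a: "a < k" for a
  proof -
    let ?u = "\<lambda>j\<in>{..<n}. if j = e a then \<one> else \<zero>"
    have "(\<Oplus>j\<in>{..<n}. F l j \<otimes> ?u j) = F l (e a)" if l: "l < n" for l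
    proof -
      have "(\<Oplus>j\<in>{..<n}. F l j \<otimes> ?u j) = F l (e a) \<otimes> ?u (e a)"
        using l e[OF a] F by (intro finsum_single) (auto simp: is_matD)
      then show ?thesis using l e[OF a] F by (simp add: is_matD)
    qed
    then have "?b a = mat_vec R n F ?u" by (auto simp: mat_vec_def fun_eq_iff)
    then show ?thesis unfolding carrier_M by (intro image_eqI[of _ _ ?u]) auto
  qed
  have comb: "(\<Oplus>\<^bsub>?M\<^esub>a\<in>{..<k}. v a \<odot>\<^bsub>?M\<^esub> ?b a) l = (\<Oplus>a\<in>{..<k}. v a \<otimes> F l (e a))"
    if v: "v \<in> {..<k} \<rightarrow> carrier R" and l: "l < n" for v l
  proof -
    have "(\<Oplus>\<^bsub>?M\<^esub>a\<in>{..<k}. v a \<odot>\<^bsub>?M\<^esub> ?b a) l = (\<Oplus>a\<in>{..<k}. (v a \<odot>\<^bsub>?M\<^esub> ?b a) l)"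
      using v l b by (intro finsum_image_module_apply F) (auto simp: Pi_iff)
    also have "\<dots> = (\<Oplus>a\<in>{..<k}. v a \<otimes> F l (e a))"
      using v l F e by (intro finsum_cong') (auto simp: smult_M is_matD Pi_iff)
    finally show ?thesis .
  qed
  show ?thesis
  proof (rule loc.loc_module_free[of ?b])
    show "?b \<in> {..<k} \<rightarrow> carrier ?M" using b by blast
  next
    fix x assume "x \<in> carrier ?M"
    then obtain y where y: "y \<in> {..<n} \<rightarrow>\<^sub>E carrier R" "x = mat_vec R n F y" by (auto simp: carrier_M)
    have y_at: "y j \<in> carrier R" if "j < n" for j using y(1) that by auto
    \<comment> \<open>The cofactors along the last row of the minor bordered by row \<open>i\<close> and column \<open>j\<close>: they do not involve \<open>i\<close>.\<close>
    define D where "D j b = mat_det R (Suc k)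
      (\<lambda>a c. if a < k then F (e a) ((e(k := j)) c) else if c = b then \<one> else \<zero>)" for j b
    have Dmat: "is_mat R (Suc k) (\<lambda>a c. if a < k then F (e a) ((e(k := j)) c) else if c = b then \<one> else \<zero>)"
      if "j < n" for j b
      using that F e by (auto simp: is_mat_def less_Suc_eq)
    have D: "D j b \<in> carrier R" if "j < n" for j b
      unfolding D_def by (rule mat_det_closed[OF Dmat[OF that]])
    \<comment> \<open>The corner entry \<open>F i j\<close> has cofactor \<open>t\<close>.\<close>
    have Dk: "D j k = t" if j: "j < n" for j
    proof -
      have "D j k = mat_det R k (\<lambda>a c. if a < k then F (e a) ((e(k := j)) c) else if c = k then \<one> else \<zero>)"
        unfolding D_def by (intro mat_det_unit_rows Dmat j) auto
      also have "\<dots> = t"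
        unfolding t_def by (intro mat_det_cong[symmetric] B) auto
      finally show ?thesis .
    qed
    define c where "c j b = \<ominus> (r \<otimes> D j b)" for j b
    have c: "c j b \<in> carrier R" if "j < n" for j b using r D[OF that] by (simp add: c_def)
    have column: "s \<otimes> F i j = (\<Oplus>b\<in>{..<k}. c j b \<otimes> F i (e b))" if ij: "i < n" "j < n" for i j
    proof -
      let ?N = "\<lambda>a b. F ((e(k := i)) a) ((e(k := j)) b)"
      have N: "is_mat R (Suc k) ?N" using F e ij by (auto simp: is_mat_def less_Suc_eq)
      have cof: "mat_det R (Suc k) (?N(k := (\<lambda>l. if l = b then \<one> else \<zero>))) = D j b" for b
        unfolding D_def
        by (intro mat_det_cong[symmetric] Dmat ij) (auto simp: less_Suc_eq)
      have Fij: "F i j \<in> carrier R" "\<And>b. b < k \<Longrightarrow> F i (e b) \<in> carrier R"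
        using F ij e by (auto simp: is_matD)
      let ?S = "\<Oplus>b\<in>{..<k}. F i (e b) \<otimes> D j b"
      have S: "?S \<in> carrier R" using Fij D ij by (intro finsum_closed) auto
      have "mat_det R (Suc k) ?N = (\<Oplus>b\<in>{..<Suc k}. ?N k b \<otimes> D j b)"
        using mat_det_row_expansion[OF N, of k] by (simp only: cof lessI)
      also have "\<dots> = F i j \<otimes> t \<oplus> (\<Oplus>b\<in>{..<k}. ?N k b \<otimes> D j b)"
        unfolding lessThan_Suc using Fij D ij t by (subst finsum_insert) (auto simp: Dk)
      also have "(\<Oplus>b\<in>{..<k}. ?N k b \<otimes> D j b) = ?S"
        using Fij D ij by (intro finsum_cong') auto
      finally have "r \<otimes> (F i j \<otimes> t) \<oplus> r \<otimes> ?S = \<zero>"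
        using bordered[OF ij] Fij t r S by (simp add: r_distr)
      moreover have "s \<otimes> F i j = r \<otimes> (F i j \<otimes> t)"
        using s r t Fij by (simp add: t_def[symmetric] m_ac)
      ultimately have "s \<otimes> F i j = \<ominus> (r \<otimes> ?S)"
        using r S Fij t sc by (metis m_closed minus_equality)
      also have "\<dots> = (\<ominus> r) \<otimes> ?S" using r S by (simp add: l_minus)
      also have "\<dots> = (\<Oplus>b\<in>{..<k}. (\<ominus> r) \<otimes> (F i (e b) \<otimes> D j b))"
        using r Fij D ij by (intro finsum_rdistr) auto
      also have "\<dots> = (\<Oplus>b\<in>{..<k}. c j b \<otimes> F i (e b))"
      proof (intro finsum_cong' refl funcsetI)
        fix b assume "b \<in> {..<k}"
        then have cl: "F i (e b) \<in> carrier R" "D j b \<in> carrier R" using Fij D ij by auto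
        then show "c j b \<otimes> F i (e b) \<in> carrier R" using c ij by simp
        show "(\<ominus> r) \<otimes> (F i (e b) \<otimes> D j b) = c j b \<otimes> F i (e b)"
          using r cl unfolding c_def by algebra
      qed
      finally show ?thesis .
    qed
    let ?v = "\<lambda>b. \<Oplus>j\<in>{..<n}. c j b \<otimes> y j"
    have v: "?v \<in> {..<k} \<rightarrow> carrier R" using c y_at by (auto intro!: finsum_closed)
    have "s \<odot>\<^bsub>?M\<^esub> x = (\<Oplus>\<^bsub>?M\<^esub>b\<in>{..<k}. ?v b \<odot>\<^bsub>?M\<^esub> ?b b)" (is "?x = ?z")
    proof (rule PiE_ext[of _ "{..<n}" "\<lambda>_. carrier R"])
      note sub = carrier_image_module_subset[OF F]
      have "?x \<in> carrier ?M" using sc \<open>x \<in> carrier ?M\<close> by (rule M.smult_closed)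
      then show "?x \<in> {..<n} \<rightarrow>\<^sub>E carrier R" using sub by blast
      have "?z \<in> carrier ?M" using v b by (intro M.finsum_closed) (auto simp: Pi_iff)
      then show "?z \<in> {..<n} \<rightarrow>\<^sub>E carrier R" using sub by blast
      fix i assume "i \<in> {..<n}"
      then have i: "i < n" by simp
      have Fi: "\<And>j. j < n \<Longrightarrow> F i j \<in> carrier R" "\<And>b. b < k \<Longrightarrow> F i (e b) \<in> carrier R"
        using F i e by (auto simp: is_matD)
      have "?x i = s \<otimes> (\<Oplus>j\<in>{..<n}. F i j \<otimes> y j)"
        using i by (simp add: smult_M y(2) mat_vec_def)
      also have "\<dots> = (\<Oplus>j\<in>{..<n}. s \<otimes> (F i j \<otimes> y j))"
        using sc Fi y_at by (intro finsum_rdistr) auto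
      also have "\<dots> = (\<Oplus>j\<in>{..<n}. \<Oplus>b\<in>{..<k}. c j b \<otimes> F i (e b) \<otimes> y j)"
      proof (intro finsum_cong' refl funcsetI)
        fix j assume "j \<in> {..<n}"
        then have j: "j < n" by simp
        show "(\<Oplus>b\<in>{..<k}. c j b \<otimes> F i (e b) \<otimes> y j) \<in> carrier R"
          using c Fi y_at j by (intro finsum_closed) auto
        have "s \<otimes> (F i j \<otimes> y j) = (\<Oplus>b\<in>{..<k}. c j b \<otimes> F i (e b)) \<otimes> y j"
          using sc Fi y_at j column[OF i j] by (simp add: m_assoc[symmetric])
        also have "\<dots> = (\<Oplus>b\<in>{..<k}. c j b \<otimes> F i (e b) \<otimes> y j)"
          using c Fi y_at j by (intro finsum_ldistr) auto
        finally show "s \<otimes> (F i j \<otimes> y j) = (\<Oplus>b\<in>{..<k}. c j b \<otimes> F i (e b) \<otimes> y j)" .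
      qed
      also have "\<dots> = (\<Oplus>b\<in>{..<k}. \<Oplus>j\<in>{..<n}. c j b \<otimes> F i (e b) \<otimes> y j)"
        using c Fi y_at by (intro finsum_nested_swap) auto
      also have "\<dots> = (\<Oplus>b\<in>{..<k}. ?v b \<otimes> F i (e b))"
      proof (intro finsum_cong' refl funcsetI)
        fix b assume "b \<in> {..<k}"
        then have b: "b < k" by simp
        show "?v b \<otimes> F i (e b) \<in> carrier R" using v Fi b by auto
        have "?v b \<otimes> F i (e b) = (\<Oplus>j\<in>{..<n}. c j b \<otimes> y j \<otimes> F i (e b))"
          using c Fi y_at b by (intro finsum_ldistr) auto
        also have "\<dots> = (\<Oplus>j\<in>{..<n}. c j b \<otimes> F i (e b) \<otimes> y j)"
          using c Fi y_at b by (intro finsum_cong') (auto simp: m_ac)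
        finally show "(\<Oplus>j\<in>{..<n}. c j b \<otimes> F i (e b) \<otimes> y j) = ?v b \<otimes> F i (e b)" by simp
      qed
      also have "\<dots> = ?z i" by (rule comb[OF v i, symmetric])
      finally show "?x i = ?z i" .
    qed
    then show "\<exists>w\<in>powers R s. \<exists>v\<in>{..<k} \<rightarrow> carrier R. w \<odot>\<^bsub>?M\<^esub> x = (\<Oplus>\<^bsub>?M\<^esub>b\<in>{..<k}. v b \<odot>\<^bsub>?M\<^esub> ?b b)"
      using s_pow v by (intro bexI[of _ s] bexI[of _ ?v])
  next
    fix v assume v: "v \<in> {..<k} \<rightarrow> carrier R" and zero: "(\<Oplus>\<^bsub>?M\<^esub>a\<in>{..<k}. v a \<odot>\<^bsub>?M\<^esub> ?b a) = \<zero>\<^bsub>?M\<^esub>"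
    have v_at: "v a \<in> carrier R" if "a < k" for a using v that by auto
    obtain C where C: "is_mat R k C"
      "\<And>a b. a < k \<Longrightarrow> b < k \<Longrightarrow> (\<Oplus>l\<in>{..<k}. C a l \<otimes> ?B l b) = (if a = b then t else \<zero>)"
      using left_adjugate_exists[OF B] unfolding t_def by blast
    have rows: "(\<Oplus>a\<in>{..<k}. v a \<otimes> ?B l a) = \<zero>" if l: "l < k" for l
      using comb[OF v e[OF l]] zero e[OF l] by (simp add: zero_M)
    note cl = v_at is_matD[OF C(1)] is_matD[OF B]
    have tv: "t \<otimes> v a = \<zero>" if a: "a < k" for a
    proof -
      have "\<zero> = (\<Oplus>l\<in>{..<k}. C a l \<otimes> (\<Oplus>b\<in>{..<k}. v b \<otimes> ?B l b))"
      proof -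
        have "(\<Oplus>l\<in>{..<k}. C a l \<otimes> (\<Oplus>b\<in>{..<k}. v b \<otimes> ?B l b)) = (\<Oplus>l\<in>{..<k}. \<zero>)"
          using rows a cl by (intro finsum_cong') auto
        then show ?thesis by simp
      qed
      also have "\<dots> = (\<Oplus>l\<in>{..<k}. \<Oplus>b\<in>{..<k}. C a l \<otimes> (v b \<otimes> ?B l b))"
        using a cl by (intro finsum_cong' refl finsum_rdistr) (auto intro!: finsum_closed)
      also have "\<dots> = (\<Oplus>b\<in>{..<k}. \<Oplus>l\<in>{..<k}. C a l \<otimes> (v b \<otimes> ?B l b))"
        using a cl by (intro finsum_nested_swap) auto
      also have "\<dots> = (\<Oplus>b\<in>{..<k}. (if a = b then t else \<zero>) \<otimes> v b)"
      proof (intro finsum_cong' refl funcsetI)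
        fix b assume "b \<in> {..<k}"
        then have b: "b < k" by simp
        show "(if a = b then t else \<zero>) \<otimes> v b \<in> carrier R" using t cl b by auto
        have "(\<Oplus>l\<in>{..<k}. C a l \<otimes> ?B l b) \<otimes> v b = (\<Oplus>l\<in>{..<k}. C a l \<otimes> ?B l b \<otimes> v b)"
          using a b cl by (intro finsum_ldistr) auto
        also have "\<dots> = (\<Oplus>l\<in>{..<k}. C a l \<otimes> (v b \<otimes> ?B l b))"
          using a b cl by (intro finsum_cong') (auto simp: m_ac)
        finally show "(\<Oplus>l\<in>{..<k}. C a l \<otimes> (v b \<otimes> ?B l b)) = (if a = b then t else \<zero>) \<otimes> v b"
          using C(2)[OF a b] by simp
      qed
      also have "\<dots> = (if a = a then t else \<zero>) \<otimes> v a"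
        using a t cl by (intro finsum_single) auto
      finally show ?thesis by simp
    qed
    have "s \<otimes> v a = \<zero>" if "a < k" for a
      using tv[OF that] v_at[OF that] r t by (simp add: s t_def[symmetric] m_assoc)
    then show "\<exists>w\<in>powers R s. \<forall>a<k. w \<otimes> v a = \<zero>" using s_pow by blast
  qed
qed

end

lemma sorted_list_of_set_nth_less:
  assumes "I \<subseteq> {..<n::nat}" "a < card I"
  shows "sorted_list_of_set I ! a < n"
proof -
  have "finite I" using assms(1) finite_subset by blast
  then have "sorted_list_of_set I ! a \<in> I"
    using nth_mem[of a "sorted_list_of_set I"] assms(2) by simp
  then show ?thesis using assms(1) by auto
qed

theorem mainTheorem1:
  fixes A :: "('a, 'm) ring_scheme"
    and n :: nat
    and F :: "nat \<Rightarrow> nat \<Rightarrow> 'a"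
    and M :: "('a, nat \<Rightarrow> 'a) module"
    and r :: "nat \<Rightarrow> 'a"
  assumes "cring A"
    and "is_mat A n F"
    and "idempotent_mat A n F"
    and "M = image_module A n F"
    and "\<And>k. r k = coeff (UP A) (rank_polynomial A n F) k"
  shows "fundamental_system_idempotents A n r \<and>
    (\<forall>k\<le>n. \<forall>t \<in> minors (idem_ring A (r k)) n (scale_mat A (r k) F) (k + 1). t = \<zero>\<^bsub>A\<^esub>) \<and>
    (\<forall>k\<le>n. \<forall>s \<in> diagonal_minors (idem_ring A (r k)) n (scale_mat A (r k) F) k.
      free_of_rank (loc_ring A (powers A s)) (loc_module A M (powers A s)) k)"
proof -
  interpret A: cring A by fact
  interpret UP_cring A "UP A" by (intro UP_cring.intro A.is_cring)
  note F = assms(2,3)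
  have r: "r = rank_idem n F"
    using assms(5) rank_polynomial_eq_rank_det[OF F(1)] by auto
  have rc: "r k \<in> carrier A" for k unfolding r by (rule rank_idem_closed[OF F(1)])
  have rr: "r i \<otimes>\<^bsub>A\<^esub> r j = (if i = j then r i else \<zero>\<^bsub>A\<^esub>)" if "i \<le> n" "j \<le> n" for i j
    unfolding r by (rule rank_idem_mult[OF F that])
  have sub: "mat_det (idem_ring A (r k)) m (submat (scale_mat A (r k) F) I J) =
      r k \<otimes>\<^bsub>A\<^esub> mat_det A m (submat F I J)"
    if "k \<le> n" "I \<subseteq> {..<n}" "J \<subseteq> {..<n}" "card I = m" "card J = m" for k m I J
  proof -
    have "is_mat A m (submat F I J)"
      using that F(1) by (auto simp: is_mat_def submat_def sorted_list_of_set_nth_less)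
    then have "mat_det (idem_ring A (r k)) m (\<lambda>i j. r k \<otimes>\<^bsub>A\<^esub> submat F I J i j) =
        r k \<otimes>\<^bsub>A\<^esub> mat_det A m (submat F I J)"
      using rc rr[of k k] that(1) by (intro A.mat_det_idem_ring) auto
    moreover have "submat (scale_mat A (r k) F) I J = (\<lambda>i j. r k \<otimes>\<^bsub>A\<^esub> submat F I J i j)"
      by (simp add: fun_eq_iff submat_def scale_mat_def)
    ultimately show ?thesis by simp
  qed
  have "fundamental_system_idempotents A n r"
    unfolding fundamental_system_idempotents_def
    using rc rr rank_idem_sum[OF F(1)] by (auto simp: r)
  moreover have "t = \<zero>\<^bsub>A\<^esub>"
    if k: "k \<le> n" and t: "t \<in> minors (idem_ring A (r k)) n (scale_mat A (r k) F) (k + 1)" for k t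
  proof -
    obtain I J where IJ: "I \<subseteq> {..<n}" "J \<subseteq> {..<n}" "card I = Suc k" "card J = Suc k"
      and "t = mat_det (idem_ring A (r k)) (Suc k) (submat (scale_mat A (r k) F) I J)"
      using t by (auto simp: minors_def)
    then have "t = r k \<otimes>\<^bsub>A\<^esub> mat_det A (Suc k) (submat F I J)" using sub[OF k IJ] by simp
    also have "\<dots> = \<zero>\<^bsub>A\<^esub>"
      unfolding r submat_def[abs_def]
      using IJ by (intro rank_idem_minor_zero F k sorted_list_of_set_nth_less) auto
    finally show ?thesis .
  qed
  moreover have "free_of_rank (loc_ring A (powers A s)) (loc_module A M (powers A s)) k"
    if k: "k \<le> n" and s: "s \<in> diagonal_minors (idem_ring A (r k)) n (scale_mat A (r k) F) k" for k s
  proof -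
    obtain I where I: "I \<subseteq> {..<n}" "card I = k"
      and "s = mat_det (idem_ring A (r k)) k (submat (scale_mat A (r k) F) I I)"
      using s by (auto simp: diagonal_minors_def)
    then have s: "s = r k \<otimes>\<^bsub>A\<^esub> mat_det A k (submat F I I)" using sub[OF k I(1) I(1) I(2) I(2)] by simp
    let ?e = "\<lambda>a. sorted_list_of_set I ! a"
    have e: "?e a < n" if "a < k" for a using sorted_list_of_set_nth_less[OF I(1)] I(2) that by simp
    show ?thesis
      unfolding assms(4)
    proof (rule A.image_module_localization_free[OF F(1) rc[of k] e])
      show "r k \<otimes>\<^bsub>A\<^esub> mat_det A (Suc k) (\<lambda>a b. F ((?e(k := i)) a) ((?e(k := j)) b)) = \<zero>\<^bsub>A\<^esub>"
        if "i < n" "j < n" for i j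
        unfolding r using that e by (intro rank_idem_minor_zero F k) (auto simp: less_Suc_eq)
      show "s = r k \<otimes>\<^bsub>A\<^esub> mat_det A k (\<lambda>a b. F (?e a) (?e b))"
        using s by (simp add: submat_def[abs_def])
    qed
  qed
  ultimately show ?thesis by blast
qed

end
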